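(* Let $\mathbb{K}$ be a field of characteristic $0$, let $I$ be a curved Lie ideal of a curved DG-algebra $(A,d,R)$ over $\mathbb{K}$ and let $\operatorname{Tr}\colon A\to C$ be a trace map. Then for every integer $k\ge 0$ there exists an $L_\infty$ morphism \[ \eta^k\colon \frac{A}{I}\rightsquigarrow \frac{C}{\operatorname{Tr}(I^{(k+1)}A)}[2k]\] with linear component \[ \eta^k_1\colon \frac{A}{I}\to \frac{C}{\operatorname{Tr}(I^{(k+1)}A)}[2k],\qquad \eta^k_1(x)=\frac{1}{k!}\operatorname{Tr}(R^{k}x).\]
   Context: Graded algebras are graded associative algebras with unit over $\mathbb{K}$; $[a,b]=ab-(-1)^{|a||b|}ba$ is the graded commutator. A curved DG-algebra $(A,d,R)$ is a graded algebra $A$ with a degree one derivation $d\colon A^*\to A^{*+1}$ and an element $R\in A^2$ (the curvature) such that $d(R)=0$ and $d^2(x)=[R,x]$ for all $x\in A$. A curved Lie ideal of $A$ is a homogeneous Lie ideal $I\subset A$ (i.e. $[A,I]\subset I$) such that $d(I)\subset I$ and $R\in I$. Then $A/I$ is a DG-Lie algebra. $[A,A]\subset A$ is the linear span of all graded commutators. For a subspace $E\subset A$, $E^{(k)}$ ($k\ge1$) is the linear span of all products $e_1\cdots e_k$ with $e_i\in E$, and $EA$ is the linear span of all products $ea$, $e\in E,a\in A$. A trace map on $(A,d,R)$ is the data of a complex of vector spaces $(C,\delta)$ and a morphism of graded vector spaces $\operatorname{Tr}\colon A\to C$ such that $\operatorname{Tr}\circ d=\delta\circ\operatorname{Tr}$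 and $\operatorname{Tr}([A,A])=0$. The complex $\frac{C}{\operatorname{Tr}(I^{(k+1)}A)}[2k]$ (with $V[n]^i=V^{n+i}$) is regarded as a DG-Lie algebra with trivial bracket. In the formula for $\eta_1^k$, $x\in A/I$ is replaced by any lifting to $A$ (the result does not depend on it). $L_\infty$ morphisms into a DG-Lie algebra $(M,d_M,0)$ with trivial bracket: for a DG-Lie algebra $(L,\bar\partial,[-,-])$, let $S(L[1])$ be the symmetric coalgebra with the degree one coderivation $Q$ with $Q(1)=0$ and $Q(x_1\odot\cdots\odot x_n)=\sum_{i}(-1)^{i+|x_1|+\cdots+|x_{i-1}|}x_1\odot\cdots\odot\bar\partial x_i\odot\cdots\odot x_n+\sum_{\tau\in S(2,n-2)}\varepsilon(\tau)(-1)^{|x_{\tau(1)}|}[x_{\tau(1)},x_{\tau(2)}]\odot x_{\tau(3)}\odot\cdots\odot x_{\tau(n)}$, where $|x|$ is the degree in $L$, $S(2,n-2)$ is the set of $(2,n-2)$-unshuffles and $\varepsilon(\tau)$ is the symmetric Koszul sign in $L[1]^{\odot n}$. An $L_\infty$ morphism $f\colon L\rightsquigarrow M$ is a degree $0$ linear map $f\colon S(L[1])\to M[1]$ with $f(1)=0$ and $-d_M f=fQ$; equivalently it is the corestriction of a morphism of DG-coalgebras $S(L[1])\to S(M[1])$. Its Taylor coefficients are the restrictions $f_i\colon L[1]^{\odot i}\to M[1]$, and $f_1$, viewed as a map $L\to M$, is its linear component. *)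

theory Defs
  imports Complex_Main
    "HOL-Library.Set_Algebras"
    "HOL-Library.Poly_Mapping"
    "HOL-Combinatorics.Permutations"
begin

section \<open>Graded vector spaces and complexes\<close>

definition is_decomposition :: "(int \<Rightarrow> 'v::ab_group_add set) \<Rightarrow> 'v \<Rightarrow> (int \<Rightarrow> 'v) \<Rightarrow> bool"
  where "is_decomposition G x f \<longleftrightarrow>
    (\<forall>i. f i \<in> G i) \<and> finite {i. f i \<noteq> 0} \<and> x = (\<Sum>i | f i \<noteq> 0. f i)"

definition component :: "(int \<Rightarrow> 'v::ab_group_add set) \<Rightarrow> 'v \<Rightarrow> int \<Rightarrow> 'v"
  where "component G x = (THE f. is_decomposition G x f)"

locale graded_vector_space = vector_space scale
  for scale :: "'k::field \<Rightarrow> 'v::ab_group_add \<Rightarrow> 'v" +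
  fixes G :: "int \<Rightarrow> 'v set"
  assumes subspace_component: "module.subspace scale (G i)"
    and direct_sum: "\<exists>!f. is_decomposition G x f"

locale cochain_complex = graded_vector_space scale G
  for scale :: "'k::field \<Rightarrow> 'v::ab_group_add \<Rightarrow> 'v" and G :: "int \<Rightarrow> 'v set" +
  fixes \<delta> :: "'v \<Rightarrow> 'v"
  assumes linear_diff: "Vector_Spaces.linear scale scale \<delta>"
    and degree_diff: "x \<in> G i \<Longrightarrow> \<delta> x \<in> G (i + 1)"
    and diff_diff: "\<delta> (\<delta> x) = 0"


section \<open>Curved DG-algebras, curved Lie ideals, trace maps\<close>

text \<open>The sort \<open>{ring, monoid_mult}\<close> (unlike \<open>ring_1\<close>) admits the zero algebra.\<close>

locale graded_algebra = graded_vector_space scale G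
  for scale :: "'k::field \<Rightarrow> 'a::{ring,monoid_mult} \<Rightarrow> 'a" and G :: "int \<Rightarrow> 'a set" +
  assumes scale_mult_left: "scale c x * y = scale c (x * y)"
    and scale_mult_right: "x * scale c y = scale c (x * y)"
    and one_degree: "1 \<in> G 0"
    and mult_degree: "x \<in> G i \<Longrightarrow> y \<in> G j \<Longrightarrow> x * y \<in> G (i + j)"

text \<open>The bilinear extension of $[a,b] = ab - (-1)^{ij} ba$ for $a \in A^i$, $b \in A^j$.\<close>

definition graded_commutator ::
    "('k::field \<Rightarrow> 'a::{ring,monoid_mult} \<Rightarrow> 'a) \<Rightarrow> (int \<Rightarrow> 'a set) \<Rightarrow> 'a \<Rightarrow> 'a \<Rightarrow> 'a"
  where "graded_commutator scale G a b =
    (\<Sum>i | component G a i \<noteq> 0. \<Sum>j | component G b j \<noteq> 0.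
       component G a i * component G b j
       - scale ((-1) powi (i * j)) (component G b j * component G a i))"

locale curved_dg_algebra = graded_algebra scale G
  for scale :: "'k::field \<Rightarrow> 'a::{ring,monoid_mult} \<Rightarrow> 'a" and G :: "int \<Rightarrow> 'a set" +
  fixes d :: "'a \<Rightarrow> 'a" and R :: 'a
  assumes linear_d: "Vector_Spaces.linear scale scale d"
    and degree_d: "x \<in> G i \<Longrightarrow> d x \<in> G (i + 1)"
    and leibniz: "x \<in> G i \<Longrightarrow> d (x * y) = d x * y + scale ((-1) powi i) (x * d y)"
    and curvature_degree: "R \<in> G 2"
    and d_curvature: "d R = 0"
    and d_d: "d (d x) = graded_commutator scale G R x"

locale curved_lie_ideal = curved_dg_algebra scale G d R
  for scale :: "'k::field \<Rightarrow> 'a::{ring,monoid_mult} \<Rightarrow> 'a" and G :: "int \<Rightarrow> 'a set"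
    and d :: "'a \<Rightarrow> 'a" and R :: 'a +
  fixes I :: "'a set"
  assumes subspace_ideal: "module.subspace scale I"
    and homogeneous_ideal: "x \<in> I \<Longrightarrow> component G x i \<in> I"
    and lie_ideal: "x \<in> I \<Longrightarrow> graded_commutator scale G a x \<in> I"
    and d_ideal: "x \<in> I \<Longrightarrow> d x \<in> I"
    and curvature_ideal: "R \<in> I"

definition commutator_space ::
    "('k::field \<Rightarrow> 'a::{ring,monoid_mult} \<Rightarrow> 'a) \<Rightarrow> (int \<Rightarrow> 'a set) \<Rightarrow> 'a set"
  where "commutator_space scale G =
    module.span scale {graded_commutator scale G a b | a b. True}"

definition power_space ::
    "('k::field \<Rightarrow> 'a::{ring,monoid_mult} \<Rightarrow> 'a) \<Rightarrow> 'a set \<Rightarrow> nat \<Rightarrow> 'a set"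
  where "power_space scale E k =
    module.span scale {prod_list es | es. length es = k \<and> set es \<subseteq> E}"

definition right_multiples ::
    "('k::field \<Rightarrow> 'a::{ring,monoid_mult} \<Rightarrow> 'a) \<Rightarrow> 'a set \<Rightarrow> 'a set"
  where "right_multiples scale E = module.span scale {e * a | e a. e \<in> E}"

locale trace_map = A: curved_dg_algebra scaleA GA d R + C: cochain_complex scaleC GC \<delta>
  for scaleA :: "'k::field \<Rightarrow> 'a::{ring,monoid_mult} \<Rightarrow> 'a" and GA :: "int \<Rightarrow> 'a set"
    and d :: "'a \<Rightarrow> 'a" and R :: 'a
    and scaleC :: "'k \<Rightarrow> 'c::ab_group_add \<Rightarrow> 'c" and GC :: "int \<Rightarrow> 'c set"
    and \<delta> :: "'c \<Rightarrow> 'c" +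
  fixes Tr :: "'a \<Rightarrow> 'c"
  assumes linear_Tr: "Vector_Spaces.linear scaleA scaleC Tr"
    and degree_Tr: "x \<in> GA i \<Longrightarrow> Tr x \<in> GC i"
    and Tr_d: "Tr (d x) = \<delta> (Tr x)"
    and Tr_commutator: "x \<in> commutator_space scaleA GA \<Longrightarrow> Tr x = 0"


section \<open>Quotients\<close>

text \<open>Quotient spaces consist of cosets, so they (and everything built from them) are given by
  explicit carriers and operations. These records are raw data, without axioms.\<close>

record ('k, 'v) graded_space =
  carr :: "'v set"
  null :: 'v
  add :: "'v \<Rightarrow> 'v \<Rightarrow> 'v"
  smult :: "'k \<Rightarrow> 'v \<Rightarrow> 'v"
  homog :: "int \<Rightarrow> 'v set"

record ('k, 'v) dg_space = "('k, 'v) graded_space" +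
  diff :: "'v \<Rightarrow> 'v"

record ('k, 'v) dg_lie = "('k, 'v) dg_space" +
  bracket :: "'v \<Rightarrow> 'v \<Rightarrow> 'v"

text \<open>For subspaces \<open>N \<subseteq> U\<close>, the quotient \<open>U/N\<close> with the grading induced by \<open>G\<close>.
  In all the unions below the sets united coincide whenever the operation descends to
  cosets, as in HOL's theory of equivalence relations.\<close>

definition quotient_space ::
    "('k \<Rightarrow> 'v::ab_group_add \<Rightarrow> 'v) \<Rightarrow> (int \<Rightarrow> 'v set) \<Rightarrow> 'v set \<Rightarrow> 'v set \<Rightarrow> ('k, 'v set) graded_space"
  where "quotient_space scale G U N =
    \<lparr>carr = (\<lambda>x. x +o N) ` U,
     null = N,
     add = (\<lambda>X Y. \<Union>x\<in>X. \<Union>y\<in>Y. (x + y) +o N),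
     smult = (\<lambda>c X. \<Union>x\<in>X. scale c x +o N),
     homog = (\<lambda>i. (\<lambda>x. x +o N) ` G i)\<rparr>"

definition quotient_complex ::
    "('k \<Rightarrow> 'v::ab_group_add \<Rightarrow> 'v) \<Rightarrow> (int \<Rightarrow> 'v set) \<Rightarrow> ('v \<Rightarrow> 'v) \<Rightarrow> 'v set \<Rightarrow> ('k, 'v set) dg_space"
  where "quotient_complex scale G \<delta> N =
    graded_space.extend (quotient_space scale G UNIV N)
      (dg_space.fields (\<lambda>X. \<Union>x\<in>X. \<delta> x +o N))"

definition quotient_dg_lie ::
    "('k::field \<Rightarrow> 'a::{ring,monoid_mult} \<Rightarrow> 'a) \<Rightarrow> (int \<Rightarrow> 'a set) \<Rightarrow> ('a \<Rightarrow> 'a) \<Rightarrow> 'a set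
      \<Rightarrow> ('k, 'a set) dg_lie"
  where "quotient_dg_lie scale G d I =
    dg_space.extend (quotient_complex scale G d I)
      (dg_lie.fields (\<lambda>X Y. \<Union>x\<in>X. \<Union>y\<in>Y. graded_commutator scale G x y +o I))"

text \<open>$V[n]^i = V^{n+i}$, with differential $(-1)^n d_V$ in the case of complexes.\<close>

definition shift :: "int \<Rightarrow> ('k, 'v, 'z) graded_space_scheme \<Rightarrow> ('k, 'v) graded_space"
  where "shift n V =
    \<lparr>carr = carr V, null = null V, add = add V, smult = smult V, homog = (\<lambda>i. homog V (n + i))\<rparr>"

definition shift_complex :: "int \<Rightarrow> ('k::field, 'v, 'z) dg_space_scheme \<Rightarrow> ('k, 'v) dg_space"
  where "shift_complex n V =
    graded_space.extend (shift n V) (dg_space.fields (\<lambda>x. smult V ((-1) powi n) (diff V x)))"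

text \<open>Linear maps of degree 0.\<close>

definition graded_linear_map ::
    "('k, 'v, 'y) graded_space_scheme \<Rightarrow> ('k, 'w, 'z) graded_space_scheme \<Rightarrow> ('v \<Rightarrow> 'w) \<Rightarrow> bool"
  where "graded_linear_map V W f \<longleftrightarrow>
    (\<forall>x \<in> carr V. f x \<in> carr W) \<and>
    (\<forall>x \<in> carr V. \<forall>y \<in> carr V. f (add V x y) = add W (f x) (f y)) \<and>
    (\<forall>c. \<forall>x \<in> carr V. f (smult V c x) = smult W c (f x)) \<and>
    (\<forall>i. \<forall>x \<in> homog V i. f x \<in> homog W i)"


section \<open>The symmetric coalgebra as a graded vector space\<close>

text \<open>\<open>S(V)\<close> is the quotient of the free vector space on words in \<open>V\<close> by the relations of
  multilinearity and of graded commutativity $x \odot y = (-1)^{|x||y|} y \odot x$.\<close>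

definition free_scale :: "'k::field \<Rightarrow> ('w \<Rightarrow>\<^sub>0 'k) \<Rightarrow> ('w \<Rightarrow>\<^sub>0 'k)"
  where "free_scale c p = Poly_Mapping.map ((*) c) p"

abbreviation word :: "'v list \<Rightarrow> ('v list \<Rightarrow>\<^sub>0 'k::field)"
  where "word xs \<equiv> Poly_Mapping.single xs 1"

inductive_set sym_relators :: "('k::field, 'v, 'z) graded_space_scheme \<Rightarrow> ('v list \<Rightarrow>\<^sub>0 'k) set"
  for V :: "('k, 'v, 'z) graded_space_scheme"
  where
    additive: "\<lbrakk>set us \<subseteq> carr V; set ws \<subseteq> carr V; x \<in> carr V; y \<in> carr V\<rbrakk> \<Longrightarrow>
      word (us @ add V x y # ws) - word (us @ x # ws) - word (us @ y # ws) \<in> sym_relators V"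
  | homogeneous: "\<lbrakk>set us \<subseteq> carr V; set ws \<subseteq> carr V; x \<in> carr V\<rbrakk> \<Longrightarrow>
      word (us @ smult V c x # ws) - free_scale c (word (us @ x # ws)) \<in> sym_relators V"
  | commutative: "\<lbrakk>set us \<subseteq> carr V; set ws \<subseteq> carr V; x \<in> homog V i; y \<in> homog V j\<rbrakk> \<Longrightarrow>
      word (us @ x # y # ws) - free_scale ((-1) powi (i * j)) (word (us @ y # x # ws))
        \<in> sym_relators V"

definition sym_null :: "('k::field, 'v, 'z) graded_space_scheme \<Rightarrow> ('v list \<Rightarrow>\<^sub>0 'k) set"
  where "sym_null V = module.span free_scale (sym_relators V)"

definition sym_space ::
    "('k::field, 'v, 'z) graded_space_scheme \<Rightarrow> ('k, ('v list \<Rightarrow>\<^sub>0 'k) set) graded_space"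
  where "sym_space V =
    quotient_space free_scale
      (\<lambda>m. module.span free_scale
         {word xs | xs es. list_all2 (\<lambda>x e. x \<in> homog V e) xs es \<and> sum_list es = m})
      {p. \<forall>xs \<in> Poly_Mapping.keys p. set xs \<subseteq> carr V}
      (sym_null V)"

text \<open>The class of \<open>p\<close> in \<open>S(V)\<close>; in particular \<open>sym_class V (word [x\<^sub>1, \<dots>, x\<^sub>n])\<close> is
  $x_1 \odot \cdots \odot x_n$, and \<open>sym_class V (word [])\<close> is \<open>1\<close>.\<close>

definition sym_class ::
    "('k::field, 'v, 'z) graded_space_scheme \<Rightarrow> ('v list \<Rightarrow>\<^sub>0 'k) \<Rightarrow> ('v list \<Rightarrow>\<^sub>0 'k) set"
  where "sym_class V p = p +o sym_null V"


section \<open>$L_\infty$ morphisms to a DG-Lie algebra with trivial bracket\<close>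

definition unshuffles :: "nat \<Rightarrow> nat \<Rightarrow> (nat \<Rightarrow> nat) set"
  where "unshuffles p q =
    {\<tau>. \<tau> permutes {..<p + q} \<and> strict_mono_on {..<p} \<tau> \<and> strict_mono_on {p..<p + q} \<tau>}"

text \<open>The sign \<open>\<epsilon>(\<tau>)\<close> with
  $x_0 \odot \cdots \odot x_{n-1} = \varepsilon(\tau)\, x_{\tau(0)} \odot \cdots \odot x_{\tau(n-1)}$,
  where \<open>es\<close> lists the degrees of the \<open>x\<^sub>i\<close>.\<close>

definition koszul_sign :: "int list \<Rightarrow> (nat \<Rightarrow> nat) \<Rightarrow> 'k::field"
  where "koszul_sign es \<tau> =
    (\<Prod>(i, j) \<in> {(i, j). i < j \<and> j < length es \<and> \<tau> j < \<tau> i}. (-1) powi (es ! \<tau> i * es ! \<tau> j))"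

text \<open>\<open>Q(x\<^sub>1 \<odot> \<dots> \<odot> x\<^sub>n)\<close> for homogeneous \<open>xs\<close> of degrees \<open>ds\<close> in \<open>L\<close>. Positions count from 0
  here, whence the summand 1 in the first exponent; the Koszul sign uses the degrees in
  \<open>L[1]\<close>, which are smaller by 1.\<close>

definition codifferential_word ::
    "('k::field, 'v, 'z) dg_lie_scheme \<Rightarrow> 'v list \<Rightarrow> int list \<Rightarrow> ('v list \<Rightarrow>\<^sub>0 'k)"
  where "codifferential_word L xs ds =
    (\<Sum>i<length xs.
       free_scale ((-1) powi (int i + 1 + (\<Sum>j<i. ds ! j))) (word (xs[i := diff L (xs ! i)]))) +
    (if 2 \<le> length xs then
       (\<Sum>\<tau> \<in> unshuffles 2 (length xs - 2).
          free_scale (koszul_sign (map (\<lambda>e. e - 1) ds) \<tau> * (-1) powi (ds ! \<tau> 0))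
            (word (bracket L (xs ! \<tau> 0) (xs ! \<tau> 1) # map (\<lambda>i. xs ! \<tau> i) [2..<length xs])))
     else 0)"

text \<open>\<open>Q\<close> is the degree one endomorphism of \<open>S(L[1])\<close> given by the formula above. It is
  unique, since \<open>S(L[1])\<close> is spanned by products of homogeneous elements.\<close>

definition codifferential ::
    "('k::field, 'v, 'z) dg_lie_scheme \<Rightarrow> (('v list \<Rightarrow>\<^sub>0 'k) set \<Rightarrow> ('v list \<Rightarrow>\<^sub>0 'k) set) \<Rightarrow> bool"
  where "codifferential L Q \<longleftrightarrow>
    graded_linear_map (sym_space (shift 1 L)) (shift 1 (sym_space (shift 1 L))) Q \<and>
    Q (sym_class (shift 1 L) (word [])) = null (sym_space (shift 1 L)) \<and>
    (\<forall>xs ds. list_all2 (\<lambda>x e. x \<in> homog L e) xs ds \<longrightarrow>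
       Q (sym_class (shift 1 L) (word xs)) = sym_class (shift 1 L) (codifferential_word L xs ds))"

text \<open>$f \colon S(L[1]) \to M[1]$ linear of degree 0 with $f(1) = 0$ and $f Q = -d_M f$.\<close>

definition L_infinity_morphism ::
    "('k::field, 'v, 'y) dg_lie_scheme \<Rightarrow> ('k, 'w, 'z) dg_space_scheme
      \<Rightarrow> (('v list \<Rightarrow>\<^sub>0 'k) set \<Rightarrow> 'w) \<Rightarrow> bool"
  where "L_infinity_morphism L M f \<longleftrightarrow>
    graded_linear_map (sym_space (shift 1 L)) (shift 1 M) f \<and>
    f (sym_class (shift 1 L) (word [])) = null M \<and>
    (\<exists>Q. codifferential L Q \<and>
       (\<forall>s \<in> carr (sym_space (shift 1 L)). f (Q s) = smult M (-1) (diff M (f s))))"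

definition linear_component ::
    "('k::field, 'v, 'z) graded_space_scheme \<Rightarrow> (('v list \<Rightarrow>\<^sub>0 'k) set \<Rightarrow> 'w) \<Rightarrow> 'v \<Rightarrow> 'w"
  where "linear_component L f x = f (sym_class (shift 1 L) (word [x]))"

end

theory Submission
  imports Defs
begin

text \<open>The morphism is a Chern--Simons form. Put $L = A/I$ and consider the linear maps from the
symmetric coalgebra $S(L[1])$ to $A$. Under convolution and with the
differential $D\varphi = d\varphi - (-1)^{|\varphi|}\varphi Q$, where $Q$ is the Chevalley--Eilenberg
codifferential, they form again a curved DG-algebra with curvature \<open>R\<close>. A degreewise linear
section of $A \to A/I$, extended by zero to words of length different from one, is an element \<open>sec\<close>
of degree one in this algebra. Its curvature $R + D(\mathrm{sec}) + \mathrm{sec}^2$ measures the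
failure of the section to be a morphism of curved Lie algebras, and since $A \to A/I$ is one, it
takes values in \<open>I\<close> (\<open>curv_in_ideal\<close>).

Now apply the transgression argument to $R_t = R + t\,D(\mathrm{sec}) + t^2\,\mathrm{sec}^2$. The
Bianchi identity $D R_t = t\,[R_t, \mathrm{sec}]$ and the cyclicity of the trace give
$\frac{d}{dt}\operatorname{Tr}(R_t^{k+1}) = (k+1)\,D\operatorname{Tr}(\mathrm{sec}\,R_t^k)$. Both
$R_0 = R$ and $R_1$ take values in \<open>I\<close>, so the form
$f = \frac{1}{k!}\int_0^1 \operatorname{Tr}(\mathrm{sec}\,R_t^k)\,dt$ satisfies
$\delta f + f Q = \frac{1}{(k+1)!}(\operatorname{Tr} R_1^{k+1} - \operatorname{Tr} R_0^{k+1})$, which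
vanishes modulo $\operatorname{Tr}(I^{(k+1)}A)$ (\<open>Tr_D_CS\<close>). This is the equation of an
$L_\infty$ morphism. On words of length one only the term $R^k$ of $R_t^k$ contributes, whence the
linear component.

Two things have to be organised. The functions on words are handled through their derivatives
$\partial_v\varphi(w) = \varphi(vw)$: the convolution product and the codifferential are defined by
recursion on the word, by requiring that $\partial_v$ be a graded derivation of the product, and
identities between them are proved by induction on the word for all functions at once. Secondly,
$S(L[1])$ is a quotient of the free vector space on words in the coset space \<open>A/I\<close>. The lemma
\<open>cochain_factors\<close> is its universal property: a function on words of homogeneous elements of \<open>A\<close>
which is multilinear, graded symmetric and zero on \<open>I\<close> induces a linear map on $S(L[1])$.
It produces both the codifferential and the $L_\infty$ morphism from functions on words.\<close>

section \<open>Signs, projections and homogeneous components\<close>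

text \<open>All signs are expressed without scalars, as $(-1)^n x$ depends only on the parity of \<open>n\<close>. A sign
identity then reduces to a congruence modulo 2 (\<open>signed_cong\<close>).\<close>

definition signed :: "int \<Rightarrow> 'b::ab_group_add \<Rightarrow> 'b"
  where "signed n x = (if even n then x else - x)"

lemma signed_simps [simp]:
  "signed 0 x = x" "signed 1 x = - x" "signed n 0 = 0"
  "signed n (- x) = - signed n x"
  by (auto simp: signed_def)

lemma signed_add: "signed n (x + y) = signed n x + signed n y"
  by (simp add: signed_def)

lemma signed_diff: "signed n (x - y) = signed n x - signed n y"
  by (simp add: signed_def)

lemma signed_signed [simp]: "signed n (signed m x) = signed (n + m) x"
  by (auto simp: signed_def)

lemma signed_sum: "signed n (\<Sum>i\<in>A. f i) = (\<Sum>i\<in>A. signed n (f i))"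
  by (simp add: signed_def sum_negf)

lemma signed_cong: "even (n - m) \<Longrightarrow> signed n x = signed m x"
  by (auto simp: signed_def)

lemma minus_one_powi: "(-1 :: 'k::field) powi n = (if even n then 1 else -1)"
  by (simp add: power_int_minus_left)

lemma (in module) scale_signed: "scale c (signed n x) = signed n (scale c x)"
  by (simp add: signed_def)

lemma (in module_hom) signed_hom: "f (signed n x) = signed n (f x)"
  by (simp add: signed_def neg)

lemma (in module) subspace_signed_iff: "subspace S \<Longrightarrow> signed n x \<in> S \<longleftrightarrow> x \<in> S"
  by (auto simp: signed_def dest: subspace_neg)

lemma (in vector_space) scale_powi: "scale ((-1) powi n) x = signed n x"
  by (simp add: minus_one_powi signed_def)

text \<open>A quotient \<open>U/N\<close> is replaced by a complement of \<open>N\<close>: the map \<open>f\<close> kills a basis of \<open>N\<close> and fixes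
the basis vectors that extend it to a basis of \<open>U\<close>. With \<open>U\<close> a homogeneous component of \<open>A\<close> this
gives the section of $A \to A/I$, and with \<open>U\<close> the whole space it turns congruences modulo \<open>N\<close> into
equations.\<close>

lemma (in vector_space) projection_along_subspace:
  assumes "subspace N" "subspace U" "N \<subseteq> U"
  obtains f where "Vector_Spaces.linear scale scale f" "\<And>u. u \<in> U \<Longrightarrow> f u \<in> U"
    "\<And>u. u \<in> U \<Longrightarrow> u - f u \<in> N" "\<And>u. u \<in> N \<Longrightarrow> f u = 0"
proof -
  interpret vector_space_pair scale scale by unfold_locales
  obtain B where B: "B \<subseteq> N" "independent B" "N \<subseteq> span B"
    using maximal_independent_subset by blast
  obtain C where C: "B \<subseteq> C" "C \<subseteq> U" "independent C" "U \<subseteq> span C"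
    using maximal_independent_subset_extend[of B U] B assms(3) by blast
  define f where "f = construct C (\<lambda>c. if c \<in> B then 0 else c)"
  have lin: "Vector_Spaces.linear scale scale f"
    unfolding f_def by (rule linear_construct[OF C(3)])
  interpret f: Vector_Spaces.linear scale scale f by (rule lin)
  have fC: "f c = (if c \<in> B then 0 else c)" if "c \<in> C" for c
    unfolding f_def by (rule construct_basis[OF C(3) that])
  show ?thesis
  proof (rule that[OF lin])
    fix u assume "u \<in> U"
    then have "u \<in> span C" using C(4) by blast
    then have "f u \<in> U \<and> u - f u \<in> N"
    proof (induction rule: span_induct_alt)
      case base
      then show ?case using assms by (simp add: subspace_0)
    next
      case (step c x y)
      have "f x \<in> U" "x - f x \<in> N"
        using step C B assms by (auto simp: fC subspace_0)
      moreover have "scale c x + y - f (scale c x + y) = scale c (x - f x) + (y - f y)"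
        by (simp add: f.add f.scale algebra_simps)
      moreover have "f (scale c x + y) = scale c (f x) + f y"
        by (simp add: f.add f.scale)
      ultimately show ?case using step.IH assms
        by (metis subspace_add subspace_scale)
    qed
    then show "f u \<in> U" "u - f u \<in> N" by auto
  next
    fix u assume "u \<in> N"
    then have "u \<in> span B" using B by blast
    then show "f u = 0"
      by (induction rule: span_induct_alt) (use C(1) in \<open>auto simp: f.add f.scale fC\<close>)
  qed
qed

context graded_vector_space
begin

lemma component_decomposes: "is_decomposition G x (component G x)"
  unfolding component_def by (rule theI'[OF direct_sum])

lemma component_in: "component G x i \<in> G i"
  using component_decomposes unfolding is_decomposition_def by blast

lemma finite_component: "finite {i. component G x i \<noteq> 0}"
  using component_decomposes unfolding is_decomposition_def by blast

lemma component_sum: "(\<Sum>i | component G x i \<noteq> 0. component G x i) = x"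
  using component_decomposes unfolding is_decomposition_def by metis

lemma component_unique: "is_decomposition G x f \<Longrightarrow> component G x = f"
  using direct_sum component_decomposes by blast

lemma component_eqI:
  assumes "\<And>i. f i \<in> G i" "finite S" "\<And>i. i \<notin> S \<Longrightarrow> f i = 0" "x = sum f S"
  shows "component G x = f"
proof (rule component_unique)
  have S: "{i. f i \<noteq> 0} \<subseteq> S" using assms(3) by auto
  then have "(\<Sum>i | f i \<noteq> 0. f i) = sum f S"
    by (rule sum.mono_neutral_left[OF assms(2)]) auto
  then show "is_decomposition G x f"
    using assms S finite_subset unfolding is_decomposition_def by metis
qed

lemma component_sum_superset:
  assumes "finite S" "\<And>i. component G x i \<noteq> 0 \<Longrightarrow> i \<in> S"
  shows "(\<Sum>i\<in>S. component G x i) = x"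
proof -
  have "(\<Sum>i\<in>S. component G x i) = (\<Sum>i | component G x i \<noteq> 0. component G x i)"
    by (rule sum.mono_neutral_right) (use assms in auto)
  then show ?thesis by (simp add: component_sum)
qed

lemma component_homogeneous: "x \<in> G i \<Longrightarrow> component G x = (\<lambda>j. if j = i then x else 0)"
  by (rule component_eqI[of _ "{i}"]) (auto simp: subspace_0[OF subspace_component])

lemma component_same: "x \<in> G i \<Longrightarrow> component G x i = x"
  by (simp add: component_homogeneous)

lemma component_add: "component G (x + y) i = component G x i + component G y i"
proof -
  let ?S = "{i. component G x i \<noteq> 0} \<union> {i. component G y i \<noteq> 0}"
  have "component G (x + y) = (\<lambda>i. component G x i + component G y i)"
    by (rule component_eqI[of _ ?S])
      (auto simp: finite_component component_in subspace_add[OF subspace_component]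
        sum.distrib component_sum_superset)
  then show ?thesis by simp
qed

lemma component_scale: "component G (scale c x) i = scale c (component G x i)"
proof -
  have "component G (scale c x) = (\<lambda>i. scale c (component G x i))"
    by (rule component_eqI[of _ "{i. component G x i \<noteq> 0}"])
      (auto simp: finite_component component_in subspace_scale[OF subspace_component]
        scale_sum_right[symmetric] component_sum)
  then show ?thesis by simp
qed

lemma component_zero [simp]: "component G 0 i = 0"
  using component_scale[of 0 0 i] by simp

lemma component_minus: "component G (- x) i = - component G x i"
  using component_scale[of "-1" x i] by simp

lemma signed_in_iff: "signed n x \<in> G i \<longleftrightarrow> x \<in> G i"
  by (rule subspace_signed_iff[OF subspace_component])

end

context graded_algebra
begin

text \<open>The index sets may be enlarged to any finite sets containing the degrees that occur; two
elements with different degrees can then be added term by term.\<close>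

lemma graded_commutator_superset:
  assumes "finite S" "\<And>i. component G a i \<noteq> 0 \<Longrightarrow> i \<in> S"
    and "finite T" "\<And>i. component G b i \<noteq> 0 \<Longrightarrow> i \<in> T"
  shows "graded_commutator scale G a b = (\<Sum>i\<in>S. \<Sum>j\<in>T. component G a i * component G b j
    - signed (i * j) (component G b j * component G a i))" (is "_ = (\<Sum>i\<in>S. ?f T i)")
proof -
  have "(\<Sum>i\<in>S. ?f T i) = (\<Sum>i | component G a i \<noteq> 0. ?f T i)"
    by (rule sum.mono_neutral_right) (use assms in auto)
  also have "\<dots> = (\<Sum>i | component G a i \<noteq> 0. ?f {j. component G b j \<noteq> 0} i)"
    by (intro sum.cong refl sum.mono_neutral_right) (use assms in auto)
  finally show ?thesis by (simp add: graded_commutator_def scale_powi)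
qed

lemma graded_commutator_homogeneous:
  assumes "a \<in> G i" "b \<in> G j"
  shows "graded_commutator scale G a b = a * b - signed (i * j) (b * a)"
proof -
  have "graded_commutator scale G a b = (\<Sum>i\<in>{i}. \<Sum>j\<in>{j}. component G a i * component G b j
    - signed (i * j) (component G b j * component G a i))"
    by (rule graded_commutator_superset)
      (auto simp: component_homogeneous[OF assms(1)] component_homogeneous[OF assms(2)] split: if_splits)
  then show ?thesis by (simp add: component_same assms)
qed

lemma graded_commutator_add_left:
  "graded_commutator scale G (a + a') b = graded_commutator scale G a b + graded_commutator scale G a' b"
proof -
  let ?S = "{i. component G a i \<noteq> 0} \<union> {i. component G a' i \<noteq> 0}"
  let ?T = "{i. component G b i \<noteq> 0}"
  show ?thesis
    by (subst (1 2 3) graded_commutator_superset[of ?S _ ?T])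
      (auto simp: finite_component component_add sum.distrib[symmetric] signed_add algebra_simps intro!: sum.cong)
qed

lemma graded_commutator_add_right:
  "graded_commutator scale G a (b + b') = graded_commutator scale G a b + graded_commutator scale G a b'"
proof -
  let ?S = "{i. component G a i \<noteq> 0}"
  let ?T = "{i. component G b i \<noteq> 0} \<union> {i. component G b' i \<noteq> 0}"
  show ?thesis
    by (subst (1 2 3) graded_commutator_superset[of ?S _ ?T])
      (auto simp: finite_component component_add sum.distrib[symmetric] signed_add algebra_simps intro!: sum.cong)
qed

lemma graded_commutator_sum_components:
  "graded_commutator scale G a b = (\<Sum>i | component G a i \<noteq> 0. \<Sum>j | component G b j \<noteq> 0.
     graded_commutator scale G (component G a i) (component G b j))"
  by (simp add: graded_commutator_homogeneous[OF component_in component_in]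
      graded_commutator_superset[OF finite_component _ finite_component])

end

context curved_lie_ideal
begin

lemma lie_ideal_right: "x \<in> I \<Longrightarrow> graded_commutator scale G x a \<in> I"
proof -
  assume x: "x \<in> I"
  have "graded_commutator scale G (component G x i) (component G a j) \<in> I" for i j
  proof -
    have "graded_commutator scale G (component G x i) (component G a j)
      = - signed (i * j) (graded_commutator scale G (component G a j) (component G x i))"
      by (simp add: graded_commutator_homogeneous[OF component_in component_in] signed_def mult.commute)
    then show ?thesis
      using lie_ideal[OF homogeneous_ideal[OF x]]
      by (simp add: subspace_neg[OF subspace_ideal] subspace_signed_iff[OF subspace_ideal])
  qed
  then show ?thesis
    by (subst graded_commutator_sum_components) (intro subspace_sum[OF subspace_ideal])
qed

end

section \<open>The convolution algebra of functions on words\<close>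

text \<open>A letter \<open>(a, e)\<close> stands for the component of \<open>a\<close> of degree \<open>e\<close>. Every letter is therefore
homogeneous of known degree, even when its value is zero, and no homogeneity hypotheses are needed on
words.\<close>

type_synonym 'a letter = "'a \<times> int"

text \<open>The degree in $A[1]$.\<close>

definition sdeg :: "'a letter \<Rightarrow> int" where "sdeg v = snd v - 1"

definition wdeg :: "'a letter list \<Rightarrow> int" where "wdeg w = (\<Sum>v\<leftarrow>w. sdeg v)"

lemma wdeg_simps [simp]: "wdeg [] = 0" "wdeg (v # w) = sdeg v + wdeg w"
  by (simp_all add: wdeg_def)

text \<open>The convolution product, where \<open>m\<close> is the degree of \<open>\<psi>\<close>. In
$(\varphi\psi)(w) = \sum \pm\varphi(w')\psi(w'')$ the sum runs over all unshuffles of \<open>w\<close>; the two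
summands of the recursion collect those in which the first letter goes to \<open>\<phi>\<close> and those in which it goes
to \<open>\<psi>\<close>. The sign is the Koszul sign for moving \<open>\<psi>\<close> past the first letter. The degree of
\<open>\<lambda>w. \<psi> (v # w)\<close> is that of \<open>\<psi>\<close> increased by the degree of \<open>v\<close>.\<close>

fun conv :: "int \<Rightarrow> ('a letter list \<Rightarrow> 'a::ring) \<Rightarrow> ('a letter list \<Rightarrow> 'a) \<Rightarrow> 'a letter list \<Rightarrow> 'a"
  where
    "conv m \<phi> \<psi> [] = \<phi> [] * \<psi> []"
  | "conv m \<phi> \<psi> (v # w) = signed (m * sdeg v) (conv m (\<lambda>w. \<phi> (v # w)) \<psi> w)
      + conv (m + sdeg v) \<phi> (\<lambda>w. \<psi> (v # w)) w"

lemma conv_add_left: "conv m (\<lambda>w. \<phi> w + \<phi>' w) \<psi> w = conv m \<phi> \<psi> w + conv m \<phi>' \<psi> w"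
  by (induction w arbitrary: m \<phi> \<phi>' \<psi>) (simp_all add: distrib_right signed_add)

lemma conv_add_right: "conv m \<phi> (\<lambda>w. \<psi> w + \<psi>' w) w = conv m \<phi> \<psi> w + conv m \<phi> \<psi>' w"
  by (induction w arbitrary: m \<phi> \<psi> \<psi>') (simp_all add: distrib_left signed_add)

lemma conv_zero [simp]: "conv m (\<lambda>w. 0) \<psi> w = 0" "conv m \<phi> (\<lambda>w. 0) w = 0"
  by (induction w arbitrary: m \<phi> \<psi>) simp_all

lemma conv_minus [simp]:
  "conv m (\<lambda>w. - \<phi> w) \<psi> w = - conv m \<phi> \<psi> w" "conv m \<phi> (\<lambda>w. - \<psi> w) w = - conv m \<phi> \<psi> w"
  by (induction w arbitrary: m \<phi> \<psi>) simp_all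

lemma conv_diff:
  "conv m (\<lambda>w. \<phi> w - \<phi>' w) \<psi> w = conv m \<phi> \<psi> w - conv m \<phi>' \<psi> w"
  "conv m \<phi> (\<lambda>w. \<psi> w - \<psi>' w) w = conv m \<phi> \<psi> w - conv m \<phi> \<psi>' w"
  using conv_add_left[of m \<phi> "\<lambda>w. - \<phi>' w" \<psi> w] conv_add_right[of m \<phi> \<psi> "\<lambda>w. - \<psi>' w" w] by simp_all

lemma conv_signed [simp]:
  "conv m (\<lambda>w. signed n (\<phi> w)) \<psi> w = signed n (conv m \<phi> \<psi> w)"
  "conv m \<phi> (\<lambda>w. signed n (\<psi> w)) w = signed n (conv m \<phi> \<psi> w)"
  by (simp_all add: signed_def)

lemma conv_sum:
  "conv m (\<lambda>w. \<Sum>i\<in>A. f i w) \<psi> w = (\<Sum>i\<in>A. conv m (f i) \<psi> w)"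
  "conv m \<phi> (\<lambda>w. \<Sum>i\<in>A. f i w) w = (\<Sum>i\<in>A. conv m \<phi> (f i) w)"
  by (induction A rule: infinite_finite_induct) (simp_all add: conv_add_left conv_add_right)

lemma conv_parity: "even (m - n) \<Longrightarrow> conv m \<phi> \<psi> w = conv n \<phi> \<psi> w"
proof (induction w arbitrary: m n \<phi> \<psi>)
  case (Cons v w)
  have "signed (m * sdeg v) x = signed (n * sdeg v) x" for x :: 'a
    using Cons.prems by (intro signed_cong) auto
  moreover have "even (m + sdeg v - (n + sdeg v))" using Cons.prems by simp
  ultimately show ?case using Cons.IH[OF Cons.prems] Cons.IH[of "m + sdeg v" "n + sdeg v"] by simp
qed simp

text \<open>The product $\psi\chi$ has degree \<open>m + n\<close> if $\psi$ and $\chi$ have degrees \<open>m\<close> and \<open>n\<close>. Since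
$\partial_v$ is a derivation on both sides, it is enough to compare the values at the empty word.\<close>

lemma conv_assoc: "conv n (conv m \<phi> \<psi>) \<chi> w = conv (m + n) \<phi> (conv n \<psi> \<chi>) w"
proof (induction w arbitrary: m n \<phi> \<psi> \<chi>)
  case (Cons v w)
  show ?case
    by (simp add: conv_add_left conv_add_right Cons.IH signed_add algebra_simps)
qed (simp add: mult.assoc)

text \<open>The embedding of \<open>A\<close> into the convolution algebra: \<open>const_fun 1\<close> is the unit, the counit of the
coalgebra of words.\<close>

fun const_fun :: "'a::zero \<Rightarrow> 'b list \<Rightarrow> 'a"
  where
    "const_fun a [] = a"
  | "const_fun a (v # w) = 0"

lemma conv_const_left: "conv m (const_fun a) \<psi> w = a * \<psi> w"
  by (induction w arbitrary: m \<psi>) simp_all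

lemma conv_const_right: "even m \<Longrightarrow> conv m \<phi> (const_fun a) w = \<phi> w * a"
  by (induction w arbitrary: \<phi>) (simp_all add: signed_def)

context curved_dg_algebra
begin

lemma conv_scale:
  "conv m (\<lambda>w. scale c (\<phi> w)) \<psi> w = scale c (conv m \<phi> \<psi> w)"
  "conv m \<phi> (\<lambda>w. scale c (\<psi> w)) w = scale c (conv m \<phi> \<psi> w)"
  by (induction w arbitrary: m \<phi> \<psi>)
    (simp_all add: scale_mult_left scale_mult_right scale_signed scale_right_distrib)

definition elt :: "'a letter \<Rightarrow> 'a" where "elt v = component G (fst v) (snd v)"

definition d_letter :: "'a letter \<Rightarrow> 'a letter" where "d_letter v = (d (elt v), snd v + 1)"

definition br_letter :: "'a letter \<Rightarrow> 'a letter \<Rightarrow> 'a letter"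
  where "br_letter u v = (elt u * elt v - signed (snd u * snd v) (elt v * elt u), snd u + snd v)"

lemma elt_in: "elt v \<in> G (snd v)"
  by (simp add: elt_def component_in)

lemma snd_d_letter [simp]: "snd (d_letter v) = snd v + 1"
  and snd_br_letter [simp]: "snd (br_letter u v) = snd u + snd v"
  by (simp_all add: d_letter_def br_letter_def)

lemma sdeg_d_letter [simp]: "sdeg (d_letter v) = sdeg v + 1"
  and sdeg_br_letter [simp]: "sdeg (br_letter u v) = sdeg u + sdeg v + 1"
  by (simp_all add: sdeg_def)

lemma elt_d_letter: "elt (d_letter v) = d (elt v)"
  unfolding elt_def[of "d_letter v"] by (simp add: component_same d_letter_def degree_d elt_in)

lemma mult_in: "x \<in> G i \<Longrightarrow> y \<in> G j \<Longrightarrow> n = i + j \<Longrightarrow> x * y \<in> G n"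
  by (simp add: mult_degree)

lemma elt_br_letter: "elt (br_letter u v) = elt u * elt v - signed (snd u * snd v) (elt v * elt u)"
  unfolding elt_def[of "br_letter u v"]
  by (simp add: component_same br_letter_def subspace_diff[OF subspace_component] signed_in_iff
      mult_in[OF elt_in elt_in])

sublocale d: Vector_Spaces.linear scale scale d
  by (rule linear_d)

text \<open>Composition with the derivation of the tensor algebra that replaces a letter \<open>u\<close> by \<open>[v, u]\<close>. The
exponent uses that this derivation has degree \<open>sdeg v + 1\<close>.\<close>

fun ad :: "'a letter \<Rightarrow> ('a letter list \<Rightarrow> 'b::ab_group_add) \<Rightarrow> 'a letter list \<Rightarrow> 'b"
  where
    "ad v \<phi> [] = 0"
  | "ad v \<phi> (u # w) = \<phi> (br_letter v u # w) + signed (sdeg u * (sdeg v + 1)) (ad v (\<lambda>w. \<phi> (u # w)) w)"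

text \<open>Composition of a function with the Chevalley--Eilenberg codifferential. The bracket of two letters is
placed at the position of the second one, which for graded symmetric functions agrees, up to the Koszul
sign, with placing it in front (\<open>Q_eq_sum\<close>). In this form the codifferential is a coderivation of the
whole tensor coalgebra, not only of its symmetric part.\<close>

fun Q :: "('a letter list \<Rightarrow> 'b::ab_group_add) \<Rightarrow> 'a letter list \<Rightarrow> 'b"
  where
    "Q \<phi> [] = 0"
  | "Q \<phi> (v # w) = - \<phi> (d_letter v # w) + signed (sdeg v) (Q (\<lambda>w. \<phi> (v # w)) w) + signed (snd v) (ad v \<phi> w)"

lemma ad_add: "ad v (\<lambda>w. \<phi> w + \<psi> w) w = ad v \<phi> w + ad v \<psi> w"
  by (induction w arbitrary: \<phi> \<psi>) (simp_all add: signed_add)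

lemma ad_minus [simp]: "ad v (\<lambda>w. - \<phi> w) w = - ad v \<phi> w"
  by (induction w arbitrary: \<phi>) simp_all

lemma ad_signed [simp]: "ad v (\<lambda>w. signed n (\<phi> w)) w = signed n (ad v \<phi> w)"
  by (simp add: signed_def)

lemma Q_add: "Q (\<lambda>w. \<phi> w + \<psi> w) w = Q \<phi> w + Q \<psi> w"
  by (induction w arbitrary: \<phi> \<psi>) (simp_all add: signed_add ad_add)

lemma Q_minus [simp]: "Q (\<lambda>w. - \<phi> w) w = - Q \<phi> w"
  by (induction w arbitrary: \<phi>) simp_all

lemma Q_signed [simp]: "Q (\<lambda>w. signed n (\<phi> w)) w = signed n (Q \<phi> w)"
  by (simp add: signed_def)

lemma ad_conv: "ad v (conv m \<phi> \<psi>) w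
    = signed (m * (sdeg v + 1)) (conv m (ad v \<phi>) \<psi> w) + conv (m + sdeg v + 1) \<phi> (ad v \<psi>) w"
proof (induction w arbitrary: m \<phi> \<psi>)
  case (Cons u w)
  show ?case
    apply (simp add: conv_add_left conv_add_right ad_add Cons.IH signed_add)
    apply (simp add: algebra_simps)
    apply (rule signed_cong)
    apply simp
    done
qed simp

text \<open>The codifferential is a coderivation: in each summand of the unshuffle coproduct, the two letters
of a bracket go to the same factor.\<close>

lemma Q_conv: "Q (conv m \<phi> \<psi>) w = signed m (conv m (Q \<phi>) \<psi> w) + conv (m + 1) \<phi> (Q \<psi>) w"
proof (induction w arbitrary: m \<phi> \<psi>)
  case (Cons u w)
  show ?case
    apply (simp add: conv_add_left conv_add_right ad_add ad_conv Q_add Cons.IH signed_add)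
    by (simp add: algebra_simps sdeg_def conv_diff signed_diff)
      (simp add: signed_def)
qed simp

end

text \<open>The condition speaks of an arbitrary family \<open>G\<close>, so that it applies to values in \<open>A\<close>, in \<open>C\<close> and in
$S(L[1])$.\<close>

definition has_degree :: "(int \<Rightarrow> 'b set) \<Rightarrow> int \<Rightarrow> ('a letter list \<Rightarrow> 'b) \<Rightarrow> bool"
  where "has_degree G n \<phi> \<longleftrightarrow> (\<forall>w. \<phi> w \<in> G (n + wdeg w))"

lemma has_degreeD: "has_degree G n \<phi> \<Longrightarrow> \<phi> w \<in> G (n + wdeg w)"
  by (simp add: has_degree_def)

lemma has_degree_Cons: "has_degree G n \<phi> \<Longrightarrow> has_degree G (n + sdeg v) (\<lambda>w. \<phi> (v # w))"
  unfolding has_degree_def by (metis add.assoc wdeg_simps(2))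

context curved_dg_algebra
begin

lemmas G_intros = subspace_add[OF subspace_component] subspace_neg[OF subspace_component]
  subspace_diff[OF subspace_component] subspace_0[OF subspace_component]

lemma has_degree_conv:
  assumes "has_degree G n \<phi>" "has_degree G m \<psi>" "k = n + m"
  shows "has_degree G k (conv m \<phi> \<psi>)"
proof -
  have "conv m \<phi> \<psi> w \<in> G (n + m + wdeg w)" for w
    using assms(1,2)
  proof (induction w arbitrary: n m \<phi> \<psi>)
    case Nil
    then show ?case using has_degreeD[of G _ _ "[]"] by (auto intro!: mult_degree)
  next
    case (Cons v w)
    have "conv m (\<lambda>w. \<phi> (v # w)) \<psi> w \<in> G (n + sdeg v + m + wdeg w)"
      and "conv (m + sdeg v) \<phi> (\<lambda>w. \<psi> (v # w)) w \<in> G (n + (m + sdeg v) + wdeg w)"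
      using Cons has_degree_Cons by blast+
    then show ?case
      by (auto simp: signed_in_iff algebra_simps intro!: G_intros)
  qed
  then show ?thesis using assms(3) by (simp add: has_degree_def)
qed

lemma leibniz_signed: "x \<in> G i \<Longrightarrow> d (x * y) = d x * y + signed i (x * d y)"
  using leibniz by (simp add: scale_powi)

lemma d_conv:
  "has_degree G n \<phi> \<Longrightarrow> d (conv m \<phi> \<psi> w)
    = conv m (\<lambda>w. d (\<phi> w)) \<psi> w + signed n (conv (m + 1) \<phi> (\<lambda>w. d (\<psi> w)) w)"
proof (induction w arbitrary: n m \<phi> \<psi>)
  case Nil
  then show ?case using has_degreeD[OF Nil, of "[]"] by (simp add: leibniz_signed)
next
  case (Cons v w)
  show ?case
    by (simp add: d.signed_hom d.add Cons.IH[OF has_degree_Cons[OF Cons.prems]] Cons.IH[OF Cons.prems] signed_add)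
      (simp add: algebra_simps)
qed

text \<open>The differential of the convolution algebra on functions of degree \<open>n\<close>.\<close>

definition D :: "int \<Rightarrow> ('a letter list \<Rightarrow> 'a) \<Rightarrow> 'a letter list \<Rightarrow> 'a"
  where "D n \<phi> w = d (\<phi> w) - signed n (Q \<phi> w)"

lemma D_conv:
  assumes "has_degree G n \<phi>"
  shows "D (n + m) (conv m \<phi> \<psi>) w = conv m (D n \<phi>) \<psi> w + signed n (conv (m + 1) \<phi> (D m \<psi>) w)"
proof -
  have [abs_def]: "D k \<chi> w = d (\<chi> w) - signed k (Q \<chi> w)" for k \<chi> w
    by (simp add: D_def)
  then show ?thesis
    apply (simp add: d_conv[OF assms] Q_conv signed_add conv_diff signed_diff)
    apply (simp add: algebra_simps)
    apply (rule signed_cong)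
    apply simp
    done
qed

context
  fixes H :: "int \<Rightarrow> 'b::ab_group_add set"
  assumes closed: "\<And>i. 0 \<in> H i" "\<And>i x y. x \<in> H i \<Longrightarrow> y \<in> H i \<Longrightarrow> x + y \<in> H i"
    "\<And>i x. x \<in> H i \<Longrightarrow> - x \<in> H i"
begin

lemma signed_closed: "x \<in> H i \<Longrightarrow> signed n x \<in> H i"
  by (simp add: signed_def closed)

lemma ad_in: "has_degree H n \<phi> \<Longrightarrow> ad v \<phi> w \<in> H (n + sdeg v + 1 + wdeg w)"
proof (induction w arbitrary: n \<phi>)
  case (Cons u w)
  have "ad v (\<lambda>w. \<phi> (u # w)) w \<in> H (n + sdeg u + sdeg v + 1 + wdeg w)"
    using Cons has_degree_Cons by blast
  moreover have "\<phi> (br_letter v u # w) \<in> H (n + wdeg (br_letter v u # w))"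
    by (rule has_degreeD[OF Cons.prems])
  ultimately show ?case
    by (auto simp: algebra_simps intro!: closed signed_closed)
qed (simp add: closed)

lemma has_degree_Q:
  assumes "has_degree H n \<phi>" shows "has_degree H (n + 1) (Q \<phi>)"
proof -
  have "Q \<phi> w \<in> H (n + 1 + wdeg w)" for w
    using assms
  proof (induction w arbitrary: n \<phi>)
    case (Cons v w)
    have "Q (\<lambda>w. \<phi> (v # w)) w \<in> H (n + sdeg v + 1 + wdeg w)"
      using Cons has_degree_Cons by blast
    then have "- \<phi> (d_letter v # w) + signed (sdeg v) (Q (\<lambda>w. \<phi> (v # w)) w) + signed (snd v) (ad v \<phi> w)
        \<in> H (n + 1 + (sdeg v + wdeg w))"
      using has_degreeD[OF Cons.prems, of "d_letter v # w"] ad_in[OF Cons.prems, of v w]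
      by (intro closed signed_closed) (simp_all add: algebra_simps)
    then show ?case by simp
  qed (simp add: closed)
  then show ?thesis by (simp add: has_degree_def)
qed

end

lemma has_degree_D:
  assumes "has_degree G n \<phi>" shows "has_degree G (n + 1) (D n \<phi>)"
proof -
  have "has_degree G (n + 1) (Q \<phi>)"
    by (rule has_degree_Q[OF _ _ _ assms]) (simp_all add: G_intros)
  then show ?thesis
    using degree_d[OF has_degreeD[OF assms]]
    by (auto simp: has_degree_def D_def signed_in_iff algebra_simps intro!: G_intros)
qed

lemma ad_postcompose:
  assumes "\<And>e. additive (h e)"
  shows "ad v (\<lambda>w. h (wdeg w) (\<phi> w)) w = h (wdeg w + sdeg v + 1) (ad v \<phi> w)"
  using assms
proof (induction w arbitrary: h \<phi>)
  case Nil
  then show ?case by (simp add: additive.zero)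
next
  case (Cons u w)
  have h: "h e (signed n x) = signed n (h e x)" for e n x
    by (simp add: signed_def additive.minus[OF Cons.prems])
  show ?case
    using Cons.IH[of "\<lambda>e. h (sdeg u + e)" "\<lambda>w. \<phi> (u # w)"] Cons.prems
    by (simp add: additive.add[OF Cons.prems] h algebra_simps)
qed

text \<open>The maps \<open>h e\<close> may depend on the degree \<open>e\<close> of the word, as the degreewise section does; the index
rises by one because the codifferential raises degrees by one.\<close>

lemma Q_postcompose:
  assumes "\<And>e. additive (h e)"
  shows "Q (\<lambda>w. h (wdeg w) (\<phi> w)) w = h (wdeg w + 1) (Q \<phi> w)"
  using assms
proof (induction w arbitrary: h \<phi>)
  case Nil
  then show ?case by (simp add: additive.zero)
next
  case (Cons u w)
  have h: "h e (signed n x) = signed n (h e x)" for e n x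
    by (simp add: signed_def additive.minus[OF Cons.prems])
  show ?case
    using Cons.IH[of "\<lambda>e. h (sdeg u + e)" "\<lambda>w. \<phi> (u # w)"] Cons.prems ad_postcompose[of h u \<phi> w]
    by (simp add: additive.add[OF Cons.prems] additive.diff[OF Cons.prems] h algebra_simps)
qed

lemma Q_additive:
  assumes "additive h" shows "Q (\<lambda>w. h (\<phi> w)) w = h (Q \<phi> w)"
  using Q_postcompose[of "\<lambda>e. h"] assms by blast

lemma additive_d: "additive d"
  by (simp add: additive_def d.add)

text \<open>The projection of the tensor coalgebra to $A[1]$.\<close>

fun val :: "'a letter list \<Rightarrow> 'a"
  where
    "val [] = 0"
  | "val [v] = elt v"
  | "val (u # v # w) = 0"

lemma ad_vanishes: "(\<And>w'. length w' = length w \<Longrightarrow> \<phi> w' = 0) \<Longrightarrow> ad v \<phi> w = 0"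
  by (induction w arbitrary: \<phi>) simp_all

lemma Q_vanishes: "(\<And>w'. length w \<le> Suc (length w') \<Longrightarrow> \<phi> w' = 0) \<Longrightarrow> Q \<phi> w = 0"
  by (induction w arbitrary: \<phi>) (simp_all add: ad_vanishes)

lemma d_d_elt: "d (d (elt v)) = R * elt v - elt v * R"
  by (simp add: d_d graded_commutator_homogeneous[OF curvature_degree elt_in] signed_def)

lemma d_elt_mult: "d (elt u * elt v) = d (elt u) * elt v + signed (snd u) (elt u * d (elt v))"
  by (rule leibniz_signed[OF elt_in])

text \<open>The square of the codifferential of the curved Lie algebra \<open>A\<close>, followed by the projection to \<open>A\<close>.
On words of length one it is $d^2 = [R,-]$; on words of length two and three it vanishes by the Leibniz
rule and by the Jacobi identity; on longer words it vanishes because the codifferential shortens a word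
by at most one letter.\<close>

lemma Q_Q_val: "Q (Q val) w = (case w of [v] \<Rightarrow> R * elt v - elt v * R | _ \<Rightarrow> 0)"
proof -
  have val0: "val w = 0" if "length w \<ge> 2" for w
    using that by (cases w rule: val.cases) auto
  have Qval3: "Q val w = 0" if "length w \<ge> 3" for w
    using that by (intro Q_vanishes val0) simp
  consider "w = []" | v where "w = [v]" | u v where "w = [u, v]" | u v z where "w = [u, v, z]"
    | "length w \<ge> 4"
    \<comment> \<open>the rule splits lists into those of length 0, 1 and at least 2\<close>
    by (cases w rule: remdups_adj.cases; cases "tl (tl w)"; cases "tl (tl (tl w))") auto
  then show ?thesis
  proof cases
    case 2
    then show ?thesis by (simp add: elt_d_letter d_d_elt)
  next
    case (3 u v)
    then show ?thesis
      by (simp add: elt_d_letter elt_br_letter d.add d.diff d.neg d.signed_hom d_elt_mult sdeg_def)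
        (auto simp: signed_def algebra_simps)
  next
    case (4 u v z)
    then show ?thesis
      by (simp add: Qval3 elt_d_letter elt_br_letter sdeg_def)
        (auto simp: signed_def algebra_simps)
  next
    case 5
    then have "Q (Q val) w = 0" by (intro Q_vanishes Qval3) simp
    moreover have "(case w of [v] \<Rightarrow> R * elt v - elt v * R | _ \<Rightarrow> 0) = 0"
      using 5 by (auto split: list.splits)
    ultimately show ?thesis by simp
  qed simp
qed

end

context trace_map
begin

sublocale Tr: Vector_Spaces.linear scaleA scaleC Tr
  by (rule linear_Tr)

lemma Tr_swap: "a \<in> GA i \<Longrightarrow> b \<in> GA j \<Longrightarrow> Tr (a * b) = signed (i * j) (Tr (b * a))"
proof -
  assume a: "a \<in> GA i" and b: "b \<in> GA j"
  have "graded_commutator scaleA GA a b \<in> commutator_space scaleA GA"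
    unfolding commutator_space_def by (rule A.span_base) blast
  then have "Tr (a * b - signed (i * j) (b * a)) = 0"
    using Tr_commutator A.graded_commutator_homogeneous[OF a b] by simp
  then show ?thesis by (simp add: Tr.diff Tr.signed_hom)
qed

text \<open>The unshuffle coproduct is graded cocommutative, so the trace property of \<open>Tr\<close> passes to convolution
products.\<close>

lemma Tr_conv_swap:
  "has_degree GA n \<phi> \<Longrightarrow> has_degree GA m \<psi> \<Longrightarrow>
    Tr (conv m \<phi> \<psi> w) = signed (n * m) (Tr (conv n \<psi> \<phi> w))"
proof (induction w arbitrary: n m \<phi> \<psi>)
  case Nil
  then show ?case
    using has_degreeD[OF Nil(1), of "[]"] has_degreeD[OF Nil(2), of "[]"]
    by (simp add: Tr_swap[of "\<phi> []" n "\<psi> []" m])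
next
  case (Cons v w)
  show ?case
    apply (simp add: Tr.add Tr.signed_hom signed_add
        Cons.IH[OF has_degree_Cons[OF Cons.prems(1)] Cons.prems(2)]
        Cons.IH[OF Cons.prems(1) has_degree_Cons[OF Cons.prems(2)]])
    apply (simp add: algebra_simps)
    apply (rule signed_cong)
    apply simp
    done
qed

end

section \<open>Cochains on the quotient Lie algebra\<close>

context curved_lie_ideal
begin

text \<open>The functions on words of \<open>A\<close> that come from linear maps on $S((A/I)[1])$: multilinear, zero as soon as
one letter lies in \<open>I\<close>, and graded symmetric for the shifted degrees. Additivity and homogeneity are stated
for three and two letters related through their values, because letters with the same value need not be
equal as pairs.\<close>

definition cochain :: "('k \<Rightarrow> 'b \<Rightarrow> 'b) \<Rightarrow> ('a letter list \<Rightarrow> 'b::ab_group_add) \<Rightarrow> bool"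
  where "cochain sc \<phi> \<longleftrightarrow>
    (\<forall>us ws u v x. snd u = snd x \<longrightarrow> snd v = snd x \<longrightarrow> elt x = elt u + elt v \<longrightarrow>
       \<phi> (us @ x # ws) = \<phi> (us @ u # ws) + \<phi> (us @ v # ws)) \<and>
    (\<forall>us ws u x c. snd u = snd x \<longrightarrow> elt x = scale c (elt u) \<longrightarrow>
       \<phi> (us @ x # ws) = sc c (\<phi> (us @ u # ws))) \<and>
    (\<forall>us ws x. elt x \<in> I \<longrightarrow> \<phi> (us @ x # ws) = 0) \<and>
    (\<forall>us ws u v. \<phi> (us @ u # v # ws) = signed (sdeg u * sdeg v) (\<phi> (us @ v # u # ws)))"

lemma cochainI:
  assumes "\<And>us ws u v x. snd u = snd x \<Longrightarrow> snd v = snd x \<Longrightarrow> elt x = elt u + elt v \<Longrightarrow>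
       \<phi> (us @ x # ws) = \<phi> (us @ u # ws) + \<phi> (us @ v # ws)"
    and "\<And>us ws u x c. snd u = snd x \<Longrightarrow> elt x = scale c (elt u) \<Longrightarrow>
       \<phi> (us @ x # ws) = sc c (\<phi> (us @ u # ws))"
    and "\<And>us ws x. elt x \<in> I \<Longrightarrow> \<phi> (us @ x # ws) = 0"
    and "\<And>us ws u v. \<phi> (us @ u # v # ws) = signed (sdeg u * sdeg v) (\<phi> (us @ v # u # ws))"
  shows "cochain sc \<phi>"
  unfolding cochain_def using assms by (intro conjI allI impI)

lemma cochain_add: "cochain sc \<phi> \<Longrightarrow> snd u = snd x \<Longrightarrow> snd v = snd x \<Longrightarrow> elt x = elt u + elt v \<Longrightarrow>
    \<phi> (us @ x # ws) = \<phi> (us @ u # ws) + \<phi> (us @ v # ws)"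
  and cochain_scale: "cochain sc \<phi> \<Longrightarrow> snd u = snd x \<Longrightarrow> elt x = scale c (elt u) \<Longrightarrow>
    \<phi> (us @ x # ws) = sc c (\<phi> (us @ u # ws))"
  and cochain_ideal: "cochain sc \<phi> \<Longrightarrow> elt x \<in> I \<Longrightarrow> \<phi> (us @ x # ws) = 0"
  and cochain_swap: "cochain sc \<phi> \<Longrightarrow>
    \<phi> (us @ u # v # ws) = signed (sdeg u * sdeg v) (\<phi> (us @ v # u # ws))"
  unfolding cochain_def by (elim conjE; blast)+

lemmas cochain_hd_add = cochain_add[where us = "[]", simplified]
  and cochain_hd_scale = cochain_scale[where us = "[]", simplified]
  and cochain_hd_ideal = cochain_ideal[where us = "[]", simplified]
  and cochain_hd_swap = cochain_swap[where us = "[]", simplified]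

text \<open>Together with the recursions for \<open>conv\<close>, \<open>ad\<close> and \<open>Q\<close>, this closure under $\partial_v$ is what makes
the inductions below work: each property has to be checked only at the beginning of a word.\<close>

lemma cochain_Cons: "cochain sc \<phi> \<Longrightarrow> cochain sc (\<lambda>w. \<phi> (v # w))"
  by (rule cochainI)
    (use cochain_add[where us = "v # _"] cochain_scale[where us = "v # _"]
      cochain_ideal[where us = "v # _"] cochain_swap[where us = "v # _"] in simp_all)

text \<open>Negation is derived from additivity, comparing with the letter of value zero.\<close>

lemma cochain_signed:
  assumes "cochain sc \<phi>" "snd u = snd x" "elt x = signed n (elt u)"
  shows "\<phi> (us @ x # ws) = signed n (\<phi> (us @ u # ws))"
proof -
  have hc0: "elt (0, e) = 0" for e by (simp add: elt_def)
  have zero: "\<phi> (us @ (0, snd x) # ws) = 0"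
    by (rule cochain_ideal[OF assms(1)]) (simp add: hc0 subspace_0[OF subspace_ideal])
  show ?thesis
  proof (cases "even n")
    case True
    have "\<phi> (us @ x # ws) = \<phi> (us @ u # ws) + \<phi> (us @ (0, snd x) # ws)"
      by (rule cochain_add[OF assms(1)]) (use assms True in \<open>simp_all add: hc0 signed_def\<close>)
    then show ?thesis using True zero by (simp add: signed_def)
  next
    case False
    have "\<phi> (us @ (0, snd x) # ws) = \<phi> (us @ x # ws) + \<phi> (us @ u # ws)"
      by (rule cochain_add[OF assms(1)]) (use assms False in \<open>simp_all add: hc0 signed_def\<close>)
    then show ?thesis using False zero by (simp add: signed_def eq_neg_iff_add_eq_0)
  qed
qed

lemmas cochain_hd_signed = cochain_signed[where us = "[]", simplified]

lemma cochain_conv: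
  assumes "cochain scale \<phi>" "cochain scale \<psi>"
  shows "cochain scale (conv m \<phi> \<psi>)"
proof (rule cochainI)
  fix us ws u v x assume *: "snd u = snd x" "snd v = snd x" "elt x = elt u + elt v"
  show "conv m \<phi> \<psi> (us @ x # ws) = conv m \<phi> \<psi> (us @ u # ws) + conv m \<phi> \<psi> (us @ v # ws)"
    using assms
  proof (induction us arbitrary: m \<phi> \<psi>)
    case Nil
    have "sdeg u = sdeg x" "sdeg v = sdeg x" using * by (simp_all add: sdeg_def)
    then show ?case
      by (simp add: cochain_hd_add[OF Nil(1) *] cochain_hd_add[OF Nil(2) *] conv_add_left conv_add_right
          signed_add algebra_simps)
  next
    case (Cons y us)
    show ?case by (simp add: Cons.IH[OF cochain_Cons[OF Cons.prems(1)] Cons.prems(2)] Cons.IH[OF Cons.prems(1) cochain_Cons[OF Cons.prems(2)]] signed_add algebra_simps)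
  qed
next
  fix us ws u x c assume *: "snd u = snd x" "elt x = scale c (elt u)"
  show "conv m \<phi> \<psi> (us @ x # ws) = scale c (conv m \<phi> \<psi> (us @ u # ws))"
    using assms
  proof (induction us arbitrary: m \<phi> \<psi>)
    case Nil
    have "sdeg u = sdeg x" using * by (simp add: sdeg_def)
    then show ?case
      by (simp add: cochain_hd_scale[OF Nil(1) *] cochain_hd_scale[OF Nil(2) *] conv_scale scale_signed
          scale_right_distrib)
  next
    case (Cons y us)
    show ?case by (simp add: Cons.IH[OF cochain_Cons[OF Cons.prems(1)] Cons.prems(2)] Cons.IH[OF Cons.prems(1) cochain_Cons[OF Cons.prems(2)]] scale_signed scale_right_distrib)
  qed
next
  fix us ws x assume *: "elt x \<in> I"
  show "conv m \<phi> \<psi> (us @ x # ws) = 0"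
    using assms
  proof (induction us arbitrary: m \<phi> \<psi>)
    case Nil
    then show ?case
      by (simp add: cochain_hd_ideal[OF Nil(1) *] cochain_hd_ideal[OF Nil(2) *])
  next
    case (Cons y us)
    show ?case by (simp add: Cons.IH[OF cochain_Cons[OF Cons.prems(1)] Cons.prems(2)] Cons.IH[OF Cons.prems(1) cochain_Cons[OF Cons.prems(2)]] )
  qed
next
  fix us ws u v
  show "conv m \<phi> \<psi> (us @ u # v # ws) = signed (sdeg u * sdeg v) (conv m \<phi> \<psi> (us @ v # u # ws))"
    using assms
  proof (induction us arbitrary: m \<phi> \<psi>)
    case Nil
    show ?case
      by (simp add: cochain_hd_swap[OF Nil(1), of u v] cochain_hd_swap[OF Nil(2), of u v] signed_add)
        (simp add: signed_def algebra_simps)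
  next
    case (Cons y us)
    show ?case by (simp add: Cons.IH[OF cochain_Cons[OF Cons.prems(1)] Cons.prems(2)] Cons.IH[OF Cons.prems(1) cochain_Cons[OF Cons.prems(2)]] signed_add algebra_simps)
  qed
qed

text \<open>The two Lie ideal properties let the bracket descend to the quotient.\<close>

lemma elt_br_letter_ideal: "elt v \<in> I \<Longrightarrow> elt (br_letter u v) \<in> I" "elt u \<in> I \<Longrightarrow> elt (br_letter u v) \<in> I"
  using lie_ideal[of "elt v" "elt u"] lie_ideal_right[of "elt u" "elt v"]
  by (simp_all add: elt_br_letter graded_commutator_homogeneous[OF elt_in elt_in])

lemma elt_br_letter_add: "snd u = snd x \<Longrightarrow> snd v = snd x \<Longrightarrow> elt x = elt u + elt v \<Longrightarrow>
    elt (br_letter x y) = elt (br_letter u y) + elt (br_letter v y) \<and> elt (br_letter y x) = elt (br_letter y u) + elt (br_letter y v)"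
  by (simp add: elt_br_letter algebra_simps signed_add)

lemma elt_br_letter_scale: "snd u = snd x \<Longrightarrow> elt x = scale c (elt u) \<Longrightarrow>
    elt (br_letter x y) = scale c (elt (br_letter u y)) \<and> elt (br_letter y x) = scale c (elt (br_letter y u))"
  by (simp add: elt_br_letter scale_mult_left scale_mult_right scale_signed scale_right_diff_distrib)

lemma elt_br_letter_swap: "elt (br_letter v u) = signed (1 + snd u * snd v) (elt (br_letter u v))"
  by (simp add: elt_br_letter signed_def mult.commute)

lemma ad_letter_add:
  assumes "cochain sc \<phi>" "snd u = snd x" "snd v = snd x" "elt x = elt u + elt v"
  shows "ad x \<phi> w = ad u \<phi> w + ad v \<phi> w"
  using assms(1)
proof (induction w arbitrary: \<phi>)
  case (Cons y w)
  have "sdeg u = sdeg x" "sdeg v = sdeg x" using assms by (simp_all add: sdeg_def)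
  moreover have "\<phi> (br_letter x y # w) = \<phi> (br_letter u y # w) + \<phi> (br_letter v y # w)"
    by (rule cochain_hd_add[OF Cons.prems]) (use assms elt_br_letter_add[of u x v y] in auto)
  ultimately show ?case
    by (simp add: Cons.IH[OF cochain_Cons[OF Cons.prems]] signed_add algebra_simps)
qed simp


lemma ad_letter_ideal:
  assumes "cochain sc \<phi>" "elt x \<in> I"
  shows "ad x \<phi> w = 0"
  using assms(1)
proof (induction w arbitrary: \<phi>)
  case (Cons y w)
  then show ?case
    by (simp add: Cons.IH[OF cochain_Cons[OF Cons.prems]] cochain_hd_ideal[OF Cons.prems elt_br_letter_ideal(2)[OF assms(2)]])
qed simp

lemma ad_letter_scale:
  assumes "module sc" "cochain sc \<phi>" "snd u = snd x" "elt x = scale c (elt u)"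
  shows "ad x \<phi> w = sc c (ad u \<phi> w)"
  using assms(2)
proof (induction w arbitrary: \<phi>)
  case Nil
  then show ?case by (simp add: module.scale_zero_right[OF assms(1)])
next
  case (Cons y w)
  have "sdeg u = sdeg x" using assms by (simp_all add: sdeg_def)
  moreover have "\<phi> (br_letter x y # w) = sc c (\<phi> (br_letter u y # w))"
    by (rule cochain_hd_scale[OF Cons.prems]) (use assms elt_br_letter_scale[of u x c y] in auto)
  ultimately show ?case
    by (simp add: Cons.IH[OF cochain_Cons[OF Cons.prems]]
        module.scale_right_distrib[OF assms(1)] module.scale_signed[OF assms(1)])
qed

lemma ad_scaled:
  assumes "module sc" shows "ad v (\<lambda>w. sc c (\<phi> w)) w = sc c (ad v \<phi> w)"
  by (induction w arbitrary: \<phi>)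
    (simp_all add: module.scale_zero_right[OF assms] module.scale_right_distrib[OF assms] module.scale_signed[OF assms])

lemma Q_scaled:
  assumes "module sc" shows "Q (\<lambda>w. sc c (\<phi> w)) w = sc c (Q \<phi> w)"
  by (induction w arbitrary: \<phi>)
    (simp_all add: module.scale_zero_right[OF assms] module.scale_right_distrib[OF assms]
      module.scale_right_diff_distrib[OF assms] module.scale_signed[OF assms] ad_scaled[OF assms])

lemma cochain_ad:
  assumes sc: "module sc" and "cochain sc \<phi>"
  shows "cochain sc (ad y \<phi>)"
proof (rule cochainI)
  fix us ws u v x assume *: "snd u = snd x" "snd v = snd x" "elt x = elt u + elt v"
  show "ad y \<phi> (us @ x # ws) = ad y \<phi> (us @ u # ws) + ad y \<phi> (us @ v # ws)"
    using assms(2)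
  proof (induction us arbitrary: \<phi>)
    case Nil
    have "\<phi> (br_letter y x # ws) = \<phi> (br_letter y u # ws) + \<phi> (br_letter y v # ws)"
      by (rule cochain_hd_add[OF Nil]) (use * elt_br_letter_add[of u x v y] in auto)
    moreover have "sdeg u = sdeg x" "sdeg v = sdeg x" using * by (simp_all add: sdeg_def)
    ultimately show ?case
      by (simp add: cochain_hd_add[OF Nil *] ad_add signed_add algebra_simps)
  next
    case (Cons z us)
    have "\<phi> (br_letter y z # us @ x # ws) = \<phi> (br_letter y z # us @ u # ws) + \<phi> (br_letter y z # us @ v # ws)"
      using cochain_add[OF Cons.prems *, of "br_letter y z # us"] by simp
    then show ?case by (simp add: Cons.IH[OF cochain_Cons[OF Cons.prems]] signed_add algebra_simps)
  qed
next
  fix us ws u x c assume *: "snd u = snd x" "elt x = scale c (elt u)"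
  show "ad y \<phi> (us @ x # ws) = sc c (ad y \<phi> (us @ u # ws))"
    using assms(2)
  proof (induction us arbitrary: \<phi>)
    case Nil
    have "\<phi> (br_letter y x # ws) = sc c (\<phi> (br_letter y u # ws))"
      by (rule cochain_hd_scale[OF Nil]) (use * elt_br_letter_scale[of u x c y] in auto)
    moreover have "sdeg u = sdeg x" using * by (simp_all add: sdeg_def)
    ultimately show ?case
      by (simp add: cochain_hd_scale[OF Nil *] ad_scaled[OF sc] module.scale_signed[OF sc]
          module.scale_right_distrib[OF sc])
  next
    case (Cons z us)
    have "\<phi> (br_letter y z # us @ x # ws) = sc c (\<phi> (br_letter y z # us @ u # ws))"
      using cochain_scale[OF Cons.prems *, of "br_letter y z # us"] by simp
    then show ?case by (simp add: Cons.IH[OF cochain_Cons[OF Cons.prems]] module.scale_signed[OF sc]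
          module.scale_right_distrib[OF sc])
  qed
next
  fix us ws x assume *: "elt x \<in> I"
  show "ad y \<phi> (us @ x # ws) = 0"
    using assms(2)
  proof (induction us arbitrary: \<phi>)
    case Nil
    then show ?case
      by (simp add: cochain_hd_ideal[OF Nil *] cochain_hd_ideal[OF Nil elt_br_letter_ideal(1)[OF *]] ad_vanishes)
  next
    case (Cons z us)
    have "\<phi> (br_letter y z # us @ x # ws) = 0"
      using cochain_ideal[OF Cons.prems *, of "br_letter y z # us"] by simp
    then show ?case by (simp add: Cons.IH[OF cochain_Cons[OF Cons.prems]])
  qed
next
  fix us ws u v
  show "ad y \<phi> (us @ u # v # ws) = signed (sdeg u * sdeg v) (ad y \<phi> (us @ v # u # ws))"
    using assms(2)
  proof (induction us arbitrary: \<phi>)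
    case Nil
    show ?case
      by (simp add: cochain_hd_swap[OF Nil, of "br_letter y u" v] cochain_hd_swap[OF Nil, of u "br_letter y v"]
          cochain_hd_swap[OF Nil, of u v] signed_add)
        (cases "even (sdeg u)"; cases "even (sdeg v)"; cases "even (sdeg y)"; simp add: signed_def)
  next
    case (Cons z us)
    have "\<phi> (br_letter y z # us @ u # v # ws) = signed (sdeg u * sdeg v) (\<phi> (br_letter y z # us @ v # u # ws))"
      using cochain_swap[OF Cons.prems, of "br_letter y z # us" u v ws] by simp
    then show ?case by (simp add: Cons.IH[OF cochain_Cons[OF Cons.prems]] signed_add algebra_simps)
  qed
qed

text \<open>This is the well-definedness of the codifferential on $S(L[1])$, in dual form: multilinearity in each
slot, independence of the representatives modulo \<open>I\<close> and compatibility with graded symmetry.\<close>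

lemma cochain_Q:
  assumes sc: "module sc" and "cochain sc \<phi>"
  shows "cochain sc (Q \<phi>)"
proof (rule cochainI)
  fix us ws u v x assume *: "snd u = snd x" "snd v = snd x" "elt x = elt u + elt v"
  show "Q \<phi> (us @ x # ws) = Q \<phi> (us @ u # ws) + Q \<phi> (us @ v # ws)"
    using assms(2)
  proof (induction us arbitrary: \<phi>)
    case Nil
    have "\<phi> (d_letter x # ws) = \<phi> (d_letter u # ws) + \<phi> (d_letter v # ws)"
      by (rule cochain_hd_add[OF Nil]) (use * in \<open>auto simp: elt_d_letter d.add\<close>)
    moreover have "sdeg u = sdeg x" "sdeg v = sdeg x" using * by (simp_all add: sdeg_def)
    ultimately show ?case using *
      by (simp add: cochain_hd_add[OF Nil *] Q_add ad_letter_add[OF Nil *] signed_add algebra_simps)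
  next
    case (Cons z us)
    have "\<phi> (d_letter z # us @ x # ws) = \<phi> (d_letter z # us @ u # ws) + \<phi> (d_letter z # us @ v # ws)"
      using cochain_add[OF Cons.prems *, of "d_letter z # us"] by simp
    then show ?case
      by (simp add: Cons.IH[OF cochain_Cons[OF Cons.prems]] cochain_add[OF cochain_ad[OF sc Cons.prems] *]
          signed_add algebra_simps)
  qed
next
  fix us ws u x c assume *: "snd u = snd x" "elt x = scale c (elt u)"
  show "Q \<phi> (us @ x # ws) = sc c (Q \<phi> (us @ u # ws))"
    using assms(2)
  proof (induction us arbitrary: \<phi>)
    case Nil
    have "\<phi> (d_letter x # ws) = sc c (\<phi> (d_letter u # ws))"
      by (rule cochain_hd_scale[OF Nil]) (use * in \<open>auto simp: elt_d_letter d.scale\<close>)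
    moreover have "sdeg u = sdeg x" using * by (simp_all add: sdeg_def)
    ultimately show ?case using *
      by (simp add: cochain_hd_scale[OF Nil *] Q_scaled[OF sc] ad_letter_scale[OF sc Nil *]
          module.scale_signed[OF sc] module.scale_right_distrib[OF sc] module.scale_right_diff_distrib[OF sc])
  next
    case (Cons z us)
    have "\<phi> (d_letter z # us @ x # ws) = sc c (\<phi> (d_letter z # us @ u # ws))"
      using cochain_scale[OF Cons.prems *, of "d_letter z # us"] by simp
    then show ?case
      by (simp add: Cons.IH[OF cochain_Cons[OF Cons.prems]] cochain_scale[OF cochain_ad[OF sc Cons.prems] *]
          module.scale_signed[OF sc] module.scale_right_distrib[OF sc] module.scale_right_diff_distrib[OF sc])
  qed
next
  fix us ws x assume *: "elt x \<in> I"
  show "Q \<phi> (us @ x # ws) = 0"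
    using assms(2)
  proof (induction us arbitrary: \<phi>)
    case Nil
    have "\<phi> (d_letter x # ws) = 0"
      by (rule cochain_hd_ideal[OF Nil]) (simp add: elt_d_letter d_ideal *)
    then show ?case
      by (simp add: cochain_hd_ideal[OF Nil *] ad_letter_ideal[OF Nil *] Q_vanishes)
  next
    case (Cons z us)
    have "\<phi> (d_letter z # us @ x # ws) = 0"
      using cochain_ideal[OF Cons.prems *, of "d_letter z # us"] by simp
    then show ?case
      by (simp add: Cons.IH[OF cochain_Cons[OF Cons.prems]] cochain_ideal[OF cochain_ad[OF sc Cons.prems] *])
  qed
next
  fix us ws u v
  show "Q \<phi> (us @ u # v # ws) = signed (sdeg u * sdeg v) (Q \<phi> (us @ v # u # ws))"
    using assms(2)
  proof (induction us arbitrary: \<phi>)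
    case Nil
    show ?case
      by (simp add: cochain_hd_swap[OF Nil, of "d_letter u" v] cochain_hd_swap[OF Nil, of u "d_letter v"]
          cochain_hd_swap[OF Nil, of u v] cochain_hd_signed[OF Nil _ elt_br_letter_swap[of v u]] signed_add signed_diff)
        (cases "even (snd u)"; cases "even (snd v)"; simp add: signed_def sdeg_def)
  next
    case (Cons z us)
    have "\<phi> (d_letter z # us @ u # v # ws) = signed (sdeg u * sdeg v) (\<phi> (d_letter z # us @ v # u # ws))"
      using cochain_swap[OF Cons.prems, of "d_letter z # us" u v ws] by simp
    then show ?case
      by (simp add: Cons.IH[OF cochain_Cons[OF Cons.prems]]
          cochain_swap[OF cochain_ad[OF sc Cons.prems], of z us u v ws] signed_add signed_diff algebra_simps)
  qed
qed

text \<open>Graded symmetry moves each bracket to the front of the word.\<close>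

lemma ad_eq_sum:
  assumes "cochain sc \<phi>"
  shows "ad v \<phi> w = (\<Sum>j<length w. signed (sdeg (w ! j) * (\<Sum>l<j. sdeg (w ! l)))
    (\<phi> (br_letter v (w ! j) # nths w (- {j}))))"
  using assms
proof (induction w arbitrary: \<phi>)
  case (Cons u w)
  have compl: "{i. Suc i \<noteq> Suc j} = - {j}" "{i. i \<noteq> j} = - {j}" for j by auto
  have "ad v (\<lambda>w. \<phi> (u # w)) w = (\<Sum>j<length w. signed (sdeg (w ! j) * (\<Sum>l<j. sdeg (w ! l))
      + sdeg u * (sdeg v + sdeg (w ! j) + 1)) (\<phi> (br_letter v (w ! j) # u # nths w (- {j}))))"
    by (subst Cons.IH[OF cochain_Cons[OF Cons.prems]], subst cochain_hd_swap[OF Cons.prems])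
      (simp add: algebra_simps)
  then show ?case
    apply (simp add: sum.lessThan_Suc_shift nths_Cons signed_sum compl nths_all del: sum.lessThan_Suc)
    by (intro sum.cong refl signed_cong)
      (simp add: algebra_simps)
qed simp

text \<open>The explicit codifferential. The pair $i<j$ corresponds to the unshuffle that brings the letters
\<open>i\<close> and \<open>j\<close> to the front, and the first two summands of the exponent are its Koszul sign.\<close>

lemma Q_eq_sum:
  assumes "cochain sc \<phi>"
  shows "Q \<phi> w = (\<Sum>i<length w. signed (1 + (\<Sum>l<i. sdeg (w ! l))) (\<phi> (w[i := d_letter (w ! i)])))
    + (\<Sum>i<length w. \<Sum>j<length w. if i < j then
        signed (sdeg (w ! i) * (\<Sum>l<i. sdeg (w ! l)) + sdeg (w ! j) * (\<Sum>l\<in>{..<j} - {i}. sdeg (w ! l)) + snd (w ! i))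
          (\<phi> (br_letter (w ! i) (w ! j) # nths w (- {i, j}))) else 0)"
  (is "_ = ?L \<phi> w + ?B \<phi> w")
  using assms
proof (induction w arbitrary: \<phi>)
  case (Cons v w)
  \<comment> \<open>both sums are split according to whether they touch the first letter\<close>
  have 1: "?L \<phi> (v # w) = - \<phi> (d_letter v # w) + signed (sdeg v) (?L (\<lambda>w. \<phi> (v # w)) w)"
    by (simp add: sum.lessThan_Suc_shift signed_sum algebra_simps del: sum.lessThan_Suc)
  have compl: "{l. Suc l \<noteq> Suc i \<and> Suc l \<noteq> Suc j} = - {i, j}" "{l. l \<noteq> i \<and> l \<noteq> j} = - {i, j}"
    "{i. Suc i \<noteq> Suc j} = - {j}" "{i. i \<noteq> j} = - {j}" for i j by auto
  have img: "{..<Suc j} - {Suc i} = insert 0 (Suc ` ({..<j} - {i}))" for i j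
    by (auto simp: image_iff less_Suc_eq_0_disj)
  have img0: "{..<Suc j} - {0} = Suc ` {..<j}" for j
    by (auto simp: image_iff less_Suc_eq_0_disj)
  have "signed (sdeg v) (?B (\<lambda>w. \<phi> (v # w)) w) = (\<Sum>i<length w. \<Sum>j<length w. if i < j then
        signed (sdeg v + (sdeg (w ! i) * (\<Sum>l<i. sdeg (w ! l)) + sdeg (w ! j) * (\<Sum>l\<in>{..<j} - {i}. sdeg (w ! l)) + snd (w ! i))
          + sdeg v * (sdeg (w ! i) + sdeg (w ! j) + 1))
          (\<phi> (br_letter (w ! i) (w ! j) # v # nths w (- {i, j}))) else 0)"
    unfolding signed_sum
    by (intro sum.cong refl) (simp add: cochain_hd_swap[OF Cons.prems, of v "br_letter _ _"] algebra_simps)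
  then have 2: "?B \<phi> (v # w) = signed (snd v) (ad v \<phi> w) + signed (sdeg v) (?B (\<lambda>w. \<phi> (v # w)) w)"
    apply (simp add: sum.lessThan_Suc_shift ad_eq_sum[OF Cons.prems] signed_sum nths_Cons compl img img0 sum.reindex
        cong: if_cong del: sum.lessThan_Suc)
    apply (rule arg_cong2[where f = "(+)"])
     apply (intro sum.cong refl signed_cong)
     apply (simp add: algebra_simps)
    by (intro sum.cong refl if_cong signed_cong)
      (simp add: algebra_simps)
  show ?case
    unfolding 1 2 using Cons.IH[OF cochain_Cons[OF Cons.prems], of v] by (simp add: signed_add)
qed simp

end

section \<open>Unshuffles that bring two letters to the front\<close>

lemma nths_eq_map_filter: "nths xs A = map ((!) xs) (filter (\<lambda>i. i \<in> A) [0..<length xs])"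
proof -
  have "zip xs [0..<length xs] = map (\<lambda>i. (xs ! i, i)) [0..<length xs]"
    by (rule nth_equalityI) simp_all
  then show ?thesis by (simp add: nths_def filter_map comp_def)
qed

context
  fixes m :: nat and \<tau> :: "nat \<Rightarrow> nat"
  assumes \<tau>: "\<tau> \<in> unshuffles 2 m"
begin

lemma unshuffle_permutes: "\<tau> permutes {..<m + 2}"
  using \<tau> by (simp add: unshuffles_def add.commute)

lemma unshuffle_less: "\<tau> 0 < \<tau> 1"
  using \<tau> by (auto simp: unshuffles_def strict_mono_on_def)

lemma unshuffle_tail_less: "2 \<le> a \<Longrightarrow> a < b \<Longrightarrow> b < m + 2 \<Longrightarrow> \<tau> a < \<tau> b"
  using \<tau> by (auto simp: unshuffles_def strict_mono_on_def)

lemma unshuffle_bound: "a < m + 2 \<Longrightarrow> \<tau> a < m + 2"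
  using permutes_in_image[OF unshuffle_permutes, of a] by simp

lemma unshuffle_eq_iff [simp]: "\<tau> a = \<tau> b \<longleftrightarrow> a = b"
  using permutes_inj[OF unshuffle_permutes] by (simp add: inj_eq)

lemma unshuffle_image_tail: "\<tau> ` {2..<m + 2} = {..<m + 2} - {\<tau> 0, \<tau> 1}"
proof -
  have "{2..<m + 2} = {..<m + 2} - {0, 1}" by auto
  then show ?thesis
    using permutes_image[OF unshuffle_permutes] permutes_inj[OF unshuffle_permutes]
    by (simp add: image_set_diff)
qed

text \<open>An unshuffle is determined by its first two values: the others are the remaining indices in
increasing order.\<close>

lemma unshuffle_tail: "map \<tau> [2..<m + 2] = filter (\<lambda>l. l \<in> - {\<tau> 0, \<tau> 1}) [0..<m + 2]"
proof (rule strict_sorted_equal)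
  show "sorted_wrt (<) (map \<tau> [2..<m + 2])"
    unfolding sorted_wrt_map
    by (rule sorted_wrt_mono_rel[of _ "(<)"]) (auto intro!: unshuffle_tail_less simp del: upt_Suc)
  show "sorted_wrt (<) (filter (\<lambda>l. l \<in> - {\<tau> 0, \<tau> 1}) [0..<m + 2])"
    by (rule sorted_wrt_filter) (rule sorted_wrt_upt)
  show "set (map \<tau> [2..<m + 2]) = set (filter (\<lambda>l. l \<in> - {\<tau> 0, \<tau> 1}) [0..<m + 2])"
    unfolding set_map set_upt set_filter unshuffle_image_tail by auto
qed

lemma prod_minus_one_powi: "(\<Prod>l\<in>A. (-1 :: 'k::field) powi f l) = (-1) powi (\<Sum>l\<in>A. f l)"
  by (induction A rule: infinite_finite_induct) (simp_all add: power_int_add)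

text \<open>As the values after the first two increase, every inversion starts at one of the first two
positions.\<close>

lemma koszul_sign_unshuffle:
  assumes "length es = m + 2"
  shows "(koszul_sign es \<tau> :: 'k::field) = (-1) powi (es ! \<tau> 0 * (\<Sum>l<\<tau> 0. es ! l)
    + es ! \<tau> 1 * (\<Sum>l\<in>{..<\<tau> 1} - {\<tau> 0}. es ! l))"
proof -
  define S where "S = {b. b < m + 2 \<and> \<tau> b < \<tau> 0}"
  define T where "T = {b. 2 \<le> b \<and> b < m + 2 \<and> \<tau> b < \<tau> 1}"
  define f :: "nat \<Rightarrow> nat \<Rightarrow> 'k" where "f a b = (-1) powi (es ! \<tau> a * es ! \<tau> b)" for a b
  have inv: "{(a, b). a < b \<and> b < length es \<and> \<tau> b < \<tau> a} = Pair 0 ` S \<union> Pair 1 ` T"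
  proof (intro equalityI subsetI; clarsimp)
    fix a b assume *: "a < b" "b < length es" "\<tau> b < \<tau> a" "(a, b) \<notin> Pair (Suc 0) ` T"
    have "\<not> 2 \<le> a" using unshuffle_tail_less[of a b] * assms by auto
    moreover have "a \<noteq> 1" using * assms by (auto simp: T_def image_iff)
    ultimately have "a = 0" by simp
    then show "(a, b) \<in> Pair 0 ` S" using * assms by (auto simp: S_def)
  next
    fix a b assume *: "(a, b) \<in> Pair 0 ` S \<or> (a, b) \<in> Pair (Suc 0) ` T"
    have "b \<noteq> 0" if "\<tau> b < \<tau> 0" using that by (metis less_irrefl)
    then show "a < b \<and> b < length es \<and> \<tau> b < \<tau> a"
      using * assms by (auto simp: S_def T_def)
  qed
  have fin: "finite S" "finite T" by (simp_all add: S_def T_def)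
  have inj: "inj_on \<tau> A" for A by (simp add: inj_on_def)
  have S: "\<tau> ` S = {..<\<tau> 0}"
  proof -
    have "l \<in> \<tau> ` S" if "l < \<tau> 0" for l
    proof -
      have "l \<in> \<tau> ` {..<m + 2}"
        unfolding permutes_image[OF unshuffle_permutes]
        using that unshuffle_bound[of 0] by simp
      then show ?thesis using that by (auto simp: S_def)
    qed
    then show ?thesis by (auto simp: S_def)
  qed
  have T: "\<tau> ` T = {..<\<tau> 1} - {\<tau> 0}"
  proof -
    have "l \<in> \<tau> ` T" if "l < \<tau> 1" "l \<noteq> \<tau> 0" for l
    proof -
      have "l \<in> \<tau> ` {2..<m + 2}"
        unfolding unshuffle_image_tail
        using that unshuffle_bound[of 1] by simp
      then show ?thesis using that by (auto simp: T_def)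
    qed
    then show ?thesis by (auto simp: T_def)
  qed
  have sumS: "(\<Sum>b\<in>S. es ! \<tau> b) = (\<Sum>l<\<tau> 0. es ! l)"
    using sum.reindex[OF inj, of "(!) es" S] by (simp add: S comp_def)
  have sumT: "(\<Sum>b\<in>T. es ! \<tau> b) = (\<Sum>l\<in>{..<\<tau> 1} - {\<tau> 0}. es ! l)"
    using sum.reindex[OF inj, of "(!) es" T] unfolding T by (simp only: comp_def)
  have "koszul_sign es \<tau> = (\<Prod>(a, b) \<in> Pair 0 ` S \<union> Pair 1 ` T. f a b)"
    by (simp only: koszul_sign_def inv f_def)
  also have "\<dots> = (\<Prod>b\<in>S. f 0 b) * (\<Prod>b\<in>T. f 1 b)"
    by (subst prod.union_disjoint) (auto simp: fin prod.reindex inj_on_def)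
  also have "\<dots> = (-1) powi (\<Sum>b\<in>S. es ! \<tau> 0 * es ! \<tau> b) * (-1) powi (\<Sum>b\<in>T. es ! \<tau> 1 * es ! \<tau> b)"
    by (simp add: f_def prod_minus_one_powi)
  also have "\<dots> = (-1) powi (es ! \<tau> 0 * (\<Sum>b\<in>S. es ! \<tau> b) + es ! \<tau> 1 * (\<Sum>b\<in>T. es ! \<tau> b))"
    by (simp add: power_int_add sum_distrib_left)
  finally show ?thesis by (simp only: sumS sumT)
qed

end

lemma bij_betw_unshuffles:
  "bij_betw (\<lambda>\<tau>. (\<tau> 0, \<tau> 1)) (unshuffles 2 m) {(i, j). i < j \<and> j < m + 2}"
proof (rule bij_betw_imageI)
  show "inj_on (\<lambda>\<tau>. (\<tau> 0, \<tau> 1 :: nat)) (unshuffles 2 m)"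
  proof (rule inj_onI)
    fix \<sigma> \<tau> assume \<sigma>: "\<sigma> \<in> unshuffles 2 m" and \<tau>: "\<tau> \<in> unshuffles 2 m" and eq: "(\<sigma> 0, \<sigma> 1) = (\<tau> 0, \<tau> 1)"
    have "map \<sigma> [2..<m + 2] = map \<tau> [2..<m + 2]"
      using eq by (simp only: unshuffle_tail[OF \<sigma>] unshuffle_tail[OF \<tau>] prod.inject)
    then have tl: "\<sigma> a = \<tau> a" if "2 \<le> a" "a < m + 2" for a
      using that unfolding map_eq_conv set_upt by (simp only: atLeastLessThan_iff)
    have "\<sigma> a = \<tau> a" for a
    proof -
      consider "a = 0" | "a = 1" | "2 \<le> a" "a < m + 2" | "m + 2 \<le> a" by linarith
      then show ?thesis
        using eq tl[of a] permutes_not_in[OF unshuffle_permutes[OF \<sigma>], of a]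
          permutes_not_in[OF unshuffle_permutes[OF \<tau>], of a] by cases auto
    qed
    then show "\<sigma> = \<tau>" by blast
  qed
  show "(\<lambda>\<tau>. (\<tau> 0, \<tau> 1)) ` unshuffles 2 m = {(i, j). i < j \<and> j < m + 2}"
  proof (intro equalityI subsetI)
    fix p assume "p \<in> (\<lambda>\<tau>. (\<tau> 0, \<tau> 1)) ` unshuffles 2 m"
    then show "p \<in> {(i, j). i < j \<and> j < m + 2}"
      using unshuffle_less unshuffle_bound[of _ m 1] by auto
  next
    fix p assume "p \<in> {(i, j). i < j \<and> j < m + 2}"
    then obtain i j where p: "p = (i, j)" "i < j" "j < m + 2" by auto
    define R where "R = filter (\<lambda>l. l \<noteq> i \<and> l \<noteq> j) [0..<m + 2]"
    define xs where "xs = i # j # R"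
    define \<tau> where "\<tau> a = (if a < m + 2 then xs ! a else a)" for a
    have set: "set xs = {..<m + 2}" and dist: "distinct xs"
      using p by (auto simp: xs_def R_def)
    have len: "length xs = m + 2"
      using distinct_card[OF dist] set by simp
    have srt: "sorted_wrt (<) R"
      unfolding R_def by (rule sorted_wrt_filter) (rule sorted_wrt_upt)
    have "bij_betw ((!) xs) {..<m + 2} {..<m + 2}"
      by (rule bij_betw_nth[OF dist]) (simp_all add: len set)
    then have "bij_betw \<tau> {..<m + 2} {..<m + 2}"
      by (rule bij_betw_cong[THEN iffD1, rotated]) (simp add: \<tau>_def)
    then have "\<tau> permutes {..<m + 2}"
      by (rule bij_imp_permutes) (simp add: \<tau>_def)
    moreover have "strict_mono_on {..<2} \<tau>"
      using p by (auto simp: strict_mono_on_def \<tau>_def xs_def less_2_cases_iff)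
    moreover have "strict_mono_on {2..<2 + m} \<tau>"
    proof (rule strict_mono_onI)
      fix a b :: nat assume *: "a \<in> {2..<2 + m}" "b \<in> {2..<2 + m}" "a < b"
      then have "R ! (a - 2) < R ! (b - 2)"
        by (intro sorted_wrt_nth_less[OF srt]) (use len in \<open>auto simp: xs_def\<close>)
      moreover have "xs ! c = R ! (c - 2)" if "2 \<le> c" for c
        using that by (auto simp: xs_def nth_Cons' numeral_2_eq_2)
      ultimately show "\<tau> a < \<tau> b" using * by (simp add: \<tau>_def)
    qed
    ultimately have "\<tau> \<in> unshuffles 2 m" by (simp add: unshuffles_def add.commute)
    moreover have "(\<tau> 0, \<tau> 1) = p" by (simp add: \<tau>_def xs_def p)
    ultimately show "p \<in> (\<lambda>\<tau>. (\<tau> 0, \<tau> 1)) ` unshuffles 2 m" by blast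
  qed
qed

section \<open>Quotients and the universal property of the symmetric coalgebra\<close>

lemma lookup_free_scale [simp]:
  "Poly_Mapping.lookup (free_scale c p) w = c * Poly_Mapping.lookup p w"
  by (simp add: free_scale_def Poly_Mapping.map.rep_eq when_def)

interpretation free: vector_space "free_scale :: 'k::field \<Rightarrow> ('w \<Rightarrow>\<^sub>0 'k) \<Rightarrow> _"
  by unfold_locales (rule poly_mapping_eqI, simp add: lookup_add algebra_simps)+

lemma sum_words: "p = (\<Sum>w\<in>Poly_Mapping.keys p. free_scale (Poly_Mapping.lookup p w) (Poly_Mapping.single w 1))"
proof (rule poly_mapping_eqI)
  fix v
  have "(\<Sum>w\<in>Poly_Mapping.keys p. Poly_Mapping.lookup p w * (1 when w = v))
      = (\<Sum>w\<in>Poly_Mapping.keys p. if w = v then Poly_Mapping.lookup p w else 0)"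
    by (intro sum.cong refl) (simp add: when_def)
  then show "Poly_Mapping.lookup p v = Poly_Mapping.lookup (\<Sum>w\<in>Poly_Mapping.keys p.
      free_scale (Poly_Mapping.lookup p w) (Poly_Mapping.single w 1)) v"
    by (simp add: lookup_sum lookup_single in_keys_iff)
qed

text \<open>The linear extension of \<open>f\<close> to the free vector space.\<close>

definition free_lift :: "('k::field \<Rightarrow> 'b \<Rightarrow> 'b) \<Rightarrow> ('w \<Rightarrow> 'b::ab_group_add) \<Rightarrow> ('w \<Rightarrow>\<^sub>0 'k) \<Rightarrow> 'b"
  where "free_lift sc f p = (\<Sum>w\<in>Poly_Mapping.keys p. sc (Poly_Mapping.lookup p w) (f w))"

context vector_space
begin

lemma free_lift_superset:
  assumes "finite S" "Poly_Mapping.keys p \<subseteq> S"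
  shows "free_lift scale f p = (\<Sum>w\<in>S. scale (Poly_Mapping.lookup p w) (f w))"
  unfolding free_lift_def
  by (rule sum.mono_neutral_left) (use assms in \<open>auto simp: in_keys_iff\<close>)

lemma free_lift_word: "free_lift scale f (Poly_Mapping.single w 1) = f w"
  by (simp add: free_lift_def)

lemma linear_free_lift:
  fixes f :: "'w \<Rightarrow> 'b"
  shows "Vector_Spaces.linear free_scale scale (free_lift scale f)"
proof -
  interpret vector_space_pair free_scale scale
    by unfold_locales
  show ?thesis
    unfolding Vector_Spaces.linear_iff
  proof (intro conjI allI)
    fix p q :: "'w \<Rightarrow>\<^sub>0 'a"
    let ?S = "Poly_Mapping.keys p \<union> Poly_Mapping.keys q"
    have "free_lift scale f (p + q) = (\<Sum>w\<in>?S. scale (Poly_Mapping.lookup (p + q) w) (f w))"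
      by (rule free_lift_superset) (simp_all add: keys_add)
    also have "\<dots> = free_lift scale f p + free_lift scale f q"
      by (simp add: free_lift_superset[of ?S] lookup_add scale_left_distrib sum.distrib)
    finally show "free_lift scale f (p + q) = free_lift scale f p + free_lift scale f q" .
  next
    fix c and p :: "'w \<Rightarrow>\<^sub>0 'a"
    have "free_lift scale f (free_scale c p)
        = (\<Sum>w\<in>Poly_Mapping.keys p. scale (Poly_Mapping.lookup (free_scale c p) w) (f w))"
      by (rule free_lift_superset) (auto simp: in_keys_iff)
    then show "free_lift scale f (free_scale c p) = scale c (free_lift scale f p)"
      by (simp add: free_lift_def scale_sum_right)
  qed unfold_locales
qed

end

context module
begin

lemma coset_eq_iff: "subspace N \<Longrightarrow> a +o N = b +o N \<longleftrightarrow> a - b \<in> N"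
proof
  assume N: "subspace N" and "a +o N = b +o N"
  then have "a + 0 \<in> b +o N" using subspace_0[OF N] set_plus_intro2 by metis
  then show "a - b \<in> N" by (simp add: set_plus_imp_minus)
next
  assume N: "subspace N" and ab: "a - b \<in> N"
  have "x - a \<in> N \<longleftrightarrow> x - b \<in> N" for x
    using subspace_add[OF N _ ab, of "x - a"] subspace_diff[OF N _ ab, of "x - b"]
    by (auto simp: algebra_simps)
  then show "a +o N = b +o N"
    by (auto simp: set_minus_plus[symmetric])
qed

text \<open>The operations on quotients are unions over representatives; the union is the common value if
there is one.\<close>

lemma UN_coset:
  assumes "subspace N" "\<And>x. x - a \<in> N \<Longrightarrow> g x = y"
  shows "(\<Union>x\<in>a +o N. g x) = y"
proof -
  have "a \<in> a +o N" using subspace_0[OF assms(1)] set_plus_intro2[of 0 N a] by simp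
  moreover have "g x = y" if "x \<in> a +o N" for x
    using assms(2) that by (simp add: set_plus_imp_minus)
  ultimately show ?thesis by blast
qed

lemma self_in_coset: "subspace N \<Longrightarrow> a \<in> a +o N"
  using subspace_0 set_plus_intro2[of 0 N a] by simp

lemma quotient_space_simps:
  "carr (quotient_space scale G U N) = (\<lambda>x. x +o N) ` U"
  "null (quotient_space scale G U N) = N"
  "homog (quotient_space scale G U N) i = (\<lambda>x. x +o N) ` G i"
  by (simp_all add: quotient_space_def)

lemma quotient_space_add:
  assumes "subspace N"
  shows "add (quotient_space scale G U N) (a +o N) (b +o N) = (a + b) +o N"
proof -
  have "(\<Union>x\<in>a +o N. \<Union>y\<in>b +o N. (x + y) +o N) = (a + b) +o N"
  proof (intro UN_coset assms)
    fix x y assume "x - a \<in> N" "y - b \<in> N"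
    then have "(x - a) + (y - b) \<in> N" by (rule subspace_add[OF assms])
    then show "(x + y) +o N = (a + b) +o N"
      by (simp add: coset_eq_iff[OF assms] algebra_simps)
  qed
  then show ?thesis by (simp add: quotient_space_def)
qed

lemma quotient_space_smult:
  assumes "subspace N"
  shows "smult (quotient_space scale G U N) c (a +o N) = scale c a +o N"
proof -
  have "(\<Union>x\<in>a +o N. scale c x +o N) = scale c a +o N"
  proof (intro UN_coset assms)
    fix x assume "x - a \<in> N"
    then have "scale c (x - a) \<in> N" by (rule subspace_scale[OF assms])
    then show "scale c x +o N = scale c a +o N"
      by (simp add: coset_eq_iff[OF assms] algebra_simps)
  qed
  then show ?thesis by (simp add: quotient_space_def)
qed

end

lemma quotient_complex_simps:
  "carr (quotient_complex scale G \<delta> N) = range (\<lambda>x. x +o N)"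
  "null (quotient_complex scale G \<delta> N) = N"
  "add (quotient_complex scale G \<delta> N) = add (quotient_space scale G UNIV N)"
  "smult (quotient_complex scale G \<delta> N) = smult (quotient_space scale G UNIV N)"
  "homog (quotient_complex scale G \<delta> N) = (\<lambda>i. (\<lambda>x. x +o N) ` G i)"
  "diff (quotient_complex scale G \<delta> N) X = (\<Union>x\<in>X. \<delta> x +o N)"
  by (simp_all add: quotient_complex_def graded_space.extend_def dg_space.fields_def quotient_space_def)

lemma shift_simps [simp]:
  "carr (shift n V) = carr V" "null (shift n V) = null V" "add (shift n V) = add V"
  "smult (shift n V) = smult V" "homog (shift n V) i = homog V (n + i)"
  by (simp_all add: shift_def)

lemma shift_complex_simps:
  "carr (shift_complex n V) = carr V" "null (shift_complex n V) = null V"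
  "add (shift_complex n V) = add V" "smult (shift_complex n V) = smult V"
  "homog (shift_complex n V) i = homog V (n + i)"
  "diff (shift_complex n V) x = smult V ((-1) powi n) (diff V x)"
  by (simp_all add: shift_complex_def graded_space.extend_def dg_space.fields_def shift_def)

lemma quotient_dg_lie_simps:
  "carr (quotient_dg_lie scale G d I) = range (\<lambda>x. x +o I)"
  "null (quotient_dg_lie scale G d I) = I"
  "add (quotient_dg_lie scale G d I) = add (quotient_space scale G UNIV I)"
  "smult (quotient_dg_lie scale G d I) = smult (quotient_space scale G UNIV I)"
  "homog (quotient_dg_lie scale G d I) i = (\<lambda>x. x +o I) ` G i"
  "diff (quotient_dg_lie scale G d I) X = (\<Union>x\<in>X. d x +o I)"
  "bracket (quotient_dg_lie scale G d I) X Y = (\<Union>x\<in>X. \<Union>y\<in>Y. graded_commutator scale G x y +o I)"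
  by (simp_all add: quotient_dg_lie_def dg_space.extend_def dg_lie.fields_def quotient_complex_def
      graded_space.extend_def dg_space.fields_def quotient_space_def)

context curved_lie_ideal
begin

abbreviation L where "L \<equiv> quotient_dg_lie scale G d I"
abbreviation V where "V \<equiv> shift 1 L"
abbreviation N :: "('a set list \<Rightarrow>\<^sub>0 'k) set" where "N \<equiv> sym_null V"

definition coset_of :: "'a letter \<Rightarrow> 'a set" where "coset_of v = elt v +o I"

lemma coset_eq: "a +o I = b +o I \<longleftrightarrow> a - b \<in> I"
  by (rule coset_eq_iff[OF subspace_ideal])

lemma add_L: "add L (a +o I) (b +o I) = (a + b) +o I"
  by (simp add: quotient_dg_lie_simps quotient_space_add[OF subspace_ideal])

lemma smult_L: "smult L c (a +o I) = scale c a +o I"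
  by (simp add: quotient_dg_lie_simps quotient_space_smult[OF subspace_ideal])

lemma diff_L: "diff L (a +o I) = d a +o I"
  unfolding quotient_dg_lie_simps
  by (rule UN_coset[OF subspace_ideal]) (simp add: coset_eq d.diff[symmetric] d_ideal)

lemma graded_commutator_diff_left:
  "graded_commutator scale G (a - a') b = graded_commutator scale G a b - graded_commutator scale G a' b"
  using graded_commutator_add_left[of "a - a'" a' b] by (simp add: algebra_simps)

lemma graded_commutator_diff_right:
  "graded_commutator scale G a (b - b') = graded_commutator scale G a b - graded_commutator scale G a b'"
  using graded_commutator_add_right[of a "b - b'" b'] by (simp add: algebra_simps)

lemma bracket_L: "bracket L (a +o I) (b +o I) = graded_commutator scale G a b +o I"
  unfolding quotient_dg_lie_simps
proof (intro UN_coset[OF subspace_ideal])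
  fix x y assume "x - a \<in> I" "y - b \<in> I"
  then have "graded_commutator scale G (x - a) y + graded_commutator scale G a (y - b) \<in> I"
    by (intro subspace_add[OF subspace_ideal] lie_ideal lie_ideal_right)
  then show "graded_commutator scale G x y +o I = graded_commutator scale G a b +o I"
    by (simp add: coset_eq graded_commutator_diff_left graded_commutator_diff_right)
qed

lemma coset_of_d_letter: "coset_of (d_letter v) = diff L (coset_of v)"
  by (simp add: coset_of_def elt_d_letter diff_L)

lemma coset_of_br_letter: "coset_of (br_letter u v) = bracket L (coset_of u) (coset_of v)"
  by (simp add: coset_of_def elt_br_letter bracket_L graded_commutator_homogeneous[OF elt_in elt_in])

lemma coset_of_carr: "coset_of v \<in> carr L"
  by (simp add: coset_of_def quotient_dg_lie_simps)

lemma coset_of_homog: "coset_of v \<in> homog V (sdeg v)"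
  by (simp add: coset_of_def quotient_dg_lie_simps sdeg_def elt_in)

lemma elt_homogeneous: "a \<in> G e \<Longrightarrow> elt (a, e) = a"
  by (simp add: elt_def component_same)

lemma homogeneous_word_lift:
  assumes "list_all2 (\<lambda>x e. x \<in> homog L e) xs es"
  obtains w where "xs = map coset_of w" "es = map snd w"
  using assms
proof (induction arbitrary: thesis rule: list_all2_induct)
  case Nil
  then show ?case by simp
next
  case (Cons x xs e es)
  obtain w where w: "xs = map coset_of w" "es = map snd w" using Cons.IH by blast
  obtain a where "a \<in> G e" "x = a +o I" using Cons.hyps by (auto simp: quotient_dg_lie_simps)
  then have "x # xs = map coset_of ((a, e) # w)" "e # es = map snd ((a, e) # w)"
    using w by (simp_all add: coset_of_def elt_homogeneous)
  then show ?case by (rule Cons.prems)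
qed

text \<open>Multilinear extension from homogeneous letters to arbitrary elements, by expanding every entry into
its homogeneous components.\<close>

fun ext :: "('a letter list \<Rightarrow> 'b::ab_group_add) \<Rightarrow> 'a list \<Rightarrow> 'b"
  where
    "ext \<phi> [] = \<phi> []"
  | "ext \<phi> (a # as) = (\<Sum>i | component G a i \<noteq> 0. ext (\<lambda>w. \<phi> ((a, i) # w)) as)"

lemma ext_zero [simp]: "ext (\<lambda>w. 0) as = 0"
  by (induction as) simp_all

lemma ext_plus: "ext (\<lambda>w. \<phi> w + \<psi> w) as = ext \<phi> as + ext \<psi> as"
  by (induction as arbitrary: \<phi> \<psi>) (simp_all add: sum.distrib)

lemma ext_scaled: "module sc \<Longrightarrow> ext (\<lambda>w. sc c (\<phi> w)) as = sc c (ext \<phi> as)"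
  by (induction as arbitrary: \<phi>) (simp_all add: module.scale_sum_right)

lemma ext_signed: "ext (\<lambda>w. signed n (\<phi> w)) as = signed n (ext \<phi> as)"
  by (induction as arbitrary: \<phi>) (simp_all add: signed_sum)

context
  fixes sc :: "'k \<Rightarrow> 'b \<Rightarrow> 'b::ab_group_add"
  assumes sc: "vector_space sc"
begin

lemma module_sc: "module sc"
  using sc by (simp add: module_iff_vector_space)

lemma cochain_zero_component:
  "cochain sc \<phi> \<Longrightarrow> component G a i = 0 \<Longrightarrow> \<phi> ((a, i) # w) = 0"
  by (rule cochain_hd_ideal) (auto simp: elt_def subspace_0[OF subspace_ideal])

text \<open>Degrees with zero component contribute nothing, so two elements can be expanded over a common index
set.\<close>

lemma ext_superset:
  assumes "cochain sc \<phi>" "finite S" "\<And>i. component G a i \<noteq> 0 \<Longrightarrow> i \<in> S"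
  shows "ext \<phi> (a # as) = (\<Sum>i\<in>S. ext (\<lambda>w. \<phi> ((a, i) # w)) as)"
  unfolding ext.simps
  by (rule sum.mono_neutral_left) (use assms in \<open>auto simp: cochain_zero_component\<close>)

lemma ext_homogeneous:
  assumes "cochain sc \<phi>" "a \<in> G i"
  shows "ext \<phi> (a # as) = ext (\<lambda>w. \<phi> ((a, i) # w)) as"
  by (subst ext_superset[OF assms(1), of "{i}"])
    (auto simp: component_homogeneous[OF assms(2)] split: if_splits)

lemma ext_letters: "cochain sc \<phi> \<Longrightarrow> ext \<phi> (map elt w) = \<phi> w"
proof (induction w arbitrary: \<phi>)
  case (Cons v w)
  have "\<phi> ((elt v, snd v) # w) = \<phi> (v # w)" for w
    using cochain_hd_signed[OF Cons.prems, of v "(elt v, snd v)" 0 w]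
    by (simp add: elt_homogeneous elt_in)
  then show ?case
    using Cons by (simp add: ext_homogeneous[OF Cons.prems elt_in] Cons.IH[OF cochain_Cons] del: ext.simps(2))
qed simp

lemma ext_add: "cochain sc \<phi> \<Longrightarrow> ext \<phi> (us @ (a + b) # ws) = ext \<phi> (us @ a # ws) + ext \<phi> (us @ b # ws)"
proof (induction us arbitrary: \<phi>)
  case Nil
  let ?S = "{i. component G a i \<noteq> 0} \<union> {i. component G b i \<noteq> 0}"
  have "ext \<phi> (c # ws) = (\<Sum>i\<in>?S. ext (\<lambda>w. \<phi> ((c, i) # w)) ws)" if "c \<in> {a, b, a + b}" for c
    by (rule ext_superset[OF Nil]) (use that in \<open>auto simp: finite_component component_add\<close>)
  moreover have "\<phi> ((a + b, i) # w) = \<phi> ((a, i) # w) + \<phi> ((b, i) # w)" for i w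
    by (rule cochain_hd_add[OF Nil]) (simp_all add: elt_def component_add)
  ultimately show ?case
    by (simp add: ext_plus sum.distrib del: ext.simps)
next
  case (Cons c us)
  then show ?case
    by (simp add: Cons.IH[OF cochain_Cons[OF Cons.prems]] sum.distrib)
qed

lemma ext_scale: "cochain sc \<phi> \<Longrightarrow> ext \<phi> (us @ scale c a # ws) = sc c (ext \<phi> (us @ a # ws))"
proof (induction us arbitrary: \<phi>)
  case Nil
  let ?S = "{i. component G a i \<noteq> 0}"
  have "ext \<phi> (b # ws) = (\<Sum>i\<in>?S. ext (\<lambda>w. \<phi> ((b, i) # w)) ws)" if "b \<in> {a, scale c a}" for b
    by (rule ext_superset[OF Nil]) (use that in \<open>auto simp: finite_component component_scale\<close>)
  moreover have "\<phi> ((scale c a, i) # w) = sc c (\<phi> ((a, i) # w))" for i w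
    by (rule cochain_hd_scale[OF Nil]) (simp_all add: elt_def component_scale)
  ultimately show ?case
    by (simp add: ext_scaled[OF module_sc] module.scale_sum_right[OF module_sc] del: ext.simps)
next
  case (Cons b us)
  then show ?case
    by (simp add: Cons.IH[OF cochain_Cons[OF Cons.prems]] module.scale_sum_right[OF module_sc])
qed

lemma ext_ideal: "cochain sc \<phi> \<Longrightarrow> a \<in> I \<Longrightarrow> ext \<phi> (us @ a # ws) = 0"
proof (induction us arbitrary: \<phi>)
  case Nil
  have "\<phi> ((a, i) # w) = 0" for i w
    by (rule cochain_hd_ideal[OF Nil(1)]) (simp add: elt_def homogeneous_ideal Nil)
  then show ?case by simp
next
  case (Cons b us)
  then show ?case
    by (simp add: Cons.IH[OF cochain_Cons[OF Cons.prems(1)]])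
qed

lemma ext_swap:
  assumes "a \<in> G i" "b \<in> G j"
  shows "cochain sc \<phi> \<Longrightarrow>
    ext \<phi> (us @ a # b # ws) = signed ((i - 1) * (j - 1)) (ext \<phi> (us @ b # a # ws))"
proof (induction us arbitrary: \<phi>)
  case Nil
  have "\<phi> ((a, i) # (b, j) # w) = signed ((i - 1) * (j - 1)) (\<phi> ((b, j) # (a, i) # w))" for w
    using cochain_hd_swap[OF Nil, of "(a, i)" "(b, j)"] by (simp add: sdeg_def)
  then show ?case
    by (simp add: ext_homogeneous[OF Nil assms(1)] ext_homogeneous[OF Nil assms(2)]
        ext_homogeneous[OF cochain_Cons[OF Nil] assms(1)] ext_homogeneous[OF cochain_Cons[OF Nil] assms(2)]
        ext_signed del: ext.simps(2))
next
  case (Cons c us)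
  then show ?case
    by (simp add: Cons.IH[OF cochain_Cons[OF Cons.prems(1)]] signed_sum)
qed

text \<open>A multilinear function that vanishes on \<open>I\<close> depends only on the cosets of its arguments.\<close>

lemma ext_cong:
  "cochain sc \<phi> \<Longrightarrow> list_all2 (\<lambda>a b. a - b \<in> I) as bs \<Longrightarrow> ext \<phi> as = ext \<phi> bs"
proof (induction as arbitrary: bs \<phi>)
  case (Cons a as)
  then obtain b bs' where bs: "bs = b # bs'" "a - b \<in> I" "list_all2 (\<lambda>a b. a - b \<in> I) as bs'"
    by (auto simp: list_all2_Cons1)
  have "ext \<phi> (b # as) = ext \<phi> (b # bs')"
    using Cons.IH[OF cochain_Cons[OF Cons.prems(1)] bs(3)] by simp
  moreover have "ext \<phi> (a # as) = ext \<phi> (b # as)"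
    using ext_add[OF Cons.prems(1), of "[]" b "a - b" as] ext_ideal[OF Cons.prems(1) bs(2), of "[]" as]
    by (simp del: ext.simps)
  ultimately show ?case using bs by simp
qed simp

definition rep :: "'a set \<Rightarrow> 'a" where "rep X = (SOME a. a \<in> X)"

lemma rep_coset: "rep (a +o I) - a \<in> I"
proof -
  have "rep (a +o I) \<in> a +o I"
    unfolding rep_def by (rule someI[of _ a]) (rule self_in_coset[OF subspace_ideal])
  then show ?thesis by (rule set_plus_imp_minus)
qed

lemma ext_rep:
  assumes "cochain sc \<phi>"
  shows "ext \<phi> (map rep (us @ (a +o I) # ws)) = ext \<phi> (map rep us @ a # map rep ws)"
  by (rule ext_cong[OF assms])
    (simp add: list_all2_appendI list_all2_same subspace_0[OF subspace_ideal] rep_coset)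

text \<open>The universal property of $S((A/I)[1])$. On a word of cosets the linear map is the multilinear
extension of \<open>\<phi>\<close>, evaluated at arbitrary representatives; the defining relations of the symmetric
coalgebra are killed because of the corresponding properties of \<open>\<phi>\<close>.\<close>

lemma cochain_factors:
  assumes \<phi>: "cochain sc \<phi>"
  obtains F where "Vector_Spaces.linear free_scale sc F" "\<And>p. p \<in> N \<Longrightarrow> F p = 0"
    "\<And>w. F (word (map coset_of w)) = \<phi> w"
proof -
  interpret B: vector_space sc by (rule sc)
  define F where "F = free_lift sc (\<lambda>xs. ext \<phi> (map rep xs))"
  have lin: "Vector_Spaces.linear free_scale sc F"
    unfolding F_def by (rule B.linear_free_lift)
  interpret F: Vector_Spaces.linear free_scale sc F by (rule lin)
  have F: "F (word xs) = ext \<phi> (map rep xs)" for xs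
    unfolding F_def by (rule B.free_lift_word)
  note E = ext_rep[OF \<phi>, unfolded map_append list.map(2)]
  have "F r = 0" if "r \<in> sym_relators V" for r
    using that
  proof cases
    case (additive us ws x y)
    then obtain a b where "x = a +o I" "y = b +o I" by (auto simp: quotient_dg_lie_simps)
    then show ?thesis
      using additive(1) by (simp add: F.diff F add_L E ext_add[OF \<phi>])
  next
    case (homogeneous us ws x c)
    then obtain a where "x = a +o I" by (auto simp: quotient_dg_lie_simps)
    then show ?thesis
      using homogeneous(1) by (simp add: F.diff F.scale F smult_L E ext_scale[OF \<phi>])
  next
    case (commutative us ws x i y j)
    then obtain a b where ab: "x = a +o I" "y = b +o I" "a \<in> G (1 + i)" "b \<in> G (1 + j)"
      by (auto simp: quotient_dg_lie_simps)
    have "ext \<phi> (map rep (us @ (a +o I) # (b +o I) # ws)) = ext \<phi> (map rep us @ a # b # map rep ws)" for a b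
      by (rule ext_cong[OF \<phi>])
        (simp add: list_all2_appendI list_all2_same subspace_0[OF subspace_ideal] rep_coset)
    then show ?thesis
      using commutative(1) ab ext_swap[OF ab(3,4) \<phi>]
      by (simp add: F.diff F.scale F B.scale_powi)
  qed
  then have "F p = 0" if "p \<in> N" for p
    using F.eq_0_on_span[of "sym_relators V" p] that unfolding sym_null_def by blast
  moreover have "F (word (map coset_of w)) = \<phi> w" for w
  proof -
    have "ext \<phi> (map rep (map coset_of w)) = ext \<phi> (map elt w)"
      by (rule ext_cong[OF \<phi>]) (simp add: list_all2_conv_all_nth coset_of_def rep_coset)
    then show ?thesis by (simp add: F ext_letters[OF \<phi>])
  qed
  ultimately show ?thesis using that lin by blast
qed

end

end

section \<open>The codifferential and the morphism defined by a cochain\<close>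

lemma (in module) subspace_modulo:
  assumes "subspace S" "subspace N"
  shows "subspace {p. \<exists>u\<in>S. p - u \<in> N}"
proof (rule subspaceI)
  show "0 \<in> {p. \<exists>u\<in>S. p - u \<in> N}" using assms subspace_0 by force
next
  fix x y assume "x \<in> {p. \<exists>u\<in>S. p - u \<in> N}" "y \<in> {p. \<exists>u\<in>S. p - u \<in> N}"
  then obtain u v where "u \<in> S" "v \<in> S" "x - u \<in> N" "y - v \<in> N" by blast
  then have "u + v \<in> S" "x + y - (u + v) \<in> N"
    using assms subspace_add[of N "x - u" "y - v"] by (simp_all add: subspace_add algebra_simps)
  then show "x + y \<in> {p. \<exists>u\<in>S. p - u \<in> N}" by blast
next
  fix c x assume "x \<in> {p. \<exists>u\<in>S. p - u \<in> N}"
  then obtain u where "u \<in> S" "x - u \<in> N" by blast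
  then have "scale c u \<in> S" "scale c x - scale c u \<in> N"
    using assms subspace_scale[of N "x - u" c] by (simp_all add: subspace_scale scale_right_diff_distrib)
  then show "scale c x \<in> {p. \<exists>u\<in>S. p - u \<in> N}" by blast
qed

context curved_lie_ideal
begin

lemma carr_L: "carr L = range (\<lambda>a. a +o I)"
  by (simp add: quotient_dg_lie_simps)

lemma subspace_N: "free.subspace N"
  unfolding sym_null_def by (rule free.subspace_span)

lemma relator_N: "r \<in> sym_relators V \<Longrightarrow> r \<in> N"
  unfolding sym_null_def by (rule free.span_base)

lemma set_map_coset_of: "set (map coset_of w) \<subseteq> carr V"
  using coset_of_carr by auto

text \<open>The converse of \<open>cochain_factors\<close>.\<close>

lemma cochain_of_linear:
  assumes "Vector_Spaces.linear free_scale sc F" and F0: "\<And>p. p \<in> N \<Longrightarrow> F p = 0"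
  shows "cochain sc (\<lambda>w. F (word (map coset_of w)))"
proof -
  interpret F: Vector_Spaces.linear free_scale sc F by (rule assms)
  have cs1: "coset_of w \<in> carr V" and cs2: "set (map coset_of us) \<subseteq> carr V" for w us
    using coset_of_carr by auto
  have scale: "F (word (map coset_of us @ smult V c (coset_of u) # map coset_of ws)) = sc c (F (word (map coset_of us @ coset_of u # map coset_of ws)))"
    for us u ws c
    using F0[OF relator_N[OF sym_relators.homogeneous[OF cs2 cs2 cs1]]]
    by (simp add: F.diff F.scale)
  show ?thesis
  proof (rule cochainI)
    fix us ws u v x assume "snd u = snd x" "snd v = snd x" "elt x = elt u + elt v"
    then have "coset_of x = add V (coset_of u) (coset_of v)" by (simp add: coset_of_def add_L)
    then show "F (word (map coset_of (us @ x # ws))) = F (word (map coset_of (us @ u # ws))) + F (word (map coset_of (us @ v # ws)))"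
      using F0[OF relator_N[OF sym_relators.additive[OF cs2[of us] cs2[of ws] cs1[of u] cs1[of v]]]]
      by (simp add: F.diff F.add algebra_simps)
  next
    fix us ws u x c assume "snd u = snd x" "elt x = scale c (elt u)"
    then have "coset_of x = smult V c (coset_of u)" by (simp add: coset_of_def smult_L)
    then show "F (word (map coset_of (us @ x # ws))) = sc c (F (word (map coset_of (us @ u # ws))))"
      using scale[of us c u ws] by simp
  next
    fix us ws x assume "elt x \<in> I"
    then have "coset_of x = 0 +o I" unfolding coset_of_def coset_eq by simp
    moreover have "smult V 0 (coset_of x) = 0 +o I"
      unfolding coset_of_def shift_simps smult_L by (simp only: scale_zero_left)
    ultimately have "coset_of x = smult V 0 (coset_of x)" by simp
    then show "F (word (map coset_of (us @ x # ws))) = 0"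
      using scale[of us 0 x ws] by simp
  next
    fix us ws u v
    show "F (word (map coset_of (us @ u # v # ws))) = signed (sdeg u * sdeg v) (F (word (map coset_of (us @ v # u # ws))))"
      using F0[OF relator_N[OF sym_relators.commutative[OF cs2[of us] cs2[of ws] coset_of_homog[of u] coset_of_homog[of v]]]]
      by (simp add: F.diff F.scale F.vs2.scale_powi)
  qed
qed

text \<open>The transpose of the codifferential formula on words is the operator \<open>Q\<close> on cochains. The unshuffles
are enumerated by the pairs $i<j$ of letters that they bring to the front.\<close>

lemma linear_codifferential_word:
  assumes "Vector_Spaces.linear free_scale sc F" and F0: "\<And>p. p \<in> N \<Longrightarrow> F p = 0"
  shows "F (codifferential_word L (map coset_of w) (map snd w)) = Q (\<lambda>w. F (word (map coset_of w))) w"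
proof -
  interpret F: Vector_Spaces.linear free_scale sc F by (rule assms)
  let ?\<phi> = "\<lambda>w. F (word (map coset_of w))"
  let ?n = "length w"
  have \<phi>: "cochain sc ?\<phi>" by (rule cochain_of_linear[OF assms])
  have 1: "F (\<Sum>i<?n. free_scale ((-1) powi (int i + 1 + (\<Sum>j<i. map snd w ! j)))
      (word ((map coset_of w)[i := diff L (map coset_of w ! i)])))
    = (\<Sum>i<?n. signed (1 + (\<Sum>l<i. sdeg (w ! l))) (?\<phi> (w[i := d_letter (w ! i)])))"
    unfolding F.sum
  proof (rule sum.cong[OF refl])
    fix i assume "i \<in> {..<?n}"
    then have i: "i < ?n" by simp
    have "(\<Sum>j<i. map snd w ! j) = (\<Sum>l<i. sdeg (w ! l) + 1)"
      by (rule sum.cong) (use i in \<open>simp_all add: sdeg_def\<close>)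
    then have "even (int i + 1 + (\<Sum>j<i. map snd w ! j) - (1 + (\<Sum>l<i. sdeg (w ! l))))"
      by (simp add: sum.distrib)
    moreover have "(map coset_of w)[i := diff L (map coset_of w ! i)] = map coset_of (w[i := d_letter (w ! i)])"
      using i by (simp add: map_update coset_of_d_letter)
    \<comment> \<open>the exponents agree modulo 2, as each of the $i$ shifted degrees is smaller by 1\<close>
    ultimately show "F (free_scale ((-1) powi (int i + 1 + (\<Sum>j<i. map snd w ! j)))
      (word ((map coset_of w)[i := diff L (map coset_of w ! i)])))
      = signed (1 + (\<Sum>l<i. sdeg (w ! l))) (?\<phi> (w[i := d_letter (w ! i)]))"
      by (simp only: F.scale F.vs2.scale_powi) (rule signed_cong)
  qed
  define g where "g i j = signed (sdeg (w ! i) * (\<Sum>l<i. sdeg (w ! l)) + sdeg (w ! j) * (\<Sum>l\<in>{..<j} - {i}. sdeg (w ! l))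
      + snd (w ! i)) (?\<phi> (br_letter (w ! i) (w ! j) # nths w (- {i, j})))" for i j
  have 2: "F (if 2 \<le> ?n then
       (\<Sum>\<tau> \<in> unshuffles 2 (?n - 2).
          free_scale (koszul_sign (map (\<lambda>e. e - 1) (map snd w)) \<tau> * (-1) powi (map snd w ! \<tau> 0))
            (word (bracket L (map coset_of w ! \<tau> 0) (map coset_of w ! \<tau> 1) # map (\<lambda>i. map coset_of w ! \<tau> i) [2..<?n])))
     else 0) = (\<Sum>i<?n. \<Sum>j<?n. if i < j then g i j else 0)"
  proof (cases "2 \<le> ?n")
    case True
    define m where "m = ?n - 2"
    have n: "?n = m + 2" using True by (simp add: m_def)
    have "F (free_scale (koszul_sign (map (\<lambda>e. e - 1) (map snd w)) \<tau> * (-1) powi (map snd w ! \<tau> 0))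
            (word (bracket L (map coset_of w ! \<tau> 0) (map coset_of w ! \<tau> 1) # map (\<lambda>i. map coset_of w ! \<tau> i) [2..<?n])))
        = g (\<tau> 0) (\<tau> 1)" if \<tau>: "\<tau> \<in> unshuffles 2 m" for \<tau>
    proof -
      have b: "\<tau> a < ?n" if "a < ?n" for a
        using unshuffle_bound[OF \<tau>] that n by simp
      have b01: "\<tau> 0 < ?n" "\<tau> 1 < ?n" using b n by simp_all
      have es: "map (\<lambda>e. e - 1) (map snd w) = map sdeg w" by (simp add: sdeg_def)
      have s1: "(\<Sum>l<\<tau> 0. map sdeg w ! l) = (\<Sum>l<\<tau> 0. sdeg (w ! l))"
        by (rule sum.cong) (use b01 in auto)
      have s2: "(\<Sum>l\<in>{..<\<tau> 1} - {\<tau> 0}. map sdeg w ! l) = (\<Sum>l\<in>{..<\<tau> 1} - {\<tau> 0}. sdeg (w ! l))"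
        by (rule sum.cong) (use b01 in auto)
      have "map (\<lambda>i. map coset_of w ! \<tau> i) [2..<?n] = map (\<lambda>i. coset_of (w ! i)) (map \<tau> [2..<?n])"
        unfolding map_map by (rule map_cong[OF refl]) (use b in simp)
      also have "\<dots> = map coset_of (nths w (- {\<tau> 0, \<tau> 1}))"
        unfolding n unshuffle_tail[OF \<tau>] nths_eq_map_filter by simp
      finally have tl: "map (\<lambda>i. map coset_of w ! \<tau> i) [2..<?n] = map coset_of (nths w (- {\<tau> 0, \<tau> 1}))" .
      have wd: "word (bracket L (map coset_of w ! \<tau> 0) (map coset_of w ! \<tau> 1) # map (\<lambda>i. map coset_of w ! \<tau> i) [2..<?n])
        = word (map coset_of (br_letter (w ! \<tau> 0) (w ! \<tau> 1) # nths w (- {\<tau> 0, \<tau> 1})))"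
        unfolding tl using b01 by (simp add: coset_of_br_letter)
      have sg: "koszul_sign (map (\<lambda>e. e - 1) (map snd w)) \<tau> * (-1) powi (map snd w ! \<tau> 0)
        = (-1) powi (sdeg (w ! \<tau> 0) * (\<Sum>l<\<tau> 0. sdeg (w ! l)) + sdeg (w ! \<tau> 1) * (\<Sum>l\<in>{..<\<tau> 1} - {\<tau> 0}. sdeg (w ! l))
      + snd (w ! \<tau> 0))"
        unfolding es koszul_sign_unshuffle[OF \<tau>, of "map sdeg w", unfolded length_map, OF n] s1 s2
        using b01 by (simp add: power_int_add)
      show ?thesis
        unfolding g_def wd sg by (simp only: F.scale F.vs2.scale_powi)
    qed
    then have "F (\<Sum>\<tau> \<in> unshuffles 2 m.
          free_scale (koszul_sign (map (\<lambda>e. e - 1) (map snd w)) \<tau> * (-1) powi (map snd w ! \<tau> 0))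
            (word (bracket L (map coset_of w ! \<tau> 0) (map coset_of w ! \<tau> 1) # map (\<lambda>i. map coset_of w ! \<tau> i) [2..<?n])))
      = (\<Sum>\<tau> \<in> unshuffles 2 m. (\<lambda>(i, j). g i j) (\<tau> 0, \<tau> 1))"
      unfolding F.sum by (intro sum.cong) simp_all
    also have "\<dots> = (\<Sum>(i, j) \<in> {(i, j). i < j \<and> j < ?n}. g i j)"
      unfolding n by (rule sum.reindex_bij_betw[OF bij_betw_unshuffles])
    also have "\<dots> = (\<Sum>(i, j) \<in> {..<?n} \<times> {..<?n}. if i < j then g i j else 0)"
      by (rule sum.mono_neutral_cong_left) (auto split: if_splits)
    also have "\<dots> = (\<Sum>i<?n. \<Sum>j<?n. if i < j then g i j else 0)"
      by (rule sum.cartesian_product[symmetric])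
    finally show ?thesis using True by (simp only: m_def if_True)
  next
    case False
    then have "\<not> (i < j \<and> j < ?n)" for i j by auto
    then have "(\<Sum>i<?n. \<Sum>j<?n. if i < j then g i j else 0) = 0"
      by (intro sum.neutral ballI) auto
    then show ?thesis using False by (simp add: F.zero)
  qed
  show ?thesis
    unfolding codifferential_word_def Q_eq_sum[OF \<phi>] F.add length_map
    using 1 2 by (simp only: g_def)
qed

lemma coset_word_sum:
  assumes "set us \<subseteq> carr V" "set ws \<subseteq> carr V" "finite A"
  shows "word (us @ ((\<Sum>i\<in>A. f i) +o I) # ws) - (\<Sum>i\<in>A. word (us @ (f i +o I) # ws)) \<in> N"
  using assms(3)
proof (induction A rule: finite_induct)
  case empty
  have "word (us @ smult V 0 (0 +o I) # ws) - free_scale 0 (word (us @ (0 +o I) # ws)) \<in> N"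
    by (intro relator_N sym_relators.homogeneous assms(1,2)) (simp add: carr_L del: set_zero_plus)
  then show ?case by (simp add: smult_L del: set_zero_plus)
next
  case (insert i A)
  have "word (us @ add V (f i +o I) (sum f A +o I) # ws) - word (us @ (f i +o I) # ws)
      - word (us @ (sum f A +o I) # ws) \<in> N"
    by (intro relator_N sym_relators.additive assms(1,2)) (simp_all add: carr_L)
  from free.subspace_add[OF subspace_N this insert.IH] insert.hyps show ?case
    by (simp add: add_L algebra_simps)
qed

text \<open>Up to the relations, words of cosets are combinations of words of homogeneous cosets: expand the
entries one after the other, from left to right.\<close>

lemma word_in_span:
  assumes "set xs \<subseteq> carr V"
  shows "word xs \<in> free.span (range (\<lambda>w. word (map coset_of w)) \<union> N)" (is "_ \<in> free.span ?S")
proof -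
  have "word (map coset_of us @ xs) \<in> free.span ?S" for us
    using assms
  proof (induction xs arbitrary: us)
    case Nil
    then show ?case by (auto intro: free.span_base)
  next
    case (Cons x xs)
    then obtain a where x: "x = a +o I" by (auto simp: carr_L)
    let ?A = "{i. component G a i \<noteq> 0}"
    have "word (map coset_of us @ (component G a i +o I) # xs) \<in> free.span ?S" for i
      using Cons.IH[of "us @ [(a, i)]"] Cons.prems by (simp add: coset_of_def[of "(a, i)"] elt_def[of "(a, i)"])
    then have "(\<Sum>i\<in>?A. word (map coset_of us @ (component G a i +o I) # xs)) \<in> free.span ?S"
      by (rule free.span_sum)
    moreover have "word (map coset_of us @ ((\<Sum>i\<in>?A. component G a i) +o I) # xs)
        - (\<Sum>i\<in>?A. word (map coset_of us @ (component G a i +o I) # xs)) \<in> free.span ?S"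
      using coset_word_sum[of "map coset_of us" xs ?A "component G a"] Cons.prems set_map_coset_of
      by (intro free.span_base UnI2) (simp add: finite_component)
    ultimately have "word (map coset_of us @ ((\<Sum>i\<in>?A. component G a i) +o I) # xs) \<in> free.span ?S"
      using free.span_add by fastforce
    then show ?case by (simp add: component_sum x)
  qed
  from this[of "[]"] show ?thesis by simp
qed

abbreviation U :: "('a set list \<Rightarrow>\<^sub>0 'k) set" where "U \<equiv> {p. \<forall>xs \<in> Poly_Mapping.keys p. set xs \<subseteq> carr V}"

text \<open>The span of the words of degree \<open>m\<close> in the grading of $L[1]$.\<close>

definition HS :: "int \<Rightarrow> ('a set list \<Rightarrow>\<^sub>0 'k) set"
  where "HS m = free.span {word xs | xs es. list_all2 (\<lambda>x e. x \<in> homog V e) xs es \<and> sum_list es = m}"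

lemma sym_space_V: "sym_space V = quotient_space free_scale HS U N"
  by (simp add: sym_space_def HS_def[abs_def])

lemma subspace_U: "free.subspace U"
proof (rule free.subspaceI)
  fix p q assume "p \<in> U" "q \<in> U"
  then show "p + q \<in> U" using keys_add[of p q] by blast
next
  fix c p assume "p \<in> U"
  then show "free_scale c p \<in> U" by (auto simp: in_keys_iff)
qed simp

lemma U_span: "p \<in> U \<Longrightarrow> p \<in> free.span (range (\<lambda>w. word (map coset_of w)) \<union> N)"
  by (subst sum_words[of p]) (intro free.span_sum free.span_scale word_in_span, blast)

lemma word_coset_of_U: "word (map coset_of w) \<in> U"
  using set_map_coset_of by auto

lemma word_coset_of_HS: "word (map coset_of w) \<in> HS (wdeg w)"
proof -
  have "list_all2 (\<lambda>x e. x \<in> homog V e) (map coset_of w) (map sdeg w)"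
    unfolding list_all2_conv_all_nth using coset_of_homog by simp
  moreover have "sum_list (map sdeg w) = wdeg w" by (simp add: wdeg_def)
  ultimately show ?thesis unfolding HS_def by (intro free.span_base) blast
qed

lemma HS_induct:
  assumes "p \<in> HS m" "free.subspace S" "\<And>w. wdeg w = m \<Longrightarrow> word (map coset_of w) \<in> S"
  shows "p \<in> S"
proof -
  have "{word xs | xs es. list_all2 (\<lambda>x e. x \<in> homog V e) xs es \<and> sum_list es = m} \<subseteq> S"
  proof clarify
    fix xs es assume *: "list_all2 (\<lambda>x e. x \<in> homog V e) xs es" "m = sum_list es"
    then have "list_all2 (\<lambda>x e. x \<in> homog L e) xs (map ((+) 1) es)"
      by (simp add: list_all2_conv_all_nth)
    then obtain w where w: "xs = map coset_of w" "map ((+) 1) es = map snd w"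
      by (rule homogeneous_word_lift)
    then have "map (\<lambda>e. e - 1) (map ((+) 1) es) = map sdeg w" by (simp add: sdeg_def comp_def)
    then have "es = map sdeg w" by (simp add: comp_def)
    then show "word xs \<in> S" using assms(3)[of w] *(2) w(1) by (simp add: wdeg_def)
  qed
  then show ?thesis using assms(1,2) free.span_minimal unfolding HS_def by blast
qed

text \<open>The function on words with values in the free vector space that sends a word to its class is
universal, and the codifferential is the linear map that belongs to its image under \<open>Q\<close>. The classes are
realised inside the free vector space through a projection \<open>\<rho>\<close> with kernel the relations, so that all
identities are equations rather than congruences.\<close>

lemma exists_codifferential:
  obtains q where "Vector_Spaces.linear free_scale free_scale q" "\<And>p. p \<in> N \<Longrightarrow> q p = 0"
    "\<And>w. q (word (map coset_of w)) - codifferential_word L (map coset_of w) (map snd w) \<in> N"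
    "codifferential L (\<lambda>X. \<Union>p\<in>X. q p +o N)"
proof -
  obtain \<rho> where \<rho>: "Vector_Spaces.linear free_scale free_scale \<rho>" "\<And>p. p - \<rho> p \<in> N"
    "\<And>p. p \<in> N \<Longrightarrow> \<rho> p = 0"
    by (rule free.projection_along_subspace[OF subspace_N free.subspace_UNIV]) auto
  have \<rho>': "\<rho> p - p \<in> N" for p
    using free.subspace_neg[OF subspace_N \<rho>(2)[of p]] by simp
  let ?\<phi> = "\<lambda>w. \<rho> (word (map coset_of w))"
  have \<phi>: "cochain free_scale ?\<phi>"
    by (rule cochain_of_linear[OF \<rho>(1,3)])
  have vs: "vector_space (free_scale :: 'k \<Rightarrow> ('a set list \<Rightarrow>\<^sub>0 'k) \<Rightarrow> _)" by unfold_locales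
  have Q\<phi>: "cochain free_scale (Q ?\<phi>)"
    by (rule cochain_Q[OF _ \<phi>]) unfold_locales
  obtain q where q: "Vector_Spaces.linear free_scale free_scale q" "\<And>p. p \<in> N \<Longrightarrow> q p = 0"
    "\<And>w. q (word (map coset_of w)) = Q ?\<phi> w"
    by (rule cochain_factors[OF vs Q\<phi>]) blast
  interpret q: Vector_Spaces.linear free_scale free_scale q by (rule q(1))
  have qw: "q (word (map coset_of w)) - codifferential_word L (map coset_of w) (map snd w) \<in> N" for w
  proof -
    have "q (word (map coset_of w)) = \<rho> (codifferential_word L (map coset_of w) (map snd w))"
      by (simp add: q(3) linear_codifferential_word[OF \<rho>(1,3)])
    then show ?thesis using \<rho>' by simp
  qed
  define Q' where "Q' = (\<lambda>X. \<Union>p\<in>X. q p +o N)"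
  have Q': "Q' (p +o N) = q p +o N" for p
    unfolding Q'_def
    by (rule free.UN_coset[OF subspace_N]) (simp add: free.coset_eq_iff[OF subspace_N] q.diff[symmetric] q(2) free.subspace_0[OF subspace_N])
  have sub: "free.subspace {p. \<exists>u\<in>S. p - u \<in> N}" if "free.subspace S" for S
    using that subspace_N by (rule free.subspace_modulo)
  have word_modulo: "\<rho> (word (map coset_of w)) \<in> {p. \<exists>u\<in>S. p - u \<in> N}" if "word (map coset_of w) \<in> S" for w S
    using that \<rho>'[of "word (map coset_of w)"] by blast
  \<comment> \<open>applied with constant \<open>H\<close> to see that the carrier is preserved, and to the grading for the degree\<close>
  have degree: "q (word (map coset_of w)) \<in> {p. \<exists>u\<in>H (1 + wdeg w). p - u \<in> N}"
    if H: "\<And>i. free.subspace (H i)" "\<And>w. word (map coset_of w) \<in> H (wdeg w)" for H w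
  proof -
    let ?H = "\<lambda>i. {p. \<exists>u\<in>H i. p - u \<in> N}"
    have s: "free.subspace (?H i)" for i by (rule sub[OF H(1)])
    have "has_degree ?H (0 + 1) (Q ?\<phi>)"
    proof (rule has_degree_Q)
      show "0 \<in> ?H i" for i by (rule free.subspace_0[OF s])
      show "x + y \<in> ?H i" if "x \<in> ?H i" "y \<in> ?H i" for i x y
        using that by (rule free.subspace_add[OF s])
      show "- x \<in> ?H i" if "x \<in> ?H i" for i x
        using that by (rule free.subspace_neg[OF s])
      show "has_degree ?H 0 ?\<phi>"
        unfolding has_degree_def using word_modulo H(2) by simp
    qed
    then show ?thesis by (simp add: has_degree_def q(3))
  qed
  have pre: "free.subspace {p. q p \<in> S}" if "free.subspace S" for S
    using that by (intro free.subspaceI) (auto simp: q.zero q.add q.scale free.subspace_0 free.subspace_add free.subspace_scale)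
  have S: "carr (sym_space V) = (\<lambda>p. p +o N) ` U" "homog (sym_space V) i = (\<lambda>p. p +o N) ` HS i" for i
    unfolding sym_space_V by (simp_all only: free.quotient_space_simps)
  have "graded_linear_map (sym_space V) (shift 1 (sym_space V)) Q'"
    unfolding graded_linear_map_def S
  proof (intro conjI ballI allI)
    fix X assume "X \<in> (\<lambda>p. p +o N) ` U"
    then obtain p where p: "p \<in> U" "X = p +o N" by blast
    let ?S = "{p. q p \<in> {p. \<exists>u\<in>U. p - u \<in> N}}"
    have "p \<in> free.span (range (\<lambda>w. word (map coset_of w)) \<union> N)" by (rule U_span[OF p(1)])
    moreover have "range (\<lambda>w. word (map coset_of w)) \<union> N \<subseteq> ?S"
    proof (intro Un_least subsetI)
      fix r :: "'a set list \<Rightarrow>\<^sub>0 'k" assume "r \<in> range (\<lambda>w. word (map coset_of w))"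
      then obtain w where r: "r = word (map coset_of w)" by blast
      show "r \<in> ?S"
        unfolding r mem_Collect_eq using degree[of "\<lambda>_. U" w, OF subspace_U word_coset_of_U] by blast
    next
      fix r assume "r \<in> N"
      then have "q r - 0 \<in> N" using q(2) free.subspace_0[OF subspace_N] by simp
      then show "r \<in> ?S" using free.subspace_0[OF subspace_U] by blast
    qed
    ultimately have "p \<in> ?S"
      using free.span_minimal[OF _ pre[OF sub[OF subspace_U]]] by blast
    then obtain u where "u \<in> U" "q p - u \<in> N" by blast
    then show "Q' X \<in> carr (shift 1 (sym_space V))"
      unfolding p(2) Q' shift_simps(1)[of 1 "sym_space V"] S using free.coset_eq_iff[OF subspace_N] by blast
  next
    fix X Y assume "X \<in> (\<lambda>p. p +o N) ` U" "Y \<in> (\<lambda>p. p +o N) ` U"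
    then obtain p r where "X = p +o N" "Y = r +o N" by blast
    then show "Q' (add (sym_space V) X Y) = add (shift 1 (sym_space V)) (Q' X) (Q' Y)"
      unfolding shift_simps(3)[of 1 "sym_space V"] unfolding sym_space_V
      by (simp only: free.quotient_space_add[OF subspace_N] Q' q.add)
  next
    fix c X assume "X \<in> (\<lambda>p. p +o N) ` U"
    then obtain p where "X = p +o N" by blast
    then show "Q' (smult (sym_space V) c X) = smult (shift 1 (sym_space V)) c (Q' X)"
      unfolding shift_simps(4)[of 1 "sym_space V"] unfolding sym_space_V
      by (simp only: free.quotient_space_smult[OF subspace_N] Q' q.scale)
  next
    fix i X assume "X \<in> (\<lambda>p. p +o N) ` HS i"
    then obtain p where p: "p \<in> HS i" "X = p +o N" by blast
    have sHS: "free.subspace (HS j)" for j unfolding HS_def by (rule free.subspace_span)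
    have "p \<in> {p. q p \<in> {p. \<exists>u\<in>HS (1 + i). p - u \<in> N}}"
      by (rule HS_induct[OF p(1) pre[OF sub[OF sHS]]])
        (use degree[of HS, OF sHS word_coset_of_HS] in blast)
    then obtain u where "u \<in> HS (1 + i)" "q p - u \<in> N" by blast
    then show "Q' X \<in> homog (shift 1 (sym_space V)) i"
      unfolding p(2) Q' shift_simps(5)[of 1 "sym_space V"] S using free.coset_eq_iff[OF subspace_N] by blast
  qed
  moreover have "Q' (sym_class V (word [])) = null (sym_space V)"
    using q(3)[of "[]"] by (simp add: sym_class_def Q' sym_space_V free.quotient_space_simps)
  moreover have "Q' (sym_class V (word xs)) = sym_class V (codifferential_word L xs ds)"
    if hom: "list_all2 (\<lambda>x e. x \<in> homog L e) xs ds" for xs ds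
  proof -
    from hom obtain w where w: "xs = map coset_of w" "ds = map snd w"
      by (rule homogeneous_word_lift)
    show ?thesis
      unfolding sym_class_def Q' w using qw free.coset_eq_iff[OF subspace_N] by blast
  qed
  ultimately have "codifferential L Q'"
    unfolding codifferential_def by blast
  then show ?thesis using that[OF q(1,2) qw] by (simp add: Q'_def)
qed

text \<open>For even \<open>n\<close> the shifted complex has the differential \<open>\<delta>\<close>, so the equation of an $L_\infty$ morphism
says that \<open>\<delta> (f w) + Q f w\<close> vanishes modulo \<open>W\<close>. By linearity it suffices to check it on words of
homogeneous elements. The linear component at an inhomogeneous element is the sum over its components.\<close>

lemma L_infinity_morphism_of_cochain:
  fixes scaleC :: "'k \<Rightarrow> 'c::ab_group_add \<Rightarrow> 'c"
  assumes C: "cochain_complex scaleC GC \<delta>" and W: "module.subspace scaleC W" "\<And>c. c \<in> W \<Longrightarrow> \<delta> c \<in> W"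
    and f: "cochain scaleC f" "has_degree GC (n + 1) f" "f [] = 0" "\<And>w. \<delta> (f w) + Q f w \<in> W"
    and n: "even n"
  obtains \<eta> where "L_infinity_morphism L (shift_complex n (quotient_complex scaleC GC \<delta> W)) \<eta>"
    "\<And>a. linear_component L \<eta> (a +o I) = (\<Sum>i | component G a i \<noteq> 0. f [(a, i)]) +o W"
proof -
  interpret C: cochain_complex scaleC GC \<delta> by (rule C)
  interpret \<delta>: Vector_Spaces.linear scaleC scaleC \<delta> by (rule C.linear_diff)
  let ?M = "shift_complex n (quotient_complex scaleC GC \<delta> W)"
  obtain F where F: "Vector_Spaces.linear free_scale scaleC F" "\<And>p. p \<in> N \<Longrightarrow> F p = 0"
    "\<And>w. F (word (map coset_of w)) = f w"
    by (rule cochain_factors[OF C.vector_space_axioms f(1)]) blast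
  interpret F: Vector_Spaces.linear free_scale scaleC F by (rule F(1))
  obtain q where q: "Vector_Spaces.linear free_scale free_scale q" "\<And>p. p \<in> N \<Longrightarrow> q p = 0"
    "\<And>w. q (word (map coset_of w)) - codifferential_word L (map coset_of w) (map snd w) \<in> N"
    "codifferential L (\<lambda>X. \<Union>p\<in>X. q p +o N)"
    by (rule exists_codifferential) blast
  interpret q: Vector_Spaces.linear free_scale free_scale q by (rule q(1))
  have Q': "(\<Union>p\<in>p +o N. q p +o N) = q p +o N" for p
    by (rule free.UN_coset[OF subspace_N]) (simp add: free.coset_eq_iff[OF subspace_N] q.diff[symmetric] q(2) free.subspace_0[OF subspace_N])
  define \<eta> where "\<eta> X = (\<Union>p\<in>X. F p +o W)" for X
  have \<eta>: "\<eta> (p +o N) = F p +o W" for p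
    unfolding \<eta>_def
    by (rule free.UN_coset[OF subspace_N]) (simp add: C.coset_eq_iff[OF W(1)] F.diff[symmetric] F(2) C.subspace_0[OF W(1)])
  have lift_in: "F p \<in> GC (n + 1 + i)" if "p \<in> HS i" for p i
  proof -
    have "free.subspace {p. F p \<in> GC (n + 1 + i)}"
      using C.subspace_component[of "n + 1 + i"]
      by (intro free.subspaceI) (auto simp: F.zero F.add F.scale C.subspace_0 C.subspace_add C.subspace_scale)
    then have "p \<in> {p. F p \<in> GC (n + 1 + i)}"
      by (rule HS_induct[OF that]) (use has_degreeD[OF f(2)] in \<open>auto simp: F(3)\<close>)
    then show ?thesis by simp
  qed
  have S: "carr (sym_space V) = (\<lambda>p. p +o N) ` U" "homog (sym_space V) i = (\<lambda>p. p +o N) ` HS i" for i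
    unfolding sym_space_V by (simp_all only: free.quotient_space_simps)
  have "graded_linear_map (sym_space V) (shift 1 ?M) \<eta>"
    unfolding graded_linear_map_def S
  proof (intro conjI ballI allI)
    fix X assume "X \<in> (\<lambda>p. p +o N) ` U"
    then obtain p where "X = p +o N" by blast
    then show "\<eta> X \<in> carr (shift 1 ?M)" by (simp add: \<eta> shift_complex_simps quotient_complex_simps)
  next
    fix X Y assume "X \<in> (\<lambda>p. p +o N) ` U" "Y \<in> (\<lambda>p. p +o N) ` U"
    then obtain p r where "X = p +o N" "Y = r +o N" by blast
    then show "\<eta> (add (sym_space V) X Y) = add (shift 1 ?M) (\<eta> X) (\<eta> Y)"
      unfolding sym_space_V shift_simps shift_complex_simps quotient_complex_simps
      by (simp only: free.quotient_space_add[OF subspace_N] C.quotient_space_add[OF W(1)] \<eta> F.add)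
  next
    fix c X assume "X \<in> (\<lambda>p. p +o N) ` U"
    then obtain p where "X = p +o N" by blast
    then show "\<eta> (smult (sym_space V) c X) = smult (shift 1 ?M) c (\<eta> X)"
      unfolding sym_space_V shift_simps shift_complex_simps quotient_complex_simps
      by (simp only: free.quotient_space_smult[OF subspace_N] C.quotient_space_smult[OF W(1)] \<eta> F.scale)
  next
    fix i X assume "X \<in> (\<lambda>p. p +o N) ` HS i"
    then obtain p where p: "p \<in> HS i" "X = p +o N" by blast
    then show "\<eta> X \<in> homog (shift 1 ?M) i"
      using lift_in[OF p(1)] by (simp add: \<eta> shift_complex_simps quotient_complex_simps add.assoc)
  qed
  moreover have "\<eta> (sym_class V (word [])) = null ?M"
    using F(3)[of "[]"] by (simp add: sym_class_def \<eta> shift_complex_simps quotient_complex_simps f(3))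
  moreover have "\<eta> (\<Union>p\<in>X. q p +o N) = smult ?M (-1) (diff ?M (\<eta> X))" if "X \<in> carr (sym_space V)" for X
  proof -
    from that obtain p where p: "p \<in> U" "X = p +o N"
      by (auto simp: sym_space_V free.quotient_space_simps)
    have \<delta>: "(\<Union>x\<in>c +o W. \<delta> x +o W) = \<delta> c +o W" for c
      by (rule C.UN_coset[OF W(1)]) (simp add: C.coset_eq_iff[OF W(1)] \<delta>.diff[symmetric] W(2))
    \<comment> \<open>a subspace containing the relations and the homogeneous words, hence all of the carrier\<close>
    let ?S = "{p. F (q p) + \<delta> (F p) \<in> W}"
    have "free.subspace ?S"
    proof (rule free.subspaceI)
      fix x y assume "x \<in> ?S" "y \<in> ?S"
      then have "(F (q x) + \<delta> (F x)) + (F (q y) + \<delta> (F y)) \<in> W"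
        using C.subspace_add[OF W(1)] by blast
      then show "x + y \<in> ?S" by (simp add: F.add q.add \<delta>.add algebra_simps)
    next
      fix c x assume "x \<in> ?S"
      then have "scaleC c (F (q x) + \<delta> (F x)) \<in> W"
        using C.subspace_scale[OF W(1)] by blast
      then show "free_scale c x \<in> ?S" by (simp add: F.scale q.scale \<delta>.scale C.scale_right_distrib)
    qed (simp add: F.zero q.zero \<delta>.zero C.subspace_0[OF W(1)])
    moreover have "range (\<lambda>w. word (map coset_of w)) \<union> N \<subseteq> ?S"
    proof -
      have "F (q (word (map coset_of w))) = Q f w" for w
        using F(2)[OF q(3)[of w]] linear_codifferential_word[OF F(1,2), of w] by (simp add: F.diff F(3))
      then show ?thesis
        using f(4) by (auto simp: F(2,3) q(2) F.zero \<delta>.zero C.subspace_0[OF W(1)] add.commute)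
    qed
    ultimately have "p \<in> ?S"
      using U_span[OF p(1)] free.span_minimal by blast
    then have "F (q p) +o W = (- \<delta> (F p)) +o W"
      by (simp add: C.coset_eq_iff[OF W(1)])
    then show ?thesis
      unfolding p(2) Q' \<eta> shift_complex_simps quotient_complex_simps \<delta>
      using n by (simp add: C.quotient_space_smult[OF W(1)])
  qed
  ultimately have "L_infinity_morphism L ?M \<eta>"
    unfolding L_infinity_morphism_def using q(4) by blast
  moreover have "linear_component L \<eta> (a +o I) = (\<Sum>i | component G a i \<noteq> 0. f [(a, i)]) +o W" for a
  proof -
    let ?A = "{i. component G a i \<noteq> 0}"
    have "F (word [] ) = 0" using F(3)[of "[]"] f(3) by simp
    have "F (word [a +o I] - (\<Sum>i\<in>?A. word [component G a i +o I])) = 0"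
      using coset_word_sum[of "[]" "[]" ?A "component G a"] by (intro F(2)) (simp add: finite_component component_sum)
    then have "F (word [a +o I]) = (\<Sum>i\<in>?A. F (word [component G a i +o I]))"
      by (simp add: F.diff F.sum)
    also have "\<dots> = (\<Sum>i\<in>?A. f [(a, i)])"
      by (intro sum.cong refl) (simp add: F(3)[symmetric] coset_of_def elt_def)
    finally show ?thesis
      by (simp add: linear_component_def sym_class_def \<eta>)
  qed
  ultimately show ?thesis by (rule that)
qed

end

section \<open>The Chern--Simons form\<close>

context curved_lie_ideal
begin

lemma cochain_linear:
  assumes "Vector_Spaces.linear sc sc' h" "cochain sc \<phi>"
  shows "cochain sc' (\<lambda>w. h (\<phi> w))"
proof -
  interpret h: Vector_Spaces.linear sc sc' h by (rule assms)
  note \<phi> = cochain_add[OF assms(2)] cochain_scale[OF assms(2)] cochain_ideal[OF assms(2)]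
  show ?thesis
  proof (rule cochainI)
    fix us ws u v
    show "h (\<phi> (us @ u # v # ws)) = signed (sdeg u * sdeg v) (h (\<phi> (us @ v # u # ws)))"
      by (simp add: cochain_swap[OF assms(2), of us u v] h.signed_hom)
  next
    fix us ws u v x assume *: "snd u = snd x" "snd v = snd x" "elt x = elt u + elt v"
    show "h (\<phi> (us @ x # ws)) = h (\<phi> (us @ u # ws)) + h (\<phi> (us @ v # ws))"
      by (simp add: \<phi>(1)[OF *] h.add)
  next
    fix us ws u x c assume *: "snd u = snd x" "elt x = scale c (elt u)"
    show "h (\<phi> (us @ x # ws)) = sc' c (h (\<phi> (us @ u # ws)))"
      by (simp add: \<phi>(2)[OF *] h.scale)
  next
    fix us ws x assume *: "elt x \<in> I"
    show "h (\<phi> (us @ x # ws)) = 0"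
      by (simp add: \<phi>(3)[OF *] h.zero)
  qed
qed

lemma cochain_plus:
  assumes "module sc" and \<phi>: "cochain sc \<phi>" and \<psi>: "cochain sc \<psi>"
  shows "cochain sc (\<lambda>w. \<phi> w + \<psi> w)"
proof (rule cochainI)
  fix us ws u v
  show "\<phi> (us @ u # v # ws) + \<psi> (us @ u # v # ws)
    = signed (sdeg u * sdeg v) (\<phi> (us @ v # u # ws) + \<psi> (us @ v # u # ws))"
    by (simp add: cochain_swap[OF \<phi>, of us u v] cochain_swap[OF \<psi>, of us u v] signed_add)
next
  fix us ws u v x assume *: "snd u = snd x" "snd v = snd x" "elt x = elt u + elt v"
  show "\<phi> (us @ x # ws) + \<psi> (us @ x # ws)
    = \<phi> (us @ u # ws) + \<psi> (us @ u # ws) + (\<phi> (us @ v # ws) + \<psi> (us @ v # ws))"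
    by (simp add: cochain_add[OF \<phi> *] cochain_add[OF \<psi> *])
next
  fix us ws u x c assume *: "snd u = snd x" "elt x = scale c (elt u)"
  show "\<phi> (us @ x # ws) + \<psi> (us @ x # ws) = sc c (\<phi> (us @ u # ws) + \<psi> (us @ u # ws))"
    by (simp add: cochain_scale[OF \<phi> *] cochain_scale[OF \<psi> *] module.scale_right_distrib[OF assms(1)])
next
  fix us ws x assume *: "elt x \<in> I"
  show "\<phi> (us @ x # ws) + \<psi> (us @ x # ws) = 0"
    by (simp add: cochain_ideal[OF \<phi> *] cochain_ideal[OF \<psi> *])
qed

lemma cochain_const_fun: "module sc \<Longrightarrow> cochain sc (const_fun a)"
proof -
  have *: "const_fun a (us @ v # ws) = 0" for us v ws
    by (cases us) simp_all
  assume "module sc"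
  then show ?thesis by (intro cochainI) (simp_all add: * module.scale_zero_right)
qed

lemma Q_const_fun [simp]: "Q (const_fun a) w = 0"
proof -
  have "ad v (const_fun a) w = 0" for v w
    by (cases w) (simp_all add: ad_vanishes)
  then show ?thesis by (cases w) (simp_all add: Q_vanishes)
qed

lemma D_const_fun: "D n (const_fun a) = const_fun (d a)"
proof
  fix w :: "'a letter list"
  have "d (const_fun a w) = const_fun (d a) w" by (cases w) (simp_all add: d.zero)
  then show "D n (const_fun a) w = const_fun (d a) w"
    unfolding D_def Q_const_fun by simp
qed

lemma const_fun_zero [simp]: "const_fun 0 w = 0"
  by (cases w) simp_all

lemma d_one: "d 1 = 0"
  using leibniz_signed[OF one_degree, of 1] by simp

end

text \<open>A degreewise linear splitting of $A \to A/I$, presented by the idempotents \<open>\<pi> e\<close> on the components of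
degree \<open>e\<close>, with kernel the part of \<open>I\<close> of that degree.\<close>

locale split_ideal = curved_lie_ideal scale G d R I
  for scale :: "'k::field \<Rightarrow> 'a::{ring,monoid_mult} \<Rightarrow> 'a" and G d R I +
  fixes \<pi> :: "int \<Rightarrow> 'a \<Rightarrow> 'a"
  assumes linear_\<pi>: "Vector_Spaces.linear scale scale (\<pi> e)"
    and \<pi>_in: "a \<in> G e \<Longrightarrow> \<pi> e a \<in> G e"
    and \<pi>_modulo: "a \<in> G e \<Longrightarrow> a - \<pi> e a \<in> I"
    and \<pi>_ideal: "a \<in> G e \<Longrightarrow> a \<in> I \<Longrightarrow> \<pi> e a = 0"
begin

sublocale \<pi>: Vector_Spaces.linear scale scale "\<pi> e" for e
  by (rule linear_\<pi>)

text \<open>The section as a function of degree one on words. Letters are elements of \<open>A\<close>, not cosets, so the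
section of the class of \<open>a\<close> is \<open>\<pi> e a\<close>.\<close>

fun sec :: "'a letter list \<Rightarrow> 'a"
  where
    "sec [] = 0"
  | "sec [v] = \<pi> (snd v) (elt v)"
  | "sec (u # v # w) = 0"

lemma sec_eq: "sec w = \<pi> (1 + wdeg w) (val w)"
  by (cases w rule: sec.cases) (simp_all add: \<pi>.zero sdeg_def)

lemma has_degree_sec: "has_degree G 1 sec"
  unfolding has_degree_def
proof
  fix w show "sec w \<in> G (1 + wdeg w)"
    by (cases w rule: sec.cases) (simp_all add: G_intros sdeg_def \<pi>_in elt_in)
qed

lemma cochain_sec: "cochain scale sec"
proof -
  have eq: "sec (us @ v # ws) = (if us = [] \<and> ws = [] then \<pi> (snd v) (elt v) else 0)" for us v ws
    by (cases us; cases ws; cases "tl us") (auto simp: neq_Nil_conv)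
  show ?thesis
    by (rule cochainI) (auto simp: eq \<pi>.add \<pi>.scale \<pi>_ideal elt_in)
qed

definition Y :: "'a letter list \<Rightarrow> 'a" where "Y = D 1 sec"

lemma Y_eq: "Y w = d (sec w) + Q sec w"
  by (simp add: Y_def D_def)

lemma has_degree_Y: "has_degree G 2 Y"
  using has_degree_D[OF has_degree_sec] by (simp add: Y_def)

lemma cochain_Y: "cochain scale Y"
proof -
  have "cochain scale (\<lambda>w. d (sec w) + Q sec w)"
    by (intro cochain_plus cochain_linear[OF linear_d] cochain_Q cochain_sec module_axioms)
  then show ?thesis by (simp add: Y_eq[abs_def])
qed

text \<open>As \<open>sec\<close> is \<open>\<pi>\<close> composed with the projection \<open>val\<close>, the square of the codifferential of \<open>A\<close> can be
used: it is $[R,-]$, which lies in \<open>I\<close> because \<open>R\<close> does, and is killed by \<open>\<pi>\<close>.\<close>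

lemma Q_Q_sec: "Q (Q sec) w = 0"
proof -
  have h: "additive (\<lambda>a. \<pi> e a)" for e by (simp add: additive_def \<pi>.add)
  have "Q sec = (\<lambda>w. \<pi> (1 + (wdeg w + 1)) (Q val w))"
    using Q_postcompose[of "\<lambda>e. \<pi> (1 + e)" val] h by (simp add: sec_eq[abs_def] fun_eq_iff)
  then have "Q (Q sec) w = \<pi> (2 + (wdeg w + 1)) (Q (Q val) w)"
    using Q_postcompose[of "\<lambda>e. \<pi> (2 + e)" "Q val"] h by (simp add: algebra_simps)
  also have "\<dots> = 0"
  proof (cases "\<exists>v. w = [v]")
    case True
    then obtain v where w: "w = [v]" by blast
    have "R * elt v - elt v * R \<in> G (snd v + 2)"
      by (intro G_intros mult_in[OF curvature_degree elt_in] mult_in[OF elt_in curvature_degree]) simp_all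
    moreover have "R * elt v - elt v * R \<in> I"
      using lie_ideal_right[OF curvature_ideal, of "elt v"]
      by (simp add: graded_commutator_homogeneous[OF curvature_degree elt_in] signed_def)
    ultimately have "\<pi> (snd v + 2) (R * elt v - elt v * R) = 0" by (rule \<pi>_ideal)
    then show ?thesis unfolding w Q_Q_val by (simp add: sdeg_def add.commute)
  next
    case False
    then show ?thesis by (simp add: Q_Q_val \<pi>.zero split: list.splits)
  qed
  finally show ?thesis .
qed

text \<open>The identity $D^2 = [R,-]$, for the element \<open>sec\<close>.\<close>

lemma D_Y: "D 2 Y w = R * sec w - sec w * R"
proof -
  have "Q Y w = d (Q sec w)"
    by (simp add: Y_eq[abs_def] Q_add Q_additive[OF additive_d] Q_Q_sec)
  then have "D 2 Y w = d (d (sec w))"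
    by (simp add: D_def Y_eq d.add signed_def)
  also have "\<dots> = R * sec w - sec w * R"
    by (simp add: d_d graded_commutator_homogeneous[OF curvature_degree has_degreeD[OF has_degree_sec]] signed_def)
  finally show ?thesis .
qed

text \<open>The coefficients of $R_t = R + t\,D(\mathrm{sec}) + t^2\,\mathrm{sec}^2$; only \<open>r 0\<close>, \<open>r 1\<close> and \<open>r 2\<close>
occur.\<close>

fun r :: "nat \<Rightarrow> 'a letter list \<Rightarrow> 'a"
  where
    "r 0 = const_fun R"
  | "r (Suc 0) = Y"
  | "r (Suc (Suc i)) = conv 1 sec sec"

lemma conv_even: "even m \<Longrightarrow> conv m = conv 0" and conv_odd: "odd m \<Longrightarrow> conv m = conv 1"
  by (intro ext conv_parity; simp)+

lemma has_degree_const_fun: "a \<in> G n \<Longrightarrow> has_degree G n (const_fun a)"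
  unfolding has_degree_def
proof
  fix w assume "a \<in> G n" then show "const_fun a w \<in> G (n + wdeg w)"
    by (cases w) (simp_all add: G_intros)
qed

lemma has_degree_r: "has_degree G 2 (r i)"
  by (cases i rule: r.cases)
    (simp_all add: has_degree_const_fun curvature_degree has_degree_Y has_degree_conv[OF has_degree_sec has_degree_sec])

lemma cochain_r: "cochain scale (r i)"
  by (cases i rule: r.cases)
    (simp_all add: cochain_const_fun[OF module_axioms] cochain_Y cochain_conv cochain_sec)

text \<open>Together with the next two lemmas this is the Bianchi identity $D R_t = t\,[R_t,\mathrm{sec}]$,
coefficient by coefficient: $D r_{i+1} = [r_i, \mathrm{sec}]$, and \<open>r 2\<close> commutes with \<open>sec\<close>.\<close>

lemma D_r_0: "D 2 (r 0) w = 0"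
  by (simp add: D_const_fun d_curvature)

lemma D_r_Suc:
  assumes "i < 2"
  shows "D 2 (r (Suc i)) w = conv 1 (r i) sec w - conv 0 sec (r i) w"
proof (cases i)
  case 0
  then show ?thesis by (simp add: D_Y conv_const_left conv_const_right)
next
  case (Suc j)
  then have j: "j = 0" using assms by simp
  have "D (1 + 1) (conv 1 sec sec) w = conv 1 (D 1 sec) sec w + signed 1 (conv (1 + 1) sec (D 1 sec) w)"
    by (rule D_conv[OF has_degree_sec])
  then show ?thesis by (simp add: Suc j Y_def[symmetric] conv_even[of 2])
qed

lemma conv_r_2_sec: "conv 1 (r 2) sec w = conv 0 sec (r 2) w"
  using conv_assoc[of 1 1 sec sec sec w] by (simp add: numeral_2_eq_2 conv_even[of 2])

text \<open>The index words of the monomials in the expansion of $R_t^k$.\<close>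

definition idx :: "nat \<Rightarrow> nat list set" where "idx k = {is. length is = k \<and> set is \<subseteq> {..<3}}"

fun mon :: "nat list \<Rightarrow> 'a letter list \<Rightarrow> 'a"
  where
    "mon [] = const_fun 1"
  | "mon (i # is) = conv 0 (r i) (mon is)"

text \<open>If $R_t^k = \sum_j t^j R_{k,j}$, then this is $\sum_j c_j R_{k,j}$, the image of $R_t^k$ under the linear
functional $t^j \mapsto c_j$. The weights $c_j = 1$ and $c_j = \delta_{j0}$ are evaluation at 1 and at 0,
and $c_j = 1/(j+1)$ is integration from 0 to 1. Shifting \<open>c\<close> amounts to multiplying by powers of \<open>t\<close>.\<close>

definition S :: "nat \<Rightarrow> (nat \<Rightarrow> 'k) \<Rightarrow> 'a letter list \<Rightarrow> 'a"
  where "S k c w = (\<Sum>is\<in>idx k. scale (c (sum_list is)) (mon is w))"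

lemma idx_0: "idx 0 = {[]}" by (auto simp: idx_def)

lemma sum_idx_Suc: "(\<Sum>is\<in>idx (Suc k). f is) = (\<Sum>i<3. \<Sum>is\<in>idx k. f (i # is))"
proof -
  have "idx (Suc k) = (\<lambda>(i, is). i # is) ` ({..<3} \<times> idx k)"
    by (auto simp: idx_def length_Suc_conv)
  then have "(\<Sum>is\<in>idx (Suc k). f is) = (\<Sum>(i, is)\<in>{..<3} \<times> idx k. f (i # is))"
    by (simp add: sum.reindex inj_on_def case_prod_unfold)
  then show ?thesis by (simp add: sum.cartesian_product)
qed

lemma S_0: "S 0 c = const_fun (scale (c 0) 1)"
proof
  fix w show "S 0 c w = const_fun (scale (c 0) 1) w"
    by (cases w) (simp_all add: S_def idx_0)
qed

lemma S_Suc: "S (Suc k) c = (\<lambda>w. \<Sum>i<3. conv 0 (r i) (S k (\<lambda>j. c (i + j))) w)"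
  by (rule ext) (simp add: S_def[abs_def] sum_idx_Suc conv_sum conv_scale)

lemma has_degree_S: "has_degree G (2 * int k) (S k c)"
proof (induction k arbitrary: c)
  case 0
  then show ?case by (simp add: S_0 has_degree_const_fun one_degree subspace_scale[OF subspace_component])
next
  case (Suc k)
  have "has_degree G (2 * int (Suc k)) (conv 0 (r i) (S k (\<lambda>j. c (i + j))))" for i
  proof -
    have "has_degree G (2 * int (Suc k)) (conv (2 * int k) (r i) (S k (\<lambda>j. c (i + j))))"
      by (rule has_degree_conv[OF has_degree_r Suc.IH]) simp
    moreover have "even (2 * int k)" by simp
    ultimately show ?thesis using conv_even by metis
  qed
  then show ?case
    unfolding S_Suc has_degree_def by (intro allI subspace_sum[OF subspace_component]) blast
qed

lemma cochain_S: "cochain scale (S k c)"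
proof (induction k arbitrary: c)
  case (Suc k)
  have "cochain scale (\<lambda>w. \<Sum>i<n. conv 0 (r i) (S k (\<lambda>j. c (i + j))) w)" for n
  proof (induction n)
    case 0
    have "(\<lambda>w. \<Sum>i<0. conv 0 (r i) (S k (\<lambda>j. c (i + j))) w) = const_fun 0"
      by (rule ext) simp
    then show ?case by (simp only: cochain_const_fun[OF module_axioms])
  next
    case (Suc n)
    show ?case
      unfolding sum.lessThan_Suc
      by (intro cochain_plus module_axioms Suc.IH cochain_conv cochain_r \<open>\<And>c. cochain scale (S k c)\<close>)
  qed
  then show ?case by (simp only: S_Suc)
qed (simp add: S_0 cochain_const_fun[OF module_axioms])

lemma Q_zero: "Q (\<lambda>w. 0) w = 0"
  by (rule Q_vanishes) simp

lemma D_sum: "D n (\<lambda>w. \<Sum>i\<in>A. f i w) w = (\<Sum>i\<in>A. D n (f i) w)"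
  by (induction A rule: infinite_finite_induct)
    (simp_all add: D_def Q_add Q_zero d.add d.zero signed_add algebra_simps)

text \<open>The identity $D(R_t^k) = t\,[R_t^k, \mathrm{sec}]$. In the induction step the factor \<open>D 2 (r i)\<close>
contributes the commutator of \<open>r (i - 1)\<close> with \<open>sec\<close>. Shifting the index turns this into a sum over all
\<open>r i\<close> (the last commutator is zero), and the inner terms of the two resulting commutators cancel.\<close>

lemma D_S: "D (2 * int k) (S k c) w = conv 1 (S k (\<lambda>j. c (Suc j))) sec w - conv 0 sec (S k (\<lambda>j. c (Suc j))) w"
proof (induction k arbitrary: c w)
  case 0
  have "D 0 (const_fun (scale (c 0) 1)) w = 0"
    by (simp add: D_const_fun d_one d.scale)
  then show ?case
    by (simp add: S_0 conv_const_left conv_const_right scale_mult_left scale_mult_right)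
next
  case (Suc k)
  let ?S = "\<lambda>i. S k (\<lambda>j. c (i + j))" and ?S' = "\<lambda>i. S k (\<lambda>j. c (Suc i + j))"
  have 1: "D (2 * int (Suc k)) (conv 0 (r i) (?S i)) w
      = conv 0 (D 2 (r i)) (?S i) w + conv 1 (r i) (conv 1 (?S' i) sec) w - conv 1 (r i) (conv 0 sec (?S' i)) w" for i
  proof -
    have IH: "D (2 * int k) (?S i) = (\<lambda>w. conv 1 (?S' i) sec w - conv 0 sec (?S' i) w)"
      by (rule ext) (simp add: Suc.IH)
    have "D (2 + 2 * int k) (conv (2 * int k) (r i) (?S i)) w
      = conv (2 * int k) (D 2 (r i)) (?S i) w + signed 2 (conv (2 * int k + 1) (r i) (D (2 * int k) (?S i)) w)"
      by (rule D_conv[OF has_degree_r])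
    then show ?thesis
      by (simp add: IH conv_diff conv_even[of "2 * int k"] conv_odd[of "2 * int k + 1"] signed_def)
  qed
  have shift: "(\<Sum>i<3. conv 0 (D 2 (r i)) (?S i) w)
      = (\<Sum>i<3. conv 0 (\<lambda>w. conv 1 (r i) sec w - conv 0 sec (r i) w) (?S' i) w)"
  proof -
    have "D 2 (r 0) = (\<lambda>w. 0)" by (rule ext) (rule D_r_0)
    moreover have "D 2 (r (Suc i)) = (\<lambda>w. conv 1 (r i) sec w - conv 0 sec (r i) w)" if "i < 2" for i
      by (rule ext) (rule D_r_Suc[OF that])
    moreover have "(\<lambda>w. conv 1 (r 2) sec w - conv 0 sec (r 2) w) = (\<lambda>w. 0)"
      by (rule ext) (simp only: conv_r_2_sec diff_self)
    ultimately show ?thesis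
      by (simp add: eval_nat_numeral sum.lessThan_Suc del: r.simps)
  qed
  have 2: "conv 0 (\<lambda>w. conv 1 (r i) sec w - conv 0 sec (r i) w) (?S' i) w
      = conv 1 (r i) (conv 0 sec (?S' i)) w - conv 0 sec (conv 0 (r i) (?S' i)) w" for i
    by (simp add: conv_diff conv_assoc)
  have "D (2 * int (Suc k)) (S (Suc k) c) w = (\<Sum>i<3. D (2 * int (Suc k)) (conv 0 (r i) (?S i)) w)"
    unfolding S_Suc by (rule D_sum)
  also have "\<dots> = (\<Sum>i<3. conv 1 (r i) (conv 1 (?S' i) sec) w - conv 0 sec (conv 0 (r i) (?S' i)) w)"
    unfolding 1 sum_subtractf sum.distrib shift 2 by simp
  also have "\<dots> = (\<Sum>i<3. conv 1 (conv 0 (r i) (?S' i)) sec w - conv 0 sec (conv 0 (r i) (?S' i)) w)"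
    by (simp add: conv_assoc)
  finally show ?case
    by (simp add: S_Suc conv_sum sum_subtractf)
qed

end

section \<open>Transgression modulo the powers of the ideal\<close>

context split_ideal
begin

text \<open>$R_1$, the curvature of the section.\<close>

definition curv :: "'a letter list \<Rightarrow> 'a" where "curv w = (\<Sum>i<3. r i w)"

lemma curv_eq: "curv w = const_fun R w + Y w + conv 1 sec sec w"
  by (simp add: curv_def eval_nat_numeral sum.lessThan_Suc)

lemma curv_pair: "curv [u, v] = - signed (snd u) (graded_commutator scale G (sec [u]) (sec [v])
    - \<pi> (snd u + snd v) (graded_commutator scale G (elt u) (elt v)))"
proof -
  have "graded_commutator scale G (sec [u]) (sec [v])
      = sec [u] * sec [v] - signed (snd u * snd v) (sec [v] * sec [u])"
    by (simp add: graded_commutator_homogeneous[OF \<pi>_in[OF elt_in] \<pi>_in[OF elt_in]])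
  moreover have "Y [u, v] = signed (snd u) (\<pi> (snd u + snd v) (graded_commutator scale G (elt u) (elt v)))"
    by (simp add: Y_eq d.zero elt_br_letter graded_commutator_homogeneous[OF elt_in elt_in])
  moreover have "conv 1 sec sec [u, v] = - signed (snd u) (sec [u] * sec [v] - signed (snd u * snd v) (sec [v] * sec [u]))"
    by (cases "even (snd u)"; cases "even (snd v)") (simp_all add: signed_def sdeg_def)
  ultimately show ?thesis by (simp add: curv_eq signed_diff)
qed

text \<open>On words of length zero, one and two the curvature is \<open>R\<close>, the defect of compatibility with the
differentials, and the defect of compatibility with the brackets. All of them lie in \<open>I\<close>, since \<open>\<pi> e a\<close> and
\<open>a\<close> agree modulo \<open>I\<close> and \<open>I\<close> is stable under \<open>d\<close> and commutators.\<close>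

lemma curv_in_ideal: "curv w \<in> I"
proof -
  have mod: "\<pi> (snd v) (elt v) - elt v \<in> I" for v
    using subspace_neg[OF subspace_ideal \<pi>_modulo[OF elt_in[of v]]] by simp
  consider "w = []" | v where "w = [v]" | u v where "w = [u, v]" | u v z w' where "w = u # v # z # w'"
    by (cases w rule: remdups_adj.cases; cases "tl (tl w)") auto
  then show ?thesis
  proof cases
    case 1
    then show ?thesis by (simp add: curv_eq Y_eq d.zero curvature_ideal)
  next
    case (2 v)
    have "d (\<pi> (snd v) (elt v) - elt v) + (elt (d_letter v) - \<pi> (snd (d_letter v)) (elt (d_letter v))) \<in> I"
      by (intro subspace_add[OF subspace_ideal] d_ideal mod \<pi>_modulo[OF elt_in])
    then show ?thesis by (simp add: 2 curv_eq Y_eq elt_d_letter d.diff)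
  next
    case (3 u v)
    have "graded_commutator scale G (\<pi> (snd u) (elt u) - elt u) (sec [v])
        + graded_commutator scale G (elt u) (\<pi> (snd v) (elt v) - elt v)
        + (elt (br_letter u v) - \<pi> (snd (br_letter u v)) (elt (br_letter u v))) \<in> I"
      by (intro subspace_add[OF subspace_ideal] lie_ideal lie_ideal_right mod \<pi>_modulo[OF elt_in])
    moreover have "elt (br_letter u v) = graded_commutator scale G (elt u) (elt v)"
      by (simp add: elt_br_letter graded_commutator_homogeneous[OF elt_in elt_in])
    ultimately have "graded_commutator scale G (sec [u]) (sec [v])
        - \<pi> (snd u + snd v) (graded_commutator scale G (elt u) (elt v)) \<in> I"
      by (simp add: graded_commutator_diff_left graded_commutator_diff_right)
    then show ?thesis
      unfolding 3 curv_pair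
      by (simp add: subspace_neg[OF subspace_ideal] subspace_signed_iff[OF subspace_ideal])
  next
    case (4 u v z w')
    have "val x = 0" if "length x \<noteq> 1" for x :: "'a letter list"
      using that by (cases x rule: val.cases) auto
    then have "Q sec w = 0" by (intro Q_vanishes) (simp add: 4 sec_eq \<pi>.zero)
    moreover have "conv 1 sec sec w = 0" by (simp add: 4)
    ultimately have "curv w = 0" by (simp add: curv_eq Y_eq 4 d.zero del: Q.simps conv.simps)
    then show ?thesis by (simp add: subspace_0[OF subspace_ideal])
  qed
qed

abbreviation P :: "nat \<Rightarrow> 'a set" where "P \<equiv> power_space scale I"

lemma subspace_P: "subspace (P n)"
  unfolding power_space_def by (rule subspace_span)

lemma mult_P: "a \<in> I \<Longrightarrow> b \<in> P n \<Longrightarrow> a * b \<in> P (Suc n)"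
proof -
  assume a: "a \<in> I" and "b \<in> P n"
  then have "b \<in> span {prod_list es | es. length es = n \<and> set es \<subseteq> I}" by (simp add: power_space_def)
  then show "a * b \<in> P (Suc n)"
  proof (induction rule: span_induct_alt)
    case base
    then show ?case by (simp add: subspace_0[OF subspace_P])
  next
    case (step c x y)
    then obtain es where "x = prod_list es" "length es = n" "set es \<subseteq> I" by blast
    then have "a * x = prod_list (a # es)" "length (a # es) = Suc n" "set (a # es) \<subseteq> I" using a by simp_all
    then have "a * x \<in> P (Suc n)" unfolding power_space_def by (intro span_base) blast
    then show ?case using step.IH
      by (simp add: distrib_left scale_mult_right subspace_add[OF subspace_P] subspace_scale[OF subspace_P])
  qed
qed

lemma conv_P:
  assumes "\<And>w. \<phi> w \<in> I" "\<And>w. \<psi> w \<in> P n"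
  shows "conv m \<phi> \<psi> w \<in> P (Suc n)"
  using assms
proof (induction w arbitrary: m \<phi> \<psi>)
  case (Cons v w)
  then show ?case
    by (auto simp: subspace_signed_iff[OF subspace_P] intro!: subspace_add[OF subspace_P])
qed (simp add: mult_P)

lemma one_P: "const_fun 1 w \<in> P 0"
proof -
  have "1 \<in> {prod_list es | es. length es = 0 \<and> set es \<subseteq> I}" by force
  then have "1 \<in> P 0" unfolding power_space_def by (rule span_base)
  then show ?thesis by (cases w) (simp_all add: subspace_0[OF subspace_P])
qed

lemma S_zero [simp]: "S n (\<lambda>j. 0) = (\<lambda>w. 0)"
  by (rule ext) (simp add: S_def)

text \<open>$R_1^n$ takes values in $I^{(n)}$.\<close>

lemma S_one_P: "S n (\<lambda>j. 1) w \<in> P n"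
proof (induction n arbitrary: w)
  case (Suc n)
  have "S (Suc n) (\<lambda>j. 1) w = conv 0 curv (S n (\<lambda>j. 1)) w"
    by (simp add: S_Suc curv_def[abs_def] conv_sum)
  then show ?case using conv_P[OF curv_in_ideal Suc.IH] by simp
qed (simp add: S_0 one_P)

text \<open>$R_0^n = R^n$ takes values in $I^{(n)}$.\<close>

lemma S_delta_P: "S n (\<lambda>j. if j = 0 then 1 else 0) w \<in> P n"
proof (induction n arbitrary: w)
  case (Suc n)
  have "S (Suc n) (\<lambda>j. if j = 0 then 1 else 0) w = conv 0 (const_fun R) (S n (\<lambda>j. if j = 0 then 1 else 0)) w"
    by (simp add: S_Suc eval_nat_numeral sum.lessThan_Suc)
  moreover have "const_fun R w \<in> I" for w :: "'a letter list"
    by (cases w) (simp_all add: curvature_ideal subspace_0[OF subspace_ideal])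
  ultimately show ?case using conv_P[OF _ Suc.IH] by simp
qed (simp add: S_0 one_P)

lemma S_Nil: "S k c [] = scale (c 0) (R ^ k)"
proof (induction k arbitrary: c)
  case (Suc k)
  have "r i [] = (if i = 0 then R else 0)" for i
    by (cases i rule: r.cases) (simp_all add: Y_eq d.zero)
  then show ?case
    by (simp add: S_Suc eval_nat_numeral sum.lessThan_Suc Suc.IH scale_mult_right Y_eq d.zero)
qed (simp add: S_0)

lemma mon_append: "mon (is @ js) = conv 0 (mon is) (mon js)"
proof (induction "is")
  case Nil
  then show ?case by (simp add: fun_eq_iff conv_const_left)
next
  case (Cons i "is")
  show ?case by (rule ext) (simp add: Cons.IH conv_assoc)
qed

lemma has_degree_mon: "has_degree G (2 * int (length is)) (mon is)"
proof (induction "is")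
  case (Cons i "is")
  have "has_degree G (2 * int (length (i # is))) (conv (2 * int (length is)) (r i) (mon is))"
    by (rule has_degree_conv[OF has_degree_r Cons.IH]) simp
  then show ?case by (simp add: conv_even[of "2 * int (length is)"])
qed (simp add: has_degree_const_fun one_degree)

end

text \<open>Averaging over rotations: each letter of a word is the first letter of one of its \<open>n\<close> rotations, so in
a sum weighted by a rotation invariant function the sum of the letters may be replaced by \<open>n\<close> times the
first letter.\<close>

lemma rotate_idx_sum:
  assumes \<Lambda>: "finite \<Lambda>" "\<And>is. is \<in> \<Lambda> \<Longrightarrow> length is = n" "\<And>is. is \<in> \<Lambda> \<Longrightarrow> rotate1 is \<in> \<Lambda>"
    and g: "\<And>is. is \<in> \<Lambda> \<Longrightarrow> g (rotate1 is) = g is"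
    and V: "module sc"
  shows "(\<Sum>is\<in>\<Lambda>. sc (of_nat (sum_list is)) (g is)) = sc (of_nat n) (\<Sum>is\<in>\<Lambda>. sc (of_nat (hd is)) (g is))"
proof -
  interpret module sc by (rule V)
  have rot: "rotate l is \<in> \<Lambda> \<and> g (rotate l is) = g is" if "is \<in> \<Lambda>" for l "is"
    using that by (induction l) (simp_all add: \<Lambda>(3) g)
  have "sc (of_nat (sum_list is)) (g is) = (\<Sum>l<n. sc (of_nat (hd (rotate l is))) (g (rotate l is)))"
    if "is \<in> \<Lambda>" for "is"
  proof -
    have "sum_list is = (\<Sum>l<n. is ! l)"
      using \<Lambda>(2)[OF that] by (simp add: sum_list_sum_nth atLeast0LessThan)
    also have "\<dots> = (\<Sum>l<n. hd (rotate l is))"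
    proof (rule sum.cong[OF refl])
      fix l assume "l \<in> {..<n}"
      then have "l < length is" using \<Lambda>(2)[OF that] by simp
      moreover from this have "is \<noteq> []" by auto
      ultimately show "is ! l = hd (rotate l is)" by (simp add: hd_rotate_conv_nth)
    qed
    finally show ?thesis using rot[OF that] by (simp add: scale_sum_left)
  qed
  then have "(\<Sum>is\<in>\<Lambda>. sc (of_nat (sum_list is)) (g is))
      = (\<Sum>is\<in>\<Lambda>. \<Sum>l<n. sc (of_nat (hd (rotate l is))) (g (rotate l is)))"
    by simp
  also have "\<dots> = (\<Sum>l<n. \<Sum>is\<in>\<Lambda>. sc (of_nat (hd (rotate l is))) (g (rotate l is)))"
    by (rule sum.swap)
  also have "\<dots> = (\<Sum>l<n. \<Sum>is\<in>\<Lambda>. sc (of_nat (hd is)) (g is))"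
  proof (rule sum.cong[OF refl])
    fix l assume l: "l \<in> {..<n}"
    have "rotate (n - l) (rotate l is) = is" "rotate l (rotate (n - l) is) = is" if "is \<in> \<Lambda>" for "is"
      using l \<Lambda>(2)[OF that] by (simp_all add: rotate_rotate rotate_id)
    then show "(\<Sum>is\<in>\<Lambda>. sc (of_nat (hd (rotate l is))) (g (rotate l is))) = (\<Sum>is\<in>\<Lambda>. sc (of_nat (hd is)) (g is))"
      by (intro sum.reindex_bij_witness[of _ "rotate (n - l)" "rotate l"]) (simp_all add: rot)
  qed
  also have "\<dots> = sc (of_nat n) (\<Sum>is\<in>\<Lambda>. sc (of_nat (hd is)) (g is))"
    by (simp add: sum_constant_scale)
  finally show ?thesis .
qed

locale chern_simons = split_ideal scale G d R I \<pi> + trace_map scale G d R scaleC GC \<delta> Tr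
  for scale :: "'k::field_char_0 \<Rightarrow> 'a::{ring,monoid_mult} \<Rightarrow> 'a" and G d R I \<pi>
    and scaleC :: "'k \<Rightarrow> 'c::ab_group_add \<Rightarrow> 'c" and GC \<delta> Tr
begin

lemma Tr_mon_rotate: "Tr (mon (rotate1 is) w) = Tr (mon is w)"
proof (cases "is")
  case (Cons i js)
  have "Tr (mon (rotate1 is) w) = Tr (conv 0 (mon js) (r i) w)"
  proof -
    have "mon [i] = r i" by (rule ext) (simp add: conv_const_right)
    then show ?thesis by (simp add: Cons mon_append del: mon.simps)
  qed
  also have "\<dots> = Tr (conv 2 (mon js) (r i) w)" by (simp add: conv_even[of 2])
  also have "\<dots> = Tr (conv (2 * int (length js)) (r i) (mon js) w)"
    using Tr_conv_swap[OF has_degree_mon has_degree_r, of js i w] by (simp add: signed_def)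
  also have "\<dots> = Tr (mon is w)" by (simp add: Cons conv_even[of "2 * int (length js)"])
  finally show ?thesis .
qed simp

lemma finite_idx: "finite (idx k)"
  unfolding idx_def by (rule finite_subset[OF _ finite_lists_length_eq[of "{..<3}" k]]) auto

text \<open>The identity $t\frac{d}{dt}\operatorname{Tr}(R_t^{k+1}) =
(k+1)\operatorname{Tr}(t\frac{dR_t}{dt} R_t^k)$, in the monomial expansion: the derivative multiplies a
monomial by the sum of its indices, and the trace is invariant under rotation of the monomial.\<close>

lemma Tr_cyclic:
  "Tr (S (Suc k) (\<lambda>j. of_nat j * c j) w)
    = scaleC (of_nat (Suc k)) (\<Sum>i<3. scaleC (of_nat i) (Tr (conv 0 (r i) (S k (\<lambda>j. c (i + j))) w)))"
proof -
  let ?g = "\<lambda>is. scaleC (c (sum_list is)) (Tr (mon is w))"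
  have sl: "sum_list (rotate1 is) = sum_list is" for "is" :: "nat list" by (cases "is") simp_all
  have "Tr (S (Suc k) (\<lambda>j. of_nat j * c j) w) = (\<Sum>is\<in>idx (Suc k). scaleC (of_nat (sum_list is)) (?g is))"
    by (simp add: S_def Tr.sum Tr.scale)
  also have "\<dots> = scaleC (of_nat (Suc k)) (\<Sum>is\<in>idx (Suc k). scaleC (of_nat (hd is)) (?g is))"
    by (rule rotate_idx_sum[OF finite_idx]) (auto simp: idx_def Tr_mon_rotate sl C.module_axioms)
  also have "(\<Sum>is\<in>idx (Suc k). scaleC (of_nat (hd is)) (?g is))
      = (\<Sum>i<3. scaleC (of_nat i) (\<Sum>is\<in>idx k. scaleC (c (i + sum_list is)) (Tr (conv 0 (r i) (mon is) w))))"
    unfolding sum_idx_Suc by (simp add: C.scale_sum_right)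
  also have "\<dots> = (\<Sum>i<3. scaleC (of_nat i) (Tr (conv 0 (r i) (S k (\<lambda>j. c (i + j))) w)))"
    by (simp add: S_def[abs_def] conv_sum conv_scale Tr.sum Tr.scale)
  finally show ?thesis .
qed

text \<open>The weights of $\int_0^1 t^{j-1}\,dt$; the value 0 at \<open>j = 0\<close> makes \<open>of_nat j * wt j\<close> the indicator of
\<open>j > 0\<close>, which is evaluation at 1 minus evaluation at 0.\<close>

abbreviation wt :: "nat \<Rightarrow> 'k" where "wt j \<equiv> 1 / of_nat j"

text \<open>$\int_0^1 \mathrm{sec}\,R_t^k\,dt$.\<close>

definition CS :: "nat \<Rightarrow> 'a letter list \<Rightarrow> 'a"
  where "CS k = conv 0 sec (S k (\<lambda>j. wt (Suc j)))"

lemma has_degree_CS: "has_degree G (2 * int k + 1) (CS k)"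
proof -
  have "has_degree G (2 * int k + 1) (conv (2 * int k) sec (S k (\<lambda>j. wt (Suc j))))"
    by (rule has_degree_conv[OF has_degree_sec has_degree_S]) simp
  then show ?thesis by (simp add: CS_def conv_even[of "2 * int k"])
qed

lemma cochain_CS: "cochain scale (CS k)"
  unfolding CS_def by (intro cochain_conv cochain_sec cochain_S)

text \<open>The derivation rule gives $D(\mathrm{sec}\,R_t^k) = D(\mathrm{sec})R_t^k - t\,\mathrm{sec}\,[R_t^k,\mathrm{sec}]$.
As \<open>sec\<close> is odd, under the trace the last term contributes $2t\,\mathrm{sec}^2 R_t^k$. Altogether this is
the trace of $\frac{dR_t}{dt} R_t^k$, to be integrated over \<open>t\<close>.\<close>

lemma Tr_D_CS_eq_sum:
  "Tr (D (2 * int k + 1) (CS k) w) = (\<Sum>i<3. scaleC (of_nat i) (Tr (conv 0 (r i) (S k (\<lambda>j. wt (i + j))) w)))"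
proof -
  define S1 S2 where "S1 = S k (\<lambda>j. wt (Suc j))" and "S2 = S k (\<lambda>j. wt (Suc (Suc j)))"
  have CS: "CS k = conv 0 sec S1" by (simp only: CS_def S1_def)
  have deg: "has_degree G (2 * int k) S2" unfolding S2_def by (rule has_degree_S)
  have DS: "D (2 * int k) S1 = (\<lambda>w. conv 1 S2 sec w - conv 0 sec S2 w)"
    unfolding S1_def S2_def by (rule ext) (rule D_S)
  have "D (1 + 2 * int k) (conv (2 * int k) sec S1) w
      = conv (2 * int k) (D 1 sec) S1 w + signed 1 (conv (2 * int k + 1) sec (D (2 * int k) S1) w)"
    by (rule D_conv[OF has_degree_sec])
  then have D: "D (2 * int k + 1) (CS k) w = conv 0 Y S1 w - conv 1 (conv 0 sec S2) sec w + conv 0 (conv 1 sec sec) S2 w"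
    by (simp add: CS DS conv_diff conv_assoc conv_even[of "2 * int k"] conv_odd[of "1 + 2 * int k"] Y_def add.commute)
  have "has_degree G (2 * int k + 1) (conv (2 * int k) sec S2)"
    by (rule has_degree_conv[OF has_degree_sec deg]) simp
  then have "has_degree G (2 * int k + 1) (conv 0 sec S2)"
    by (simp add: conv_even[of "2 * int k"])
  from Tr_conv_swap[OF this has_degree_sec, of w]
  have "Tr (conv 1 (conv 0 sec S2) sec w) = - Tr (conv 1 sec (conv 0 sec S2) w)"
    by (simp add: signed_def conv_odd[of "2 * int k + 1"])
  also have "conv 1 sec (conv 0 sec S2) w = conv 0 (conv 1 sec sec) S2 w"
    by (simp add: conv_assoc)
  finally have "Tr (D (2 * int k + 1) (CS k) w) = Tr (conv 0 Y S1 w) + scaleC 2 (Tr (conv 0 (conv 1 sec sec) S2 w))"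
    unfolding D using C.scale_left_distrib[of 1 1] by (simp add: Tr.add Tr.diff)
  then show ?thesis
    unfolding S1_def S2_def by (simp add: eval_nat_numeral sum.lessThan_Suc)
qed

abbreviation W where "W k \<equiv> Tr ` right_multiples scale (P (k + 1))"

lemma subspace_W: "C.subspace (W k)"
  unfolding right_multiples_def by (rule Tr.subspace_image) (rule subspace_span)

lemma Tr_P_W: "a \<in> P (Suc k) \<Longrightarrow> Tr a \<in> W k"
proof -
  assume "a \<in> P (Suc k)"
  then have "a \<in> P (k + 1)" by simp
  then have "a * 1 \<in> right_multiples scale (P (k + 1))"
    unfolding right_multiples_def by (intro span_base) blast
  then have "Tr (a * 1) \<in> W k" by (rule imageI)
  then show ?thesis by simp
qed

text \<open>By \<open>Tr_cyclic\<close>, \<open>k + 1\<close> times this trace is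
$\operatorname{Tr}(R_1^{k+1}) - \operatorname{Tr}(R_0^{k+1})$.\<close>

lemma Tr_D_CS: "Tr (D (2 * int k + 1) (CS k) w) \<in> W k"
proof -
  have "(\<lambda>j. of_nat j * wt j) = (\<lambda>j. 1 - (if j = 0 then 1 else 0))" by auto
  then have "S (Suc k) (\<lambda>j. of_nat j * wt j) w
      = S (Suc k) (\<lambda>j. 1) w - S (Suc k) (\<lambda>j. if j = 0 then 1 else 0) w"
    by (simp add: S_def scale_left_diff_distrib sum_subtractf)
  then have "S (Suc k) (\<lambda>j. of_nat j * wt j) w \<in> P (Suc k)"
    using subspace_diff[OF subspace_P S_one_P S_delta_P] by simp
  then have "Tr (S (Suc k) (\<lambda>j. of_nat j * wt j) w) \<in> W k"
    by (rule Tr_P_W)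
  then have "scaleC (of_nat (Suc k)) (Tr (D (2 * int k + 1) (CS k) w)) \<in> W k"
    by (simp only: Tr_D_CS_eq_sum Tr_cyclic)
  from C.subspace_scale[OF subspace_W this, of "1 / of_nat (Suc k)"]
  show ?thesis by (simp del: of_nat_Suc)
qed

text \<open>Needed for the differential of $C/\operatorname{Tr}(I^{(k+1)}A)$ to be well defined. The Leibniz rule
applies to homogeneous factors, and the components of elements of \<open>I\<close> lie again in \<open>I\<close>.\<close>

lemma d_right_multiples:
  assumes "a \<in> right_multiples scale (P n)" shows "d a \<in> right_multiples scale (P n)"
proof -
  let ?J = "\<lambda>n. right_multiples scale (P n)"
  have sub: "subspace (?J n)" for n unfolding right_multiples_def by (rule subspace_span)
  have prod: "prod_list es * b \<in> ?J n" if "length es = n" "set es \<subseteq> I" for es b n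
  proof -
    have "prod_list es \<in> P n" unfolding power_space_def using that by (intro span_base) blast
    then show ?thesis unfolding right_multiples_def by (intro span_base) blast
  qed
  have mult: "e * b \<in> ?J (Suc n)" if "e \<in> I" "b \<in> ?J n" for e b n
  proof -
    from that(2) have "b \<in> span {p * a |p a. p \<in> P n}" by (simp add: right_multiples_def)
    then show ?thesis
    proof (induction rule: span_induct_alt)
      case (step c x y)
      then obtain p a where "x = p * a" "p \<in> P n" by blast
      then have "e * x = (e * p) * a" "e * p \<in> P (Suc n)" using that(1) by (simp_all add: mult.assoc mult_P)
      then have "e * x \<in> ?J (Suc n)" unfolding right_multiples_def by (intro span_base) blast
      then show ?case using step.IH
        by (simp add: distrib_left scale_mult_right subspace_add[OF sub] subspace_scale[OF sub])
    qed (simp add: subspace_0[OF sub])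
  qed
  have d_prod: "d (prod_list es * b) \<in> ?J n" if "length es = n" "set es \<subseteq> I" for es b n
    using that
  proof (induction es arbitrary: n)
    case Nil
    then show ?case using prod[of "[]" 0 "d b"] by simp
  next
    case (Cons e es)
    let ?y = "prod_list es * b"
    have "d (component G e i * ?y) \<in> ?J n" for i
    proof -
      have e: "component G e i \<in> I" using Cons.prems by (simp add: homogeneous_ideal)
      have "d (component G e i) * ?y \<in> ?J (Suc (length es))"
        by (rule mult[OF d_ideal[OF e] prod]) (use Cons.prems in auto)
      moreover have "component G e i * d ?y \<in> ?J (Suc (length es))"
        by (rule mult[OF e Cons.IH]) (use Cons.prems in auto)
      ultimately show ?thesis
        using Cons.prems by (auto simp: leibniz_signed[OF component_in] subspace_signed_iff[OF sub] intro!: subspace_add[OF sub])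
    qed
    then have "d (\<Sum>i | component G e i \<noteq> 0. component G e i * ?y) \<in> ?J n"
      unfolding d.sum by (intro subspace_sum[OF sub])
    moreover have "(\<Sum>i | component G e i \<noteq> 0. component G e i * ?y) = prod_list (e # es) * b"
      by (simp add: sum_distrib_right[symmetric] component_sum mult.assoc)
    ultimately show ?case by simp
  qed
  have d_mult: "d (p * b) \<in> ?J n" if "p \<in> P n" for p b
  proof -
    from that have "p \<in> span {prod_list es | es. length es = n \<and> set es \<subseteq> I}" by (simp add: power_space_def)
    then show ?thesis
    proof (induction rule: span_induct_alt)
      case (step c x y)
      then have "d (x * b) \<in> ?J n" using d_prod by blast
      then show ?case using step.IH
        by (simp add: distrib_right scale_mult_left d.add d.scale subspace_add[OF sub] subspace_scale[OF sub])
    qed (simp add: d.zero subspace_0[OF sub])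
  qed
  from assms have "a \<in> span {p * b |p b. p \<in> P n}" by (simp add: right_multiples_def)
  then show ?thesis
  proof (induction rule: span_induct_alt)
    case (step c x y)
    then have "d x \<in> ?J n" using d_mult by blast
    then show ?case using step.IH
      by (simp add: d.add d.scale subspace_add[OF sub] subspace_scale[OF sub])
  qed (simp add: d.zero subspace_0[OF sub])
qed

text \<open>On a letter \<open>v\<close> the Chern--Simons form is $\pi(v)R^k$, as all other coefficients of $R_t^k$ vanish on
the empty word. Replacing \<open>\<pi> e a\<close> by \<open>a\<close> changes its trace by an element of $\operatorname{Tr}(I^{(k+1)})$.\<close>

theorem chern_simons_L_infinity:
  obtains \<eta> where
    "L_infinity_morphism L (shift_complex (2 * int k) (quotient_complex scaleC GC \<delta> (W k))) \<eta>"
    "\<And>a. linear_component L \<eta> (a +o I) = scaleC (1 / fact k) (Tr (R ^ k * a)) +o W k"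
proof -
  interpret \<delta>: Vector_Spaces.linear scaleC scaleC \<delta> by (rule C.linear_diff)
  define f where "f w = scaleC (1 / fact k) (Tr (CS k w))" for w
  have lin: "Vector_Spaces.linear scale scaleC (\<lambda>a. scaleC (1 / fact k) (Tr a))"
    by unfold_locales (simp_all add: Tr.add Tr.scale C.scale_right_distrib mult.commute)
  have complex: "cochain_complex scaleC GC \<delta>" by unfold_locales
  have closed: "\<delta> c \<in> W k" if "c \<in> W k" for c
    using that d_right_multiples by (auto simp: Tr_d[symmetric])
  have cf: "cochain scaleC f"
    using cochain_linear[OF lin cochain_CS] by (simp add: f_def[abs_def])
  have deg: "has_degree GC (2 * int k + 1) f"
    unfolding has_degree_def f_def
    by (intro allI C.subspace_scale[OF C.subspace_component] degree_Tr has_degreeD[OF has_degree_CS])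
  have f0: "f [] = 0" by (simp add: f_def CS_def Tr.zero)
  have eq: "\<delta> (f w) + Q f w \<in> W k" for w
  proof -
    have "additive (\<lambda>a. scaleC (1 / fact k) (Tr a))"
      by (simp add: additive_def Tr.add C.scale_right_distrib)
    then have "Q f w = scaleC (1 / fact k) (Tr (Q (CS k) w))"
      unfolding f_def[abs_def] by (rule Q_additive)
    moreover have "\<delta> (f w) = scaleC (1 / fact k) (Tr (d (CS k w)))"
      by (simp add: f_def Tr_d \<delta>.scale)
    ultimately have "\<delta> (f w) + Q f w = scaleC (1 / fact k) (Tr (D (2 * int k + 1) (CS k) w))"
      by (simp add: D_def Tr.add C.scale_right_distrib signed_def)
    then show ?thesis using C.subspace_scale[OF subspace_W Tr_D_CS] by simp
  qed
  obtain \<eta> where \<eta>: "L_infinity_morphism L (shift_complex (2 * int k) (quotient_complex scaleC GC \<delta> (W k))) \<eta>"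
    "\<And>a. linear_component L \<eta> (a +o I) = (\<Sum>i | component G a i \<noteq> 0. f [(a, i)]) +o W k"
    by (rule L_infinity_morphism_of_cochain[OF complex subspace_W closed cf deg f0 eq]) simp_all
  have Rk: "R ^ n \<in> G (2 * int n)" for n
    by (induction n) (auto simp: one_degree intro!: mult_in[OF curvature_degree])
  have f1: "f [v] - scaleC (1 / fact k) (Tr (R ^ k * elt v)) \<in> W k" for v
  proof -
    have "CS k [v] = \<pi> (snd v) (elt v) * R ^ k"
      by (simp add: CS_def S_Nil)
    then have "Tr (CS k [v]) = Tr (R ^ k * \<pi> (snd v) (elt v))"
      using Tr_swap[OF \<pi>_in[OF elt_in] Rk, of v k] by (simp add: signed_def)
    moreover have "R ^ k * (\<pi> (snd v) (elt v) - elt v) \<in> P (Suc k)"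
    proof -
      have "R ^ n * e \<in> P (Suc n)" if "e \<in> I" for n e
      proof -
        have "R ^ n * e = prod_list (replicate n R @ [e])" by (simp add: prod_list_replicate)
        moreover have "length (replicate n R @ [e]) = Suc n" "set (replicate n R @ [e]) \<subseteq> I"
          using that curvature_ideal by auto
        ultimately show ?thesis unfolding power_space_def by (intro span_base) blast
      qed
      then show ?thesis
        using subspace_neg[OF subspace_ideal \<pi>_modulo[OF elt_in[of v]]] by simp
    qed
    from C.subspace_scale[OF subspace_W Tr_P_W[OF this], of "1 / fact k"]
    have "scaleC (1 / fact k) (Tr (R ^ k * (\<pi> (snd v) (elt v) - elt v))) \<in> W k" .
    ultimately show ?thesis
      by (simp add: f_def right_diff_distrib Tr.diff C.scale_right_diff_distrib)
  qed
  have "(\<Sum>i | component G a i \<noteq> 0. f [(a, i)]) +o W k = scaleC (1 / fact k) (Tr (R ^ k * a)) +o W k" for a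
  proof -
    let ?A = "{i. component G a i \<noteq> 0}"
    have "(\<Sum>i\<in>?A. f [(a, i)] - scaleC (1 / fact k) (Tr (R ^ k * elt (a, i)))) \<in> W k"
      by (intro C.subspace_sum[OF subspace_W] f1)
    moreover have "(\<Sum>i\<in>?A. scaleC (1 / fact k) (Tr (R ^ k * elt (a, i)))) = scaleC (1 / fact k) (Tr (R ^ k * a))"
      by (simp add: C.scale_sum_right[symmetric] Tr.sum[symmetric] sum_distrib_left[symmetric] elt_def component_sum)
    ultimately show ?thesis
      unfolding C.coset_eq_iff[OF subspace_W] by (simp add: sum_subtractf)
  qed
  then show ?thesis using that[OF \<eta>(1)] \<eta>(2) by simp
qed

end

theorem corollary2p10:
  fixes scaleA :: "'k::field_char_0 \<Rightarrow> 'a::{ring,monoid_mult} \<Rightarrow> 'a"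
    and GA :: "int \<Rightarrow> 'a set" and d :: "'a \<Rightarrow> 'a" and R :: 'a and I :: "'a set"
    and scaleC :: "'k \<Rightarrow> 'c::ab_group_add \<Rightarrow> 'c"
    and GC :: "int \<Rightarrow> 'c set" and \<delta> :: "'c \<Rightarrow> 'c" and Tr :: "'a \<Rightarrow> 'c"
    and k :: nat
  defines "L \<equiv> quotient_dg_lie scaleA GA d I"
    and "W \<equiv> Tr ` right_multiples scaleA (power_space scaleA I (k + 1))"
  defines "M \<equiv> shift_complex (2 * int k) (quotient_complex scaleC GC \<delta> W)"
  assumes "curved_dg_algebra scaleA GA d R"
    and "curved_lie_ideal scaleA GA d R I"
    and "trace_map scaleA GA d R scaleC GC \<delta> Tr"
  shows "\<exists>\<eta>. L_infinity_morphism L M \<eta> \<and>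
    (\<forall>x. linear_component L \<eta> (x +o I) = scaleC (1 / fact k) (Tr (R ^ k * x)) +o W)"
proof -
  interpret curved_lie_ideal scaleA GA d R I by fact
  have "\<forall>e. \<exists>f. Vector_Spaces.linear scaleA scaleA f \<and>
      (\<forall>a\<in>GA e. f a \<in> GA e \<and> a - f a \<in> I \<and> (a \<in> I \<longrightarrow> f a = 0))"
  proof
    fix e
    have "subspace (I \<inter> GA e)" using subspace_ideal subspace_component by (rule subspace_inter)
    then obtain f where "Vector_Spaces.linear scaleA scaleA f" "\<And>u. u \<in> GA e \<Longrightarrow> f u \<in> GA e"
      "\<And>u. u \<in> GA e \<Longrightarrow> u - f u \<in> I \<inter> GA e" "\<And>u. u \<in> I \<inter> GA e \<Longrightarrow> f u = 0"
      by (rule projection_along_subspace[OF _ subspace_component[of e]]) auto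
    then show "\<exists>f. Vector_Spaces.linear scaleA scaleA f \<and>
      (\<forall>a\<in>GA e. f a \<in> GA e \<and> a - f a \<in> I \<and> (a \<in> I \<longrightarrow> f a = 0))" by blast
  qed
  from choice[OF this] obtain \<pi> where \<pi>: "\<And>e. Vector_Spaces.linear scaleA scaleA (\<pi> e) \<and>
      (\<forall>a\<in>GA e. \<pi> e a \<in> GA e \<and> a - \<pi> e a \<in> I \<and> (a \<in> I \<longrightarrow> \<pi> e a = 0))"
    by blast
  have split: "split_ideal scaleA GA d R I \<pi>"
    by (intro split_ideal.intro split_ideal_axioms.intro curved_lie_ideal_axioms) (use \<pi> in blast)+
  interpret chern_simons scaleA GA d R I \<pi> scaleC GC \<delta> Tr
    by (rule chern_simons.intro[OF split]) fact
  show ?thesis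
    unfolding L_def M_def W_def by (rule chern_simons_L_infinity[of k]) blast
qed

end
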